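(* Let $f:\mathbb R^n\to\mathbb R^n$ ($n\ge 2$) be smooth, let $x^\star$ be a non-trivial $T$-periodic solution of $\dot x=f(x)$ (with $T>0$ its minimal period) such that $f(x^\star(t))\neq0$ for all $t$, and let $z(\cdot)$, $\Pi(\cdot)$, the coordinates $(x_\perp,\tau)$ and the $T$-periodic matrix function $A(\cdot)$ be as in the context. The following statements are equivalent: 1. $x^\star$ is an exponentially orbitally stable $T$-periodic solution of $\dot x=f(x)$. 2. The transverse linearization, i.e. the $(n-1)$-dimensional $T$-periodic linear system $\dot\zeta=A(t)\zeta$, is exponentially stable. 3. For each SPPD $Q(t)$ there exists a unique SPPD solution $P(t)$ of the periodic Lyapunov equation $$\dot P(t)+A(t)^\top P(t)+P(t)A(t)+Q(t)=0.$$ Furthermore, for a sufficiently small region around $x^\star$ the Lyapunov function $V(x)=x_\perp^\top P(\tau)x_\perp$ verifies exponential orbital stability of $x^\star$.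
   Context: Vectors are columns and $^\top$ denotes transpose. $\Phi(x_0,t)$ is the solution at time $t$ of $\dot x=f(x)$, $x(0)=x_0$; $\Gamma^\star=\{x^\star(t):t\in[0,T)\}$; $\operatorname{dist}(x,\Gamma^\star)=\inf_{y\in\Gamma^\star}|y-x|$ (Euclidean norm). $x^\star$ is asymptotically orbitally stable if there is $b>0$ such that for every $x_0$ with $\operatorname{dist}(x_0,\Gamma^\star)<b$ the solution exists, is unique, and $\operatorname{dist}(\Phi(x_0,t),\Gamma^\star)\to0$ as $t\to\infty$. It is exponentially orbitally stable if, furthermore, there are $b,K,c>0$ such that $\operatorname{dist}(\Phi(x_0,t),\Gamma^\star)\le K\operatorname{dist}(x_0,\Gamma^\star)e^{-ct}$ for all $t\ge0$ whenever $\operatorname{dist}(x_0,\Gamma^\star)<b$. SPPD means symmetric, $T$-periodic and positive definite for every $t$ (matrix function of size $(n-1)\times(n-1)$; $Q$ continuous, $P$ continuously differentiable). Transversal normal field: $z:\mathbb R\to\mathbb R^n$ is smooth, $T$-periodic, with bounded derivative, $\|z(\tau)\|=1$, and $z(\tau)^\top f(x^\star(\tau))>\delta$ for all $\tau$ and some $\delta>0$. Projection operator: for $n\ge3$, fix an orthonormal basis $\eta_1,\dots,\eta_n$ of $\mathbb R^n$ such that $\eta_1$ is not collinear with $z(\tau)$ for any $\tau$, and set $\xi_j(\tau)=\eta_j-\frac{\eta_j^\top z(\tau)}{1+\eta_1^\top z(\tau)}(\eta_1+z(\tau))$ for $j=2,\dots,n$; for $n=2$ set $\xi_2(\tau)=(-z_2(\tau),z_1(\tau))^\top$.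 $\Pi(\tau)$ is the $(n-1)\times n$ matrix with rows $\xi_2(\tau)^\top,\dots,\xi_n(\tau)^\top$. Coordinates: for $x$ in a sufficiently small neighbourhood of $\Gamma^\star$, $(x_\perp,\tau)\in\mathbb R^{n-1}\times(\mathbb R/T\mathbb Z)$ with $x_\perp$ small is determined by $z(\tau)^\top(x-x^\star(\tau))=0$ and $x_\perp=\Pi(\tau)(x-x^\star(\tau))$, equivalently $x=x^\star(\tau)+\Pi(\tau)^\top x_\perp$. Transverse linearization matrix: $$A(t)=\Big[\frac{d}{dt}\Pi(t)\Big]\Pi(t)^\top+\Pi(t)\frac{\partial f(x^\star(t))}{\partial x}\Pi(t)^\top-\Pi(t)f(x^\star(t))\,\frac{z(t)^\top\frac{\partial f(x^\star(t))}{\partial x}\Pi(t)^\top+\dot z(t)^\top\Pi(t)^\top}{z(t)^\top f(x^\star(t))}.$$ "$V$ verifies exponential orbital stability of $x^\star$ for a sufficiently small region around $x^\star$" means that $V$ is a Lyapunov function for exponential convergence to $\Gamma^\star$ there: there are a neighbourhood $U$ of $\Gamma^\star$ and constants $k_1,k_2,k_3>0$ such that for all $x\in U$, $k_1\operatorname{dist}(x,\Gamma^\star)^2\le V(x)\le k_2\operatorname{dist}(x,\Gamma^\star)^2$ and the derivative of $V$ along solutions of $\dot x=f(x)$ satisfies $\dot V(x)\le-k_3\operatorname{dist}(x,\Gamma^\star)^2$. *)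

theory Defs
  imports "HOL-Analysis.Analysis"
begin

section \<open>Smooth maps\<close>

fun Ck :: "nat \<Rightarrow> ('a::real_normed_vector \<Rightarrow> 'b::real_normed_vector) \<Rightarrow> bool" where
  "Ck 0 g \<longleftrightarrow> continuous_on UNIV g"
| "Ck (Suc k) g \<longleftrightarrow>
     (\<forall>x. g differentiable (at x)) \<and> (\<forall>v. Ck k (\<lambda>x. frechet_derivative g (at x) v))"

text \<open>In finite dimension, continuity of all iterated directional derivatives is the usual
  notion of being infinitely often continuously differentiable.\<close>

definition smooth :: "('a::euclidean_space \<Rightarrow> 'b::real_normed_vector) \<Rightarrow> bool" where
  "smooth g \<longleftrightarrow> (\<forall>k. Ck k g)"

definition jacobian :: "(real^'n \<Rightarrow> real^'n) \<Rightarrow> real^'n \<Rightarrow> real^'n^'n" where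
  "jacobian f x = matrix (frechet_derivative f (at x))"

section \<open>Solutions and orbital stability\<close>

definition ode_solution ::
  "(real \<Rightarrow> 'a \<Rightarrow> 'a) \<Rightarrow> real set \<Rightarrow> (real \<Rightarrow> 'a::real_normed_vector) \<Rightarrow> bool" where
  "ode_solution F S x \<longleftrightarrow> (\<forall>t\<in>S. (x has_vector_derivative F t (x t)) (at t within S))"

text \<open>\<open>x\<close> restricted to \<open>{0..}\<close> is the function \<open>t \<mapsto> \<Phi>(x0,t)\<close>: it exists for all forward time
  and every other solution from \<open>x0\<close>, even if only defined on a bounded interval, agrees with it.\<close>

definition unique_forward_solution ::
  "('a::real_normed_vector \<Rightarrow> 'a) \<Rightarrow> 'a \<Rightarrow> (real \<Rightarrow> 'a) \<Rightarrow> bool" where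
  "unique_forward_solution f x0 x \<longleftrightarrow>
     x 0 = x0 \<and> ode_solution (\<lambda>_. f) {0..} x \<and>
     (\<forall>s\<ge>0. \<forall>y. y 0 = x0 \<and> ode_solution (\<lambda>_. f) {0..s} y \<longrightarrow> (\<forall>t\<in>{0..s}. y t = x t))"

definition nontrivial_periodic_solution ::
  "(real^'n \<Rightarrow> real^'n) \<Rightarrow> real \<Rightarrow> (real \<Rightarrow> real^'n) \<Rightarrow> bool" where
  "nontrivial_periodic_solution f T xs \<longleftrightarrow>
     T > 0 \<and> ode_solution (\<lambda>_. f) UNIV xs \<and> (\<forall>t. xs (t + T) = xs t) \<and>
     (\<forall>s. 0 < s \<and> s < T \<longrightarrow> \<not> (\<forall>t. xs (t + s) = xs t)) \<and>
     (\<forall>t. f (xs t) \<noteq> 0)"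

definition orbit :: "real \<Rightarrow> (real \<Rightarrow> 'a) \<Rightarrow> 'a set" where
  "orbit T xs = xs ` {0..<T}"

definition asymptotically_orbitally_stable ::
  "('a::real_normed_vector \<Rightarrow> 'a) \<Rightarrow> 'a set \<Rightarrow> bool" where
  "asymptotically_orbitally_stable f \<Gamma> \<longleftrightarrow>
     (\<exists>b>0. \<forall>x0. infdist x0 \<Gamma> < b \<longrightarrow>
        (\<exists>x. unique_forward_solution f x0 x \<and> ((\<lambda>t. infdist (x t) \<Gamma>) \<longlongrightarrow> 0) at_top))"

definition exponentially_orbitally_stable ::
  "('a::real_normed_vector \<Rightarrow> 'a) \<Rightarrow> 'a set \<Rightarrow> bool" where
  "exponentially_orbitally_stable f \<Gamma> \<longleftrightarrow>
     asymptotically_orbitally_stable f \<Gamma> \<and>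
     (\<exists>b>0. \<exists>K>0. \<exists>c>0. \<forall>x0. infdist x0 \<Gamma> < b \<longrightarrow>
        (\<exists>x. unique_forward_solution f x0 x \<and>
             (\<forall>t\<ge>0. infdist (x t) \<Gamma> \<le> K * infdist x0 \<Gamma> * exp (- c * t))))"

definition linear_system_exponentially_stable :: "(real \<Rightarrow> real^'m^'m) \<Rightarrow> bool" where
  "linear_system_exponentially_stable A \<longleftrightarrow>
     (\<exists>K>0. \<exists>c>0. \<forall>t0 \<zeta>. ode_solution (\<lambda>t v. A t *v v) {t0..} \<zeta> \<longrightarrow>
        (\<forall>t\<ge>t0. norm (\<zeta> t) \<le> K * exp (- c * (t - t0)) * norm (\<zeta> t0)))"

section \<open>Transversal frame and transverse linearization\<close>

definition transversal_normal_field ::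
  "(real^'n \<Rightarrow> real^'n) \<Rightarrow> real \<Rightarrow> (real \<Rightarrow> real^'n) \<Rightarrow> (real \<Rightarrow> real^'n) \<Rightarrow> bool" where
  "transversal_normal_field f T xs z \<longleftrightarrow>
     smooth z \<and> (\<forall>\<tau>. z (\<tau> + T) = z \<tau>) \<and>
     bounded (range (\<lambda>\<tau>. vector_derivative z (at \<tau>))) \<and>
     (\<forall>\<tau>. norm (z \<tau>) = 1) \<and> (\<exists>\<delta>>0. \<forall>\<tau>. z \<tau> \<bullet> f (xs \<tau>) > \<delta>)"

text \<open>Throughout, \<open>'n\<close> has one element more than \<open>'m\<close>, and \<open>'m\<close> plays the role of the index
  range \<open>2,\<dots>,n\<close>. A basis \<open>\<eta>\<^sub>1,\<dots>,\<eta>\<^sub>n\<close> is a family over \<open>'m option\<close>, with \<open>\<eta> None\<close>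
  standing for \<open>\<eta>\<^sub>1\<close>.\<close>

definition orthonormal_basis :: "('k::finite \<Rightarrow> real^'n) \<Rightarrow> bool" where
  "orthonormal_basis \<eta> \<longleftrightarrow>
     (\<forall>i j. \<eta> i \<bullet> \<eta> j = (if i = j then 1 else 0)) \<and> span (range \<eta>) = UNIV"

text \<open>The indices \<open>i1\<close> and \<open>i2\<close> name the first and the second coordinate; they and the planar
  formula are used only for \<open>n = 2\<close>, and \<open>\<eta>\<close> only for \<open>n \<ge> 3\<close>.\<close>

definition frame_vector ::
  "'n \<Rightarrow> 'n \<Rightarrow> ('m option \<Rightarrow> real^'n) \<Rightarrow> (real \<Rightarrow> real^'n) \<Rightarrow> real \<Rightarrow> 'm::finite \<Rightarrow> real^'n" where
  "frame_vector i1 i2 \<eta> z \<tau> j =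
     (if CARD('n) = 2
      then (\<chi> i. if i = i1 then - (z \<tau> $ i2) else z \<tau> $ i1)
      else \<eta> (Some j) -
           ((\<eta> (Some j) \<bullet> z \<tau>) / (1 + \<eta> None \<bullet> z \<tau>)) *\<^sub>R (\<eta> None + z \<tau>))"

definition projection ::
  "'n \<Rightarrow> 'n \<Rightarrow> ('m::finite option \<Rightarrow> real^'n) \<Rightarrow> (real \<Rightarrow> real^'n) \<Rightarrow> real \<Rightarrow> real^'n^'m" where
  "projection i1 i2 \<eta> z \<tau> = (\<chi> j. frame_vector i1 i2 \<eta> z \<tau> j)"

definition transverse_linearization ::
  "(real^'n \<Rightarrow> real^'n) \<Rightarrow> (real \<Rightarrow> real^'n) \<Rightarrow> (real \<Rightarrow> real^'n) \<Rightarrow> (real \<Rightarrow> real^'n^'m) \<Rightarrow>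
   real \<Rightarrow> real^'m^'m" where
  "transverse_linearization f xs z Pm t =
     (let J = jacobian f (xs t);
          c = Pm t *v f (xs t);
          r = (1 / (z t \<bullet> f (xs t))) *\<^sub>R
                  (z t v* (J ** transpose (Pm t)) +
                   vector_derivative z (at t) v* transpose (Pm t))
      in vector_derivative Pm (at t) ** transpose (Pm t)
         + Pm t ** J ** transpose (Pm t)
         - (\<chi> i j. c $ i * r $ j))"

text \<open>The circle \<open>\<real>/T\<int>\<close> is represented by \<open>{0..<T}\<close>. A point may lie on the transversal
  hyperplanes at several \<open>\<tau>\<close>; the bound \<open>r\<close> makes precise that \<open>xp x\<close> (the coordinate
  \<open>x\<^sub>\<bottom>\<close>) is small, which singles out one of them.\<close>

definition transverse_coordinates ::
  "real \<Rightarrow> (real \<Rightarrow> real^'n) \<Rightarrow> (real \<Rightarrow> real^'n) \<Rightarrow> (real \<Rightarrow> real^'n^'m) \<Rightarrow>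
   (real^'n) set \<Rightarrow> real \<Rightarrow> (real^'n \<Rightarrow> real^'m) \<Rightarrow> (real^'n \<Rightarrow> real) \<Rightarrow> bool" where
  "transverse_coordinates T xs z Pm U r xp tau \<longleftrightarrow>
     open U \<and> orbit T xs \<subseteq> U \<and> r > 0 \<and>
     (\<forall>x\<in>U. tau x \<in> {0..<T} \<and> z (tau x) \<bullet> (x - xs (tau x)) = 0 \<and>
            xp x = Pm (tau x) *v (x - xs (tau x)) \<and> norm (xp x) < r \<and>
            (\<forall>\<tau>\<in>{0..<T}. z \<tau> \<bullet> (x - xs \<tau>) = 0 \<and> norm (Pm \<tau> *v (x - xs \<tau>)) < r \<longrightarrow> \<tau> = tau x))"

section \<open>Lyapunov equation and Lyapunov function\<close>

definition SPPD :: "real \<Rightarrow> (real \<Rightarrow> real^'m^'m) \<Rightarrow> bool" where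
  "SPPD T M \<longleftrightarrow>
     (\<forall>t. transpose (M t) = M t \<and> M (t + T) = M t \<and> (\<forall>v. v \<noteq> 0 \<longrightarrow> v \<bullet> (M t *v v) > 0))"

definition SPPD_Lyapunov_solution ::
  "real \<Rightarrow> (real \<Rightarrow> real^'m^'m) \<Rightarrow> (real \<Rightarrow> real^'m^'m) \<Rightarrow> (real \<Rightarrow> real^'m^'m) \<Rightarrow> bool" where
  "SPPD_Lyapunov_solution T A Q P \<longleftrightarrow>
     SPPD T P \<and> P C1_differentiable_on UNIV \<and>
     (\<forall>t. vector_derivative P (at t) + transpose (A t) ** P t + P t ** A t + Q t = 0)"

text \<open>The derivative of \<open>V\<close> along solutions at \<open>x\<close> is the derivative at time 0 of \<open>V \<circ> \<phi>\<close> for a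
  local solution \<open>\<phi>\<close> through \<open>x\<close>; its existence is part of the requirement.\<close>

definition verifies_exponential_orbital_stability ::
  "('a::real_normed_vector \<Rightarrow> 'a) \<Rightarrow> 'a set \<Rightarrow> 'a set \<Rightarrow> ('a \<Rightarrow> real) \<Rightarrow> bool" where
  "verifies_exponential_orbital_stability f \<Gamma> U V \<longleftrightarrow>
     open U \<and> \<Gamma> \<subseteq> U \<and>
     (\<exists>k1>0. \<exists>k2>0. \<exists>k3>0. \<forall>x\<in>U.
        k1 * (infdist x \<Gamma>)\<^sup>2 \<le> V x \<and> V x \<le> k2 * (infdist x \<Gamma>)\<^sup>2 \<and>
        (\<forall>\<phi> e. e > 0 \<and> \<phi> 0 = x \<and> ode_solution (\<lambda>_. f) {-e<..<e} \<phi> \<longrightarrow>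
           (\<exists>v. ((\<lambda>t. V (\<phi> t)) has_real_derivative v) (at 0) \<and>
                v \<le> - k3 * (infdist x \<Gamma>)\<^sup>2)))"

definition Lyapunov_condition ::
  "(real^'n \<Rightarrow> real^'n) \<Rightarrow> real \<Rightarrow> (real \<Rightarrow> real^'n) \<Rightarrow> (real \<Rightarrow> real^'n) \<Rightarrow>
   (real \<Rightarrow> real^'n^'m) \<Rightarrow> (real \<Rightarrow> real^'m^'m) \<Rightarrow> bool" where
  "Lyapunov_condition f T xs z Pm A \<longleftrightarrow>
     (\<exists>U0 r xp tau. transverse_coordinates T xs z Pm U0 r xp tau \<and>
        (\<forall>Q. SPPD T Q \<and> continuous_on UNIV Q \<longrightarrow>
           (\<exists>!P. SPPD_Lyapunov_solution T A Q P) \<and>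
           (\<forall>P. SPPD_Lyapunov_solution T A Q P \<longrightarrow>
              (\<exists>U\<subseteq>U0. verifies_exponential_orbital_stability f (orbit T xs) U
                 (\<lambda>x. xp x \<bullet> (P (tau x) *v xp x))))))"

end

theory Submission
  imports Defs
begin

text \<open>In the moving frame a point near the orbit is \<open>x = xs \<tau> + \<Pi>(\<tau>)\<^sup>T p\<close>, and along solutions
  \<open>\<tau>' = 1 + O(|p|)\<close> and \<open>p' = A(\<tau>) p + o(|p|)\<close>, uniformly in \<open>\<tau>\<close>
  (\<open>transverse_dynamics_linearize\<close>). The transverse linearization is thus the first order part of the
  motion across the orbit, and every implication passes through it.

  \<^item> \<^emph>\<open>A stable linearization yields the Lyapunov function.\<close> The Lyapunov equation is a periodic affine
  differential equation for the matrix \<open>P\<close>. If \<open>D\<close> solves the homogeneous equation and \<open>u\<close>, \<open>w\<close> solve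
  the linear system, then \<open>u \<bullet> D w\<close> is constant; for periodic \<open>D\<close> it tends to zero, so \<open>D = 0\<close>
  (\<open>homogeneous_Lyapunov_solution_zero\<close>). By the Fredholm alternative
  (\<open>Fredholm_periodic_solution\<close>) there is exactly one periodic \<open>P\<close> for each \<open>Q\<close>. Uniqueness makes it
  symmetric, and \<open>\<zeta> \<bullet> P \<zeta>\<close> is positive because it decreases to zero along solutions. In transverse
  coordinates the derivative of \<open>V = p \<bullet> P(\<tau>) p\<close> along the flow is \<open>- p \<bullet> Q p + o(|p|\<^sup>2)\<close>
  (\<open>Lyapunov_solution_verifies\<close>).

  \<^item> \<^emph>\<open>The Lyapunov equation yields a stable linearization.\<close> For \<open>Q = 1\<close> the form \<open>\<zeta> \<bullet> P \<zeta>\<close>, which is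
  comparable to \<open>|\<zeta>|\<^sup>2\<close>, decreases at the rate \<open>|\<zeta>|\<^sup>2\<close> (\<open>Lyapunov_solution_imp_stable\<close>).

  \<^item> \<^emph>\<open>The Lyapunov function yields orbital stability.\<close> \<open>V\<close> is comparable to the squared distance from the
  orbit and decreases exponentially, so solutions that start close stay in the region where this is
  known (\<open>Lyapunov_function_imp_exponentially_orbitally_stable\<close>).

  \<^item> \<^emph>\<open>Orbital stability yields a stable linearization.\<close> To a solution \<open>\<zeta>\<close> of the linear system belongs
  a solution \<open>y = \<theta> f(xs) + \<Pi>\<^sup>T \<zeta>\<close> of the variational equation along the orbit, and the solution of the
  nonlinear system from \<open>xs t0 + \<epsilon> y t0\<close> is \<open>xs + \<epsilon> y + o(\<epsilon>)\<close> on bounded time intervals. It approaches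
  the orbit exponentially. Projecting along \<open>f(xs)\<close> removes the drift \<open>\<theta>\<close> along the orbit and leaves
  the same exponential bound for \<open>\<zeta>\<close> (\<open>decay_of_linearization\<close>).\<close>

section \<open>Comparison estimates and existence for differential equations\<close>

lemma curve_continuous:
  assumes "\<And>t. (h has_vector_derivative h' t) (at t)"
  shows "continuous_on S h"
  by (rule continuous_on_vector_derivative) (rule has_vector_derivative_at_within[OF assms])

text \<open>The square of the norm is differentiable where the norm need not be. The cross term
  \<open>2 \<eta> |u|\<close> in its derivative is at most \<open>|u|\<^sup>2 + \<eta>\<^sup>2\<close>, whence the summand 1 in the exponent.\<close>

lemma gronwall_inequality:
  fixes u u' :: "real \<Rightarrow> 'a::real_inner"
  assumes "a \<le> b" and "0 \<le> L" 
    and deriv: "\<And>t. t \<in> {a..b} \<Longrightarrow> (u has_vector_derivative u' t) (at t within {a..b})"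
    and bound: "\<And>t. t \<in> {a..b} \<Longrightarrow> norm (u' t) \<le> L * norm (u t) + \<eta>"
  shows "(norm (u b))\<^sup>2 \<le> exp ((2 * L + 1) * (b - a)) * ((norm (u a))\<^sup>2 + \<eta>\<^sup>2 * (b - a))"
proof -
  define k where "k = 2 * L + 1"
  have k: "k \<ge> 0" using assms by (simp add: k_def)
  define w where "w = (\<lambda>t. exp (- k * (t - a)) * (u t \<bullet> u t) - \<eta>\<^sup>2 * (t - a))"
  have cont_u: "continuous_on {a..b} u"
    by (rule continuous_on_vector_derivative[where f' = u']) (rule deriv)
  have "w b \<le> w a"
  proof (rule DERIV_nonpos_imp_decreasing_open[where f = w and a = a and b = b])
    show "continuous_on {a..b} w"
      unfolding w_def by (intro continuous_intros cont_u)
    fix t assume t: "a < t" "t < b"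
    have du: "(u has_vector_derivative u' t) (at t)"
      using deriv[of t] t at_within_Icc_at[of a t b] by simp
    have "((\<lambda>t. u t \<bullet> u t) has_vector_derivative (u t \<bullet> u' t + u' t \<bullet> u t)) (at t)"
      by (rule bounded_bilinear.has_vector_derivative[OF bounded_bilinear_inner du du])
    then have duu: "((\<lambda>t. u t \<bullet> u t) has_real_derivative 2 * (u t \<bullet> u' t)) (at t)"
      by (simp add: has_real_derivative_iff_has_vector_derivative inner_commute)
    define y where "y = exp (- k * (t - a)) * (2 * (u t \<bullet> u' t) - k * (u t \<bullet> u t)) - \<eta>\<^sup>2"
    have dw: "(w has_real_derivative y) (at t)"
      unfolding w_def y_def by (auto intro!: derivative_eq_intros duu simp: algebra_simps)
    have "u t \<bullet> u' t \<le> norm (u t) * norm (u' t)" by (rule norm_cauchy_schwarz)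
    also have "\<dots> \<le> norm (u t) * (L * norm (u t) + \<eta>)"
      using bound[of t] t by (intro mult_left_mono) auto
    finally have "2 * (u t \<bullet> u' t) - k * (u t \<bullet> u t) \<le> 2 * norm (u t) * \<eta> - norm (u t) ^ 2"
      by (simp add: k_def power2_norm_eq_inner[symmetric] power2_eq_square algebra_simps)
    also have "\<dots> \<le> \<eta>\<^sup>2"
      using zero_le_power2[of "norm (u t) - \<eta>"] by (simp add: power2_eq_square algebra_simps)
    finally have "exp (- k * (t - a)) * (2 * (u t \<bullet> u' t) - k * (u t \<bullet> u t)) \<le> exp (- k * (t - a)) * \<eta>\<^sup>2"
      by (rule mult_left_mono) simp
    also have "\<dots> \<le> 1 * \<eta>\<^sup>2" using t k by (intro mult_right_mono) auto
    finally have "y \<le> 0" by (simp add: y_def)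
    with dw show "\<exists>y. (w has_real_derivative y) (at t) \<and> y \<le> 0" by blast
  qed fact
  then have "exp (- (k * (b - a))) * (norm (u b))\<^sup>2 \<le> (norm (u a))\<^sup>2 + \<eta>\<^sup>2 * (b - a)"
    by (simp add: w_def power2_norm_eq_inner)
  then have "exp (k * (b - a)) * (exp (- (k * (b - a))) * (norm (u b))\<^sup>2) \<le>
      exp (k * (b - a)) * ((norm (u a))\<^sup>2 + \<eta>\<^sup>2 * (b - a))"
    by (rule mult_left_mono) simp
  then show ?thesis
    by (simp add: k_def mult.assoc[symmetric] exp_add[symmetric] del: mult.assoc)
qed

lemma vanishing_forward:
  fixes u u' :: "real \<Rightarrow> 'a::real_inner"
  assumes "a \<le> b" and "0 \<le> L"
    and "\<And>t. t \<in> {a..b} \<Longrightarrow> (u has_vector_derivative u' t) (at t within {a..b})"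
    and "\<And>t. t \<in> {a..b} \<Longrightarrow> norm (u' t) \<le> L * norm (u t)"
    and "u a = 0"
  shows "u b = 0"
proof -
  have "(norm (u b))\<^sup>2 \<le> exp ((2 * L + 1) * (b - a)) * ((norm (u a))\<^sup>2 + 0\<^sup>2 * (b - a))"
  proof (rule gronwall_inequality[where u = u and u' = u'])
    show "(u has_vector_derivative u' t) (at t within {a..b})" if "t \<in> {a..b}" for t
      using assms(3)[OF that] .
    show "norm (u' t) \<le> L * norm (u t) + 0" if "t \<in> {a..b}" for t
      using assms(4)[OF that] by simp
  qed fact+
  then show ?thesis using \<open>u a = 0\<close> by simp
qed

lemma exponential_bound_tendsto_0:
  fixes d :: "real \<Rightarrow> real"
  assumes "c > 0" and "\<And>t. 0 \<le> t \<Longrightarrow> d t \<le> D * exp (- c * t)" and "\<And>t. 0 \<le> d t"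
  shows "(d \<longlongrightarrow> 0) at_top"
proof (rule tendsto_sandwich[of "\<lambda>_. 0" _ _ "\<lambda>t. D * exp (- c * t)"])
  have "LIM t at_top. - c * t :> at_bot"
    by (rule filterlim_tendsto_neg_mult_at_bot[OF tendsto_const])
       (use \<open>c > 0\<close> in \<open>auto simp: filterlim_ident\<close>)
  from filterlim_compose[OF exp_at_bot this]
  show "((\<lambda>t. D * exp (- c * t)) \<longlongrightarrow> 0) at_top" by (rule tendsto_mult_right_zero)
  show "\<forall>\<^sub>F t in at_top. d t \<le> D * exp (- c * t)"
    by (rule eventually_mono[OF eventually_ge_at_top[of 0]]) (rule assms(2))
qed (auto simp: assms(3))

text \<open>The passage from a decaying quadratic form, equivalent to the squared norm, to the
  norm itself halves the rate.\<close>

lemma norm_decay_from_quadratic_decay: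
  fixes c d d0 k1 k2 s :: real
  assumes "k1 > 0" "k2 > 0" "d0 \<ge> 0" and le: "exp (c * s) * (k1 * d\<^sup>2) \<le> k2 * d0\<^sup>2"
  shows "d \<le> sqrt (k2 / k1) * exp (- (c / 2) * s) * d0"
proof (rule power2_le_imp_le)
  have "exp (- (c * s)) / k1 * (exp (c * s) * (k1 * d\<^sup>2)) \<le> exp (- (c * s)) / k1 * (k2 * d0\<^sup>2)"
    using le by (rule mult_left_mono) (use assms in auto)
  then have "d\<^sup>2 \<le> exp (- (c * s)) / k1 * (k2 * d0\<^sup>2)"
    using \<open>k1 > 0\<close> by (simp add: exp_minus mult.assoc[symmetric])
  also have "\<dots> = (sqrt (k2 / k1) * exp (- (c / 2) * s) * d0)\<^sup>2"
    using assms by (simp add: power_mult_distrib exp_double[symmetric] field_simps)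
  finally show "d\<^sup>2 \<le> (sqrt (k2 / k1) * exp (- (c / 2) * s) * d0)\<^sup>2" .
qed (use assms in auto)

lemma has_vector_derivative_reflect:
  fixes u :: "real \<Rightarrow> 'a::real_normed_vector"
  assumes "(u has_vector_derivative d) (at (- s))"
  shows "((\<lambda>s. u (- s)) has_vector_derivative - d) (at s)"
proof -
  have "(uminus has_vector_derivative - 1) (at s)"
    by (auto intro!: derivative_eq_intros)
  from vector_diff_chain_at[OF this assms] show ?thesis by (simp add: o_def)
qed

text \<open>The past is the future of the reflected curve.\<close>

lemma vanishing_everywhere:
  fixes u u' :: "real \<Rightarrow> 'a::real_inner"
  assumes "0 \<le> L" and deriv: "\<And>t. (u has_vector_derivative u' t) (at t)"
    and bound: "\<And>t. norm (u' t) \<le> L * norm (u t)"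
    and "u t0 = 0"
  shows "u t = 0"
proof (cases "t0 \<le> t")
  case True
  show ?thesis
  proof (rule vanishing_forward[where u = u and u' = u' and a = t0])
    show "(u has_vector_derivative u' s) (at s within {t0..t})" for s
      by (rule has_vector_derivative_at_within[OF deriv])
  qed (use True \<open>0 \<le> L\<close> \<open>u t0 = 0\<close> bound in simp_all)
next
  case False
  have "u (- (- t)) = 0"
  proof (rule vanishing_forward[where u = "\<lambda>s. u (- s)" and u' = "\<lambda>s. - u' (- s)" and a = "- t0"])
    show "((\<lambda>s. u (- s)) has_vector_derivative - u' (- s)) (at s within {- t0..- t})" for s
      by (rule has_vector_derivative_at_within[OF has_vector_derivative_reflect[OF deriv]])
    show "norm (- u' (- s)) \<le> L * norm (u (- s))" for s
      using bound[of "- s"] by simp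
  qed (use False \<open>0 \<le> L\<close> \<open>u t0 = 0\<close> in simp_all)
  then show ?thesis by simp
qed

text \<open>Integrals over \<open>{-n..t}\<close> and \<open>{-n..0}\<close> with a common left end differ by the integral from
  0 to \<open>t\<close>, whatever the sign of \<open>t\<close>.\<close>

lemma antiderivative_on_line:
  fixes h :: "real \<Rightarrow> 'a::banach"
  assumes h: "continuous_on UNIV h"
  obtains H where "H 0 = 0" and "\<And>t. (H has_vector_derivative h t) (at t)"
proof -
  define H where "H = (\<lambda>t. integral {-(\<bar>t\<bar>+1)..t} h - integral {-(\<bar>t\<bar>+1)..0} h)"
  have eq: "H t = integral {-n..t} h - integral {-n..0} h" if "\<bar>t\<bar> + 1 \<le> n" for t n
  proof -
    have int: "h integrable_on {a..b}" for a b
      using h by (meson continuous_on_subset integrable_continuous_real subset_UNIV)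
    have "integral {-n..-(\<bar>t\<bar>+1)} h + integral {-(\<bar>t\<bar>+1)..t} h = integral {-n..t} h"
         "integral {-n..-(\<bar>t\<bar>+1)} h + integral {-(\<bar>t\<bar>+1)..0} h = integral {-n..0} h"
      using that by (intro Henstock_Kurzweil_Integration.integral_combine int; simp)+
    from this[symmetric] show ?thesis by (simp only: H_def add_diff_cancel_left)
  qed
  have "(H has_vector_derivative h t) (at t)" for t
  proof -
    define n where "n = \<bar>t\<bar> + 2"
    have "((\<lambda>s. integral {-n..s} h) has_vector_derivative h t) (at t within {-n..n})"
      using h by (intro integral_has_vector_derivative) (auto intro: continuous_on_subset simp: n_def)
    then have "((\<lambda>s. integral {-n..s} h) has_vector_derivative h t) (at t)"
      by (subst (asm) at_within_Icc_at) (auto simp: n_def)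
    then have "((\<lambda>s. integral {-n..s} h - integral {-n..0} h) has_vector_derivative h t) (at t)"
      by (auto intro!: derivative_eq_intros)
    moreover have "\<forall>\<^sub>F s in nhds t. integral {-n..s} h - integral {-n..0} h = H s"
      unfolding eventually_nhds_metric
      by (rule exI[of _ 1]) (use eq[of _ n] in \<open>force simp: dist_real_def n_def\<close>)
    ultimately show ?thesis
      unfolding has_vector_derivative_def
      using has_derivative_transform_eventually[of "\<lambda>s. integral {-n..s} h - integral {-n..0} h" _ t UNIV H]
      by (auto simp: eventually_nhds_conv_at)
  qed
  moreover have "H 0 = 0" by (simp add: H_def)
  ultimately show thesis using that by blast
qed

text \<open>Integration gains the factor \<open>1 / k\<close> in the norm weighted by \<open>exp (- k |t|)\<close>; this factor
  makes the Picard operator below a contraction.\<close>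

lemma exponential_growth_of_primitive:
  fixes D d :: "real \<Rightarrow> 'a::real_normed_vector"
  assumes deriv: "\<And>t. (D has_vector_derivative d t) (at t)" and "D 0 = 0"
    and bound: "\<And>t. norm (d t) \<le> C * exp (k * \<bar>t\<bar>)" and "k > 0" "C \<ge> 0"
  shows "norm (D t) \<le> C / k * exp (k * \<bar>t\<bar>)"
proof -
  have fwd: "norm (E t) \<le> C / k * exp (k * \<bar>t\<bar>)"
    if E: "\<And>t. (E has_vector_derivative e t) (at t)" "E 0 = 0"
      "\<And>t. norm (e t) \<le> C * exp (k * \<bar>t\<bar>)" and "t > 0" for E e :: "real \<Rightarrow> 'a" and t
  proof -
    have "norm (E t - E 0) \<le> C / k * exp (k * t) - C / k * exp (k * 0)"
    proof (rule differentiable_bound_general[where \<phi> = "\<lambda>t. C / k * exp (k * t)" and \<phi>' = "\<lambda>t. C * exp (k * t)" and f' = e])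
      show "continuous_on {0..t} E"
        by (rule curve_continuous[OF E(1)])
      show "((\<lambda>t. C / k * exp (k * t)) has_vector_derivative C * exp (k * s)) (at s)" for s
        unfolding has_real_derivative_iff_has_vector_derivative[symmetric]
        using \<open>k > 0\<close> by (auto intro!: derivative_eq_intros)
      show "norm (e s) \<le> C * exp (k * s)" if "0 < s" for s
        using E(3)[of s] that by simp
      show "continuous_on {0..t} (\<lambda>t. C / k * exp (k * t))"
        by (intro continuous_intros)
      show "(E has_vector_derivative e s) (at s)" for s by (rule E(1))
    qed (rule \<open>t > 0\<close>)
    moreover have "C / k \<ge> 0" using \<open>k > 0\<close> \<open>C \<ge> 0\<close> by simp
    ultimately show ?thesis using \<open>E 0 = 0\<close> \<open>t > 0\<close> by simp
  qed
  consider "t > 0" | "t = 0" | "t < 0" by linarith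
  then show ?thesis
  proof cases
    case 1 then show ?thesis by (rule fwd[OF deriv \<open>D 0 = 0\<close> bound])
  next
    case 2 then show ?thesis using \<open>D 0 = 0\<close> \<open>k > 0\<close> \<open>C \<ge> 0\<close> by simp
  next
    case 3
    have "((\<lambda>s. D (- s)) has_vector_derivative - d (- s)) (at s)" for s
      by (rule has_vector_derivative_reflect[OF deriv])
    moreover have "norm (- d (- s)) \<le> C * exp (k * \<bar>s\<bar>)" for s
      using bound[of "- s"] by simp
    moreover have "D (- 0) = 0" using \<open>D 0 = 0\<close> by simp
    moreover have "- t > 0" using 3 by simp
    ultimately have "norm (D (- (- t))) \<le> C / k * exp (k * \<bar>- t\<bar>)"
      by (intro fwd[of "\<lambda>s. D (- s)" "\<lambda>s. - d (- s)" "- t"])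
    then show ?thesis by simp
  qed
qed

text \<open>Picard iteration in a weighted norm: a solution is sought as \<open>exp (k |t|) u t\<close> with \<open>u\<close> bounded
  and continuous. If \<open>k\<close> is twice a Lipschitz constant, the integral operator contracts by \<open>1 / 2\<close> on
  the whole line, so the fixed point is at once a global solution.\<close>

theorem global_solution_exists:
  fixes F :: "real \<Rightarrow> 'a::euclidean_space \<Rightarrow> 'a"
  assumes cont: "continuous_on UNIV (\<lambda>p. F (fst p) (snd p))"
    and lip: "\<And>t x y. norm (F t x - F t y) \<le> L * norm (x - y)"
    and bdd: "\<And>t. norm (F t 0) \<le> M"
  obtains x where "x t0 = x0" and "\<And>t. (x has_vector_derivative F t (x t)) (at t)"
proof -
  have at_0: "\<exists>x. x 0 = x0 \<and> (\<forall>t. (x has_vector_derivative F t (x t)) (at t))"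
    if cont: "continuous_on UNIV (\<lambda>p. F (fst p) (snd p))"
    and lip: "\<And>t x y. norm (F t x - F t y) \<le> L * norm (x - y)"
    and bdd: "\<And>t. norm (F t 0) \<le> M" for F :: "real \<Rightarrow> 'a \<Rightarrow> 'a"
  proof -
    \<comment> \<open>A positive Lipschitz constant, to divide by.\<close>
    define l where "l = \<bar>L\<bar> + 1"
    define k where "k = 2 * l"
    have l: "l > 0" and k: "k > 0" by (auto simp: l_def k_def)
    have M: "M \<ge> 0" using bdd[of 0] norm_ge_zero order_trans by blast
    have lip: "norm (F t x - F t y) \<le> l * norm (x - y)" for t x y
    proof -
      have "L * norm (x - y) \<le> l * norm (x - y)"
        by (intro mult_right_mono) (auto simp: l_def)
      with lip[of t x y] show ?thesis by linarith
    qed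
    define h where "h = (\<lambda>(u :: real \<Rightarrow>\<^sub>C 'a) s. F s (exp (k * \<bar>s\<bar>) *\<^sub>R u s))"
    have h_cont: "continuous_on UNIV (h u)" for u
    proof -
      have "continuous_on UNIV (\<lambda>s. (s, exp (k * \<bar>s\<bar>) *\<^sub>R u s))"
        by (intro continuous_intros continuous_on_apply_bcontfun)
      from continuous_on_compose2[OF cont this] show ?thesis by (simp add: h_def)
    qed
    have "\<exists>H. H 0 = 0 \<and> (\<forall>t. (H has_vector_derivative h u t) (at t))" for u
      using antiderivative_on_line[OF h_cont] by metis
    then obtain H where H0: "\<And>u. H u 0 = 0" and H: "\<And>u t. (H u has_vector_derivative h u t) (at t)"
      by metis
    have h_diff: "norm (h u s - h v s) \<le> l * dist u v * exp (k * \<bar>s\<bar>)" for u v s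
    proof -
      have "norm (h u s - h v s) \<le> l * norm (exp (k * \<bar>s\<bar>) *\<^sub>R (u s - v s))"
        using lip by (simp add: h_def scaleR_diff_right)
      also have "\<dots> = l * (exp (k * \<bar>s\<bar>) * dist (u s) (v s))" by (simp add: dist_norm)
      also have "\<dots> \<le> l * (exp (k * \<bar>s\<bar>) * dist u v)"
        using l by (intro mult_left_mono dist_bounded) auto
      finally show ?thesis by (simp add: algebra_simps)
    qed
    have h_bound: "norm (h u s) \<le> (M + l * norm u) * exp (k * \<bar>s\<bar>)" for u s
    proof -
      have "norm (h u s) \<le> norm (h u s - F s 0) + norm (F s 0)"
        using norm_triangle_sub by (metis add.commute)
      also have "\<dots> \<le> l * norm (exp (k * \<bar>s\<bar>) *\<^sub>R u s) + M * exp (k * \<bar>s\<bar>)"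
      proof (rule add_mono)
        show "norm (h u s - F s 0) \<le> l * norm (exp (k * \<bar>s\<bar>) *\<^sub>R u s)"
          using lip[of s "exp (k * \<bar>s\<bar>) *\<^sub>R u s" 0] by (simp add: h_def)
        have "M * 1 \<le> M * exp (k * \<bar>s\<bar>)" using M k by (intro mult_left_mono) auto
        with bdd[of s] show "norm (F s 0) \<le> M * exp (k * \<bar>s\<bar>)" by linarith
      qed
      also have "l * norm (exp (k * \<bar>s\<bar>) *\<^sub>R u s) \<le> l * (exp (k * \<bar>s\<bar>) * norm u)"
        using l norm_bounded[of u s] by (auto intro!: mult_left_mono)
      finally show ?thesis by (simp add: algebra_simps)
    qed
    have H_diff: "norm (H u t - H v t) \<le> l * dist u v / k * exp (k * \<bar>t\<bar>)" for u v t
      using h_diff l k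
      by (intro exponential_growth_of_primitive[where D = "\<lambda>t. H u t - H v t" and d = "\<lambda>s. h u s - h v s"])
         (auto simp: H0 intro!: derivative_intros H)
    have H_bound: "norm (H u t) \<le> (M + l * norm u) / k * exp (k * \<bar>t\<bar>)" for u t
      using h_bound l k M
      by (intro exponential_growth_of_primitive[where D = "H u" and d = "h u"]) (auto simp: H0 H)
    define G where "G = (\<lambda>u t. exp (- (k * \<bar>t\<bar>)) *\<^sub>R (x0 + H u t))"
    have G_bound: "norm (G u t) \<le> norm x0 + (M + l * norm u) / k" for u t
    proof -
      have "norm (G u t) \<le> exp (- (k * \<bar>t\<bar>)) * (norm x0 + (M + l * norm u) / k * exp (k * \<bar>t\<bar>))"
        unfolding G_def using norm_triangle_le[OF add_left_mono[OF H_bound]] by simp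
      also have "\<dots> = exp (- (k * \<bar>t\<bar>)) * norm x0 + (M + l * norm u) / k"
        by (simp add: distrib_left exp_minus)
      also have "\<dots> \<le> 1 * norm x0 + (M + l * norm u) / k"
        using k by (intro add_right_mono mult_right_mono) auto
      finally show ?thesis by simp
    qed
    have H_cont: "continuous_on UNIV (H u)" for u
      by (rule curve_continuous[OF H])
    have "G u \<in> bcontfun" for u
      unfolding bcontfun_def
    proof (intro CollectI conjI)
      show "continuous_on UNIV (G u)" unfolding G_def by (intro continuous_intros H_cont)
      show "bounded (range (G u))" using G_bound by (force simp: bounded_iff)
    qed
    then have G_inv: "apply_bcontfun (Bcontfun (G u)) = G u" for u
      by (rule Bcontfun_inverse)
    define \<Psi> where "\<Psi> = (\<lambda>u. Bcontfun (G u))"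
    have \<Psi>: "apply_bcontfun (\<Psi> u) = G u" for u
      by (simp add: \<Psi>_def G_inv)
    have "dist (\<Psi> u) (\<Psi> v) \<le> 1/2 * dist u v" for u v
    proof (rule dist_bound)
      fix t
      have "dist (\<Psi> u t) (\<Psi> v t) = exp (- (k * \<bar>t\<bar>)) * norm (H u t - H v t)"
        by (simp add: \<Psi> G_def dist_norm scaleR_diff_right[symmetric])
      also have "\<dots> \<le> exp (- (k * \<bar>t\<bar>)) * (l * dist u v / k * exp (k * \<bar>t\<bar>))"
        by (intro mult_left_mono H_diff) simp
      also have "\<dots> = 1/2 * dist u v" using l by (simp add: exp_minus k_def)
      finally show "dist (\<Psi> u t) (\<Psi> v t) \<le> 1/2 * dist u v" .
    qed
    then obtain u where u: "\<Psi> u = u"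
      using banach_fix_type[of "1/2" \<Psi>] by auto
    define x where "x = (\<lambda>t. x0 + H u t)"
    have "exp (k * \<bar>t\<bar>) *\<^sub>R u t = x t" for t
      using \<Psi>[of u] u by (simp add: G_def x_def exp_minus fun_eq_iff)
    then have "h u t = F t (x t)" for t by (simp add: h_def)
    moreover have "(x has_vector_derivative h u t) (at t)" for t
      unfolding x_def by (auto intro!: derivative_eq_intros H)
    ultimately show ?thesis by (intro exI[of _ x]) (auto simp: x_def H0)
  qed
  have "continuous_on UNIV (\<lambda>p. F (fst p + t0) (snd p))"
    using continuous_on_compose2[OF cont, of UNIV "\<lambda>p. (fst p + t0, snd p)"]
    by (simp add: continuous_intros)
  from at_0[of "\<lambda>t. F (t + t0)", OF this lip bdd] obtain y
    where y: "y 0 = x0" "\<And>t. (y has_vector_derivative F (t + t0) (y t)) (at t)" by auto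
  have "((\<lambda>s. y (s - t0)) has_vector_derivative F t (y (t - t0))) (at t)" for t
  proof -
    have "((\<lambda>s. s - t0) has_vector_derivative 1) (at t)" by (auto intro!: derivative_eq_intros)
    from vector_diff_chain_at[OF this y(2)] show ?thesis by (simp add: o_def)
  qed
  with y(1) that[of "\<lambda>s. y (s - t0)"] show thesis by simp
qed


section \<open>Continuously differentiable vector fields\<close>

lemma bounded_bilinear_matrix_vector_mult:
  "bounded_bilinear ((*v) :: real^'n^'m \<Rightarrow> real^'n \<Rightarrow> real^'m)"
  unfolding bilinear_conv_bounded_bilinear[symmetric] bilinear_def linear_iff
  by (simp add: matrix_vector_mult_add_rdistrib matrix_vector_right_distrib
      scaleR_matrix_vector_assoc[symmetric] matrix_vector_mult_scaleR)

lemma bounded_bilinear_matrix_matrix_mult: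
  "bounded_bilinear ((**) :: real^'n^'m \<Rightarrow> real^'k^'n \<Rightarrow> real^'k^'m)"
  unfolding bilinear_conv_bounded_bilinear[symmetric] bilinear_def linear_iff
  by (simp add: vec_eq_iff matrix_matrix_mult_def sum.distrib algebra_simps sum_distrib_left)

lemma bounded_linear_transpose: "bounded_linear (transpose :: real^'n^'m \<Rightarrow> real^'m^'n)"
  unfolding linear_conv_bounded_linear[symmetric] linear_iff
  by (simp add: vec_eq_iff transpose_def)

lemmas matrix_vector_continuous = bounded_bilinear.continuous_on[OF bounded_bilinear_matrix_vector_mult]
  and matrix_vector_deriv = bounded_bilinear.has_vector_derivative[OF bounded_bilinear_matrix_vector_mult]
  and matrix_matrix_continuous = bounded_bilinear.continuous_on[OF bounded_bilinear_matrix_matrix_mult]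
  and matrix_matrix_diff = bounded_bilinear.diff_left[OF bounded_bilinear_matrix_matrix_mult]
    bounded_bilinear.diff_right[OF bounded_bilinear_matrix_matrix_mult]
  and transpose_continuous = bounded_linear.continuous_on[OF bounded_linear_transpose]
  and transpose_deriv = bounded_linear.has_vector_derivative[OF bounded_linear_transpose]

definition lipschitz_on_balls :: "('a::real_normed_vector \<Rightarrow> 'b::real_normed_vector) \<Rightarrow> bool" where
  "lipschitz_on_balls f \<longleftrightarrow>
     (\<forall>R. \<exists>L\<ge>0. \<forall>x\<in>cball 0 R. \<forall>y\<in>cball 0 R. norm (f x - f y) \<le> L * norm (x - y))"

lemma C1_lipschitz_on_balls:
  fixes f :: "real^'n \<Rightarrow> real^'m"
  assumes deriv: "\<And>x. (f has_derivative (\<lambda>h. J x *v h)) (at x)" and J: "continuous_on UNIV J"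
  shows "lipschitz_on_balls f"
  unfolding lipschitz_on_balls_def
proof
  fix R :: real
  obtain K where K: "K \<ge> 0" "\<And>(M::real^'n^'m) v. norm (M *v v) \<le> norm M * norm v * K"
    using bounded_bilinear.nonneg_bounded[OF bounded_bilinear_matrix_vector_mult] by blast
  have "bounded (J ` cball 0 R)"
    by (intro compact_imp_bounded compact_continuous_image continuous_on_subset[OF J]) auto
  then obtain B where B: "B > 0" "\<And>x. x \<in> cball 0 R \<Longrightarrow> norm (J x) \<le> B"
    by (auto simp: bounded_pos)
  have "norm (f x - f y) \<le> (B * K) * norm (x - y)" if "x \<in> cball 0 R" "y \<in> cball 0 R" for x y
  proof (rule differentiable_bound[OF _ _ _ that])
    show "(f has_derivative (\<lambda>h. J w *v h)) (at w within cball 0 R)" for w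
      by (rule has_derivative_at_withinI[OF deriv])
    show "onorm (\<lambda>h. J w *v h) \<le> B * K" if "w \<in> cball 0 R" for w
    proof (rule onorm_le)
      fix v :: "real^'n"
      have "norm (J w) * norm v * K \<le> B * norm v * K"
        using B(2)[OF that] K by (intro mult_right_mono) auto
      with K(2)[of "J w" v] show "norm (J w *v v) \<le> B * K * norm v" by (simp add: ac_simps)
    qed
  qed simp
  then show "\<exists>L\<ge>0. \<forall>x\<in>cball 0 R. \<forall>y\<in>cball 0 R. norm (f x - f y) \<le> L * norm (x - y)"
    using B K by (intro exI[of _ "B * K"]) auto
qed

text \<open>The derivative is uniformly continuous on a ball of radius larger by 1, where all the points
  \<open>a + h\<close> lie once \<open>d \<le> 1\<close>.\<close>

lemma uniform_linearization:
  fixes f :: "real^'n \<Rightarrow> real^'m"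
  assumes deriv: "\<And>x. (f has_derivative (\<lambda>h. J x *v h)) (at x)" and J: "continuous_on UNIV J"
    and "e > 0"
  obtains d where "d > 0"
    "\<And>a h. a \<in> cball 0 R \<Longrightarrow> norm h \<le> d \<Longrightarrow> norm (f (a + h) - f a - J a *v h) \<le> e * norm h"
proof -
  obtain K where K: "K > 0" "\<And>(M::real^'n^'m) v. norm (M *v v) \<le> norm M * norm v * K"
    using bounded_bilinear.pos_bounded[OF bounded_bilinear_matrix_vector_mult] by blast
  have "uniformly_continuous_on (cball 0 (R + 1)) J"
    by (intro compact_uniformly_continuous continuous_on_subset[OF J]) auto
  then obtain d0 where d0: "d0 > 0"
    "\<And>x y. x \<in> cball 0 (R + 1) \<Longrightarrow> y \<in> cball 0 (R + 1) \<Longrightarrow> dist y x < d0 \<Longrightarrow> dist (J y) (J x) < e / K"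
    unfolding uniformly_continuous_on_def using \<open>e > 0\<close> K(1) by (metis divide_pos_pos)
  define d where "d = min (d0 / 2) 1"
  have d: "d > 0" "d < d0" "d \<le> 1" using d0 by (auto simp: d_def)
  show thesis
  proof (rule that[OF d(1)])
    fix a h :: "real^'n" assume a: "a \<in> cball 0 R" and h: "norm h \<le> d"
    have a': "a \<in> cball 0 (R + 1)" using a by auto
    have "norm (f (a + h) - f a - J a *v (a + h - a)) \<le> norm (a + h - a) * e"
    proof (rule differentiable_bound_linearization[where S = "cball a (norm h)" and f' = "\<lambda>x h. J x *v h" and f = f])
      show "a + t *\<^sub>R (a + h - a) \<in> cball a (norm h)" if "t \<in> {0..1}" for t
        using that mult_right_mono[of t 1 "norm h"] by (auto simp: dist_norm)
      show "(f has_derivative (\<lambda>h. J x *v h)) (at x within cball a (norm h))" for x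
        by (rule has_derivative_at_withinI[OF deriv])
      show "onorm ((\<lambda>h. J x *v h) - (\<lambda>h. J a *v h)) \<le> e" if "x \<in> cball a (norm h)" for x
      proof (rule onorm_le)
        fix v :: "real^'n"
        have "norm x \<le> norm a + dist x a" by (metis add.commute dist_norm norm_triangle_sub)
        with that a h d have "x \<in> cball 0 (R + 1)" "dist x a < d0" by (auto simp: dist_commute)
        then have "norm (J x - J a) \<le> e / K" using d0(2)[OF a'] by (simp add: dist_norm less_imp_le)
        then have "norm (J x - J a) * norm v * K \<le> e / K * norm v * K"
          using K by (intro mult_right_mono) auto
        also have "\<dots> = e * norm v" using K by simp
        finally show "norm (((\<lambda>h. J x *v h) - (\<lambda>h. J a *v h)) v) \<le> e * norm v"
          using K(2)[of "J x - J a" v] by (simp add: matrix_vector_mult_diff_rdistrib)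
      qed
    qed auto
    then show "norm (f (a + h) - f a - J a *v h) \<le> e * norm h" by (simp add: mult.commute)
  qed
qed

text \<open>The nearest point map of the ball is 1-Lipschitz. Composed with it, \<open>f\<close> becomes globally
  Lipschitz and bounded and keeps its values on the ball.\<close>

lemma solution_while_in_ball:
  fixes f :: "'a::euclidean_space \<Rightarrow> 'a"
  assumes f: "lipschitz_on_balls f" and "R > 0"
  obtains \<phi> where "\<phi> 0 = x0" "continuous_on UNIV \<phi>"
    "\<And>t. norm (\<phi> t) \<le> R \<Longrightarrow> (\<phi> has_vector_derivative f (\<phi> t)) (at t)"
proof -
  define g where "g = (\<lambda>x. f (closest_point (cball 0 R) x))"
  have in_ball: "closest_point (cball 0 R) x \<in> cball 0 R" for x :: 'a
    using \<open>R > 0\<close> by (intro closest_point_in_set) auto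
  obtain L where L: "L \<ge> 0" "\<And>x y. x \<in> cball 0 R \<Longrightarrow> y \<in> cball 0 R \<Longrightarrow> norm (f x - f y) \<le> L * norm (x - y)"
    using f unfolding lipschitz_on_balls_def by blast
  have g: "norm (g x - g y) \<le> L * norm (x - y)" for x y
  proof -
    have "norm (g x - g y) \<le> L * dist (closest_point (cball 0 R) x) (closest_point (cball 0 R) y)"
      unfolding g_def dist_norm by (intro L in_ball)
    also have "\<dots> \<le> L * dist x y"
      using \<open>R > 0\<close> L by (intro mult_left_mono closest_point_lipschitz) auto
    finally show ?thesis by (simp add: dist_norm)
  qed
  have "L-lipschitz_on UNIV g" using g L by (intro lipschitz_onI) (auto simp: dist_norm)
  then have "continuous_on UNIV g" by (rule lipschitz_on_continuous_on)
  then have cont: "continuous_on UNIV (\<lambda>p. g (snd p))" for p :: "real \<times> 'a"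
    by (rule continuous_on_compose2) (auto intro: continuous_intros)
  obtain \<phi> where \<phi>: "\<phi> 0 = x0" "\<And>t. (\<phi> has_vector_derivative g (\<phi> t)) (at t)"
    using global_solution_exists[of "\<lambda>_. g" L "norm (g 0)" 0 x0, OF cont g order_refl] by blast
  show thesis
  proof (rule that[of \<phi>, OF \<phi>(1)])
    show "continuous_on UNIV \<phi>"
      by (rule curve_continuous[OF \<phi>(2)])
    show "(\<phi> has_vector_derivative f (\<phi> t)) (at t)" if "norm (\<phi> t) \<le> R" for t
      using \<phi>(2)[of t] that by (simp add: g_def closest_point_self)
  qed
qed

lemma solutions_agree:
  fixes f :: "'a::euclidean_space \<Rightarrow> 'a"
  assumes f: "lipschitz_on_balls f" and "a \<le> b"
    and x: "ode_solution (\<lambda>_. f) {a..b} x" and y: "ode_solution (\<lambda>_. f) {a..b} y" and "x a = y a"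
  shows "x b = y b"
proof -
  have dx: "(x has_vector_derivative f (x t)) (at t within {a..b})"
    and dy: "(y has_vector_derivative f (y t)) (at t within {a..b})" if "t \<in> {a..b}" for t
    using x y that by (auto simp: ode_solution_def)
  have "continuous_on {a..b} x" "continuous_on {a..b} y"
    by (rule continuous_on_vector_derivative[where f' = "\<lambda>t. f (x t)"], erule dx)
       (rule continuous_on_vector_derivative[where f' = "\<lambda>t. f (y t)"], erule dy)
  then have "bounded (x ` {a..b} \<union> y ` {a..b})"
    by (auto intro!: compact_imp_bounded compact_continuous_image)
  then obtain R where "\<forall>w \<in> x ` {a..b} \<union> y ` {a..b}. norm w \<le> R"
    unfolding bounded_iff by blast
  then have R: "norm (x t) \<le> R" "norm (y t) \<le> R" if "t \<in> {a..b}" for t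
    using that by blast+
  obtain L where L: "L \<ge> 0" "\<And>x y. x \<in> cball 0 R \<Longrightarrow> y \<in> cball 0 R \<Longrightarrow> norm (f x - f y) \<le> L * norm (x - y)"
    using f unfolding lipschitz_on_balls_def by blast
  have "x b - y b = 0"
  proof (rule vanishing_forward[where u = "\<lambda>t. x t - y t" and u' = "\<lambda>t. f (x t) - f (y t)" and a = a])
    show "((\<lambda>t. x t - y t) has_vector_derivative f (x t) - f (y t)) (at t within {a..b})"
      if "t \<in> {a..b}" for t
      by (rule has_vector_derivative_diff[OF dx[OF that] dy[OF that]])
    show "norm (f (x t) - f (y t)) \<le> L * norm (x t - y t)" if "t \<in> {a..b}" for t
      using R that by (intro L) auto
  qed (use assms L in auto)
  then show ?thesis by simp
qed

lemma unique_forward_solutionI: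
  fixes f :: "'a::euclidean_space \<Rightarrow> 'a"
  assumes f: "lipschitz_on_balls f" and x: "ode_solution (\<lambda>_. f) {0..} x"
  shows "unique_forward_solution f (x 0) x"
  unfolding unique_forward_solution_def
proof (intro conjI allI impI ballI)
  fix s t :: real and y
  assume "0 \<le> s" and y: "y 0 = x 0 \<and> ode_solution (\<lambda>_. f) {0..s} y" and t: "t \<in> {0..s}"
  have sub: "ode_solution (\<lambda>_. f) S z" if "ode_solution (\<lambda>_. f) S' z" "S \<subseteq> S'" for S S' z
    using that has_vector_derivative_within_subset unfolding ode_solution_def by blast
  show "y t = x t"
  proof (rule solutions_agree[OF f, of 0])
    show "ode_solution (\<lambda>_. f) {0..t} x" by (rule sub[OF x]) auto
    show "ode_solution (\<lambda>_. f) {0..t} y" by (rule sub[of "{0..s}"]) (use y t in auto)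
  qed (use y t in auto)
qed (auto intro: x)

section \<open>Periodic linear systems and the Lyapunov equation\<close>

lemma periodic_int_shift:
  fixes h :: "real \<Rightarrow> 'a"
  assumes "\<And>t. h (t + T) = h t"
  shows "h (t + of_int k * T) = h t"
proof (induction k arbitrary: t rule: int_induct[where k = 0])
  case (step1 i)
  then show ?case using assms[of "t + of_int i * T"] by (simp add: algebra_simps)
next
  case (step2 i)
  then show ?case using assms[of "t + of_int (i - 1) * T"] by (simp add: algebra_simps)
qed simp

lemma reduce_to_period:
  assumes "(T::real) > 0"
  obtains k :: int where "t + of_int k * T \<in> {0..<T}"
proof (rule that)
  have "of_int \<lfloor>t / T\<rfloor> * T \<le> t" "t < (of_int \<lfloor>t / T\<rfloor> + 1) * T"
    using assms floor_correct[of "t / T"] pos_le_divide_eq[OF assms] pos_divide_less_eq[OF assms]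
    by (simp_all add: algebra_simps)
  then show "t + of_int (- \<lfloor>t / T\<rfloor>) * T \<in> {0..<T}" by (simp add: algebra_simps)
qed

lemma periodic_continuous_bounded:
  fixes h :: "real \<Rightarrow> 'a::real_normed_vector"
  assumes "continuous_on UNIV h" and per: "\<And>t. h (t + T) = h t" and "T > 0"
  obtains B where "B > 0" "\<And>t. norm (h t) \<le> B"
proof -
  have "bounded (h ` {0..T})"
    using assms(1) by (intro compact_imp_bounded compact_continuous_image) (auto intro: continuous_on_subset)
  then obtain B where B: "B > 0" "\<And>t. t \<in> {0..T} \<Longrightarrow> norm (h t) \<le> B" by (auto simp: bounded_pos)
  have "norm (h t) \<le> B" for t
  proof -
    obtain k :: int where "t + of_int k * T \<in> {0..<T}" using reduce_to_period[OF \<open>T > 0\<close>] by blast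
    then show ?thesis using B(2)[of "t + of_int k * T"] periodic_int_shift[of h, OF per] by auto
  qed
  with B(1) that show thesis by blast
qed

lemma has_vector_derivative_shift_time:
  fixes y :: "real \<Rightarrow> 'a::real_normed_vector"
  assumes "(y has_vector_derivative d) (at (t + T))"
  shows "((\<lambda>t. y (t + T)) has_vector_derivative d) (at t)"
proof -
  have "((\<lambda>t. t + T) has_vector_derivative 1) (at t)" by (auto intro!: derivative_eq_intros)
  from vector_diff_chain_at[OF this assms] show ?thesis by (simp add: o_def)
qed

text \<open>Let \<open>Y s\<close> be the homogeneous solution from \<open>s\<close> at time 0. The gap \<open>Y s T - s\<close> after one period is linear in
  \<open>s\<close> and, by assumption, zero only for \<open>s = 0\<close>, hence takes every value in finite dimension. One
  \<open>s\<close> therefore closes the gap left by a particular solution.\<close>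

theorem Fredholm_periodic_solution:
  fixes G :: "real \<Rightarrow> 'a::euclidean_space \<Rightarrow> 'a" and q :: "real \<Rightarrow> 'a"
  assumes lin: "\<And>t. linear (G t)"
    and cont: "continuous_on UNIV (\<lambda>p. G (fst p) (snd p))"
    and bound: "\<And>t y. norm (G t y) \<le> L * norm y"
    and per: "\<And>t. G (t + T) = G t" "\<And>t. q (t + T) = q t" and "T > 0"
    and q: "continuous_on UNIV q"
    and only_zero: "\<And>y. (\<And>t. (y has_vector_derivative G t (y t)) (at t)) \<Longrightarrow>
       (\<And>t. y (t + T) = y t) \<Longrightarrow> y 0 = 0"
  obtains y where "\<And>t. (y has_vector_derivative G t (y t) + q t) (at t)" "\<And>t. y (t + T) = y t"
proof -
  define l where "l = \<bar>L\<bar>"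
  have l: "l \<ge> 0" "norm (G t y) \<le> l * norm y" for t y
  proof -
    have "L * norm y \<le> l * norm y" unfolding l_def by (rule mult_right_mono) auto
    with bound[of t y] show "norm (G t y) \<le> l * norm y" by linarith
  qed (simp add: l_def)
  have diff: "G t x - G t y = G t (x - y)" for t x y by (simp add: linear_diff[OF lin])
  obtain B where B: "\<And>t. norm (q t) \<le> B"
    using periodic_continuous_bounded[OF q per(2) \<open>T > 0\<close>] by blast
  have cont': "continuous_on UNIV (\<lambda>p. G (fst p) (snd p) + q (fst p))"
    by (intro continuous_intros cont continuous_on_compose2[OF q]) auto
  have homogeneous: "\<exists>y. y 0 = s \<and> (\<forall>t. (y has_vector_derivative G t (y t)) (at t))" for s
    using global_solution_exists[of G l 0 0 s, OF cont] l diff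
    by (metis linear_0[OF lin] norm_zero order_refl)
  then obtain Y where Y: "\<And>s. Y s 0 = s" "\<And>s t. (Y s has_vector_derivative G t (Y s t)) (at t)"
    by metis
  obtain p where p: "p 0 = 0" "\<And>t. (p has_vector_derivative G t (p t) + q t) (at t)"
  proof (rule global_solution_exists[of "\<lambda>t y. G t y + q t" l B 0 0])
    show "norm (G t x + q t - (G t y + q t)) \<le> l * norm (x - y)" for t x y
      using l(2)[of t "x - y"] by (simp add: diff[symmetric])
    show "norm (G t 0 + q t) \<le> B" for t using B by (simp add: linear_0[OF lin])
  qed (use cont' in auto)
  have zero: "u t = 0" if "\<And>t. (u has_vector_derivative G t (u t)) (at t)" "u 0 = 0" for u t
    by (rule vanishing_everywhere[OF l(1) that(1) l(2) that(2)])
  have superpose: "((\<lambda>t. a *\<^sub>R u t + v t) has_vector_derivative G t (a *\<^sub>R u t + v t) + (a *\<^sub>R r t + w t)) (at t)"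
    if "\<And>t. (u has_vector_derivative G t (u t) + r t) (at t)"
       "\<And>t. (v has_vector_derivative G t (v t) + w t) (at t)" for a u v r w t
  proof -
    have "((\<lambda>t. a *\<^sub>R u t + v t) has_vector_derivative a *\<^sub>R (G t (u t) + r t) + (G t (v t) + w t)) (at t)"
      by (intro has_vector_derivative_add bounded_linear.has_vector_derivative[OF bounded_linear_scaleR_right] that)
    then show ?thesis by (simp add: linear_add[OF lin] linear_cmul[OF lin] algebra_simps)
  qed
  have shift: "((\<lambda>t. u (t + T)) has_vector_derivative G t (u (t + T)) + r t) (at t)"
    if "\<And>t. (u has_vector_derivative G t (u t) + r t) (at t)" "\<And>t. r (t + T) = r t" for u r t
  proof (rule has_vector_derivative_shift_time)
    show "(u has_vector_derivative G t (u (t + T)) + r t) (at (t + T))"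
      using that(1)[of "t + T"] that(2) per(1) by simp
  qed
  have becomes_periodic: "u (t + T) = u t"
    if u: "\<And>t. (u has_vector_derivative G t (u t) + r t) (at t)" "\<And>t. r (t + T) = r t" "u T = u 0" for u r t
  proof -
    have "(-1) *\<^sub>R u t + u (t + T) = 0"
    proof (rule zero[where u = "\<lambda>t. (-1) *\<^sub>R u t + u (t + T)"])
      show "((\<lambda>t. (-1) *\<^sub>R u t + u (t + T)) has_vector_derivative G t ((-1) *\<^sub>R u t + u (t + T))) (at t)" for t
        using superpose[OF u(1) shift[OF u(1,2)], of "-1" t] by simp
      show "(-1) *\<^sub>R u 0 + u (0 + T) = 0" using u(3) by simp
    qed
    then show ?thesis by (simp add: algebra_simps)
  qed
  have Y': "(Y s has_vector_derivative G t (Y s t) + 0) (at t)" for s t using Y(2)[of s t] by simp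
  have Y_eq: "Y (a *\<^sub>R s + s') t = a *\<^sub>R Y s t + Y s' t" for a s s' t
  proof -
    have "(-1) *\<^sub>R Y (a *\<^sub>R s + s') t + (a *\<^sub>R Y s t + Y s' t) = 0"
    proof (rule zero[where u = "\<lambda>t. (-1) *\<^sub>R Y (a *\<^sub>R s + s') t + (a *\<^sub>R Y s t + Y s' t)"])
      have "((\<lambda>t. a *\<^sub>R Y s t + Y s' t) has_vector_derivative G t (a *\<^sub>R Y s t + Y s' t) + 0) (at t)" for t
        using superpose[OF Y' Y', of a s s' t] by simp
      from superpose[OF Y' this, of "-1" "a *\<^sub>R s + s'"]
      show "((\<lambda>t. (-1) *\<^sub>R Y (a *\<^sub>R s + s') t + (a *\<^sub>R Y s t + Y s' t)) has_vector_derivative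
        G t ((-1) *\<^sub>R Y (a *\<^sub>R s + s') t + (a *\<^sub>R Y s t + Y s' t))) (at t)" for t by simp
    qed (simp add: Y(1))
    then show ?thesis by simp
  qed
  define M where "M = (\<lambda>s. Y s T - s)"
  have "linear M"
  proof (rule linearI)
    show "M (s + s') = M s + M s'" for s s' using Y_eq[of 1 s s'] by (simp add: M_def)
    have "Y 0 t = 0" for t using Y_eq[of 1 0 0 t] by simp
    then show "M (a *\<^sub>R s) = a *\<^sub>R M s" for a s using Y_eq[of a s 0] by (simp add: M_def algebra_simps)
  qed
  moreover have "s = 0" if "M s = 0" for s
    using only_zero[of "Y s"] Y becomes_periodic[OF Y'] that by (simp add: M_def)
  ultimately have "surj M"
    by (intro linear_inj_imp_surj) (auto simp: linear_injective_0)
  then obtain s where s: "M s = - p T" by (metis surj_def)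
  define y where "y = (\<lambda>t. 1 *\<^sub>R Y s t + p t)"
  have y: "(y has_vector_derivative G t (y t) + q t) (at t)" for t
    using superpose[OF Y' p(2), of 1 s t] by (simp add: y_def)
  moreover have "y (t + T) = y t" for t
  proof (rule becomes_periodic[OF y per(2)])
    show "y T = y 0" using s p(1) Y(1) by (simp add: y_def M_def algebra_simps)
  qed
  ultimately show thesis using that by blast
qed

lemma has_real_derivative_bilinear_form:
  fixes P :: "real \<Rightarrow> real^'n^'m"
  assumes "(P has_vector_derivative P') (at t within S)"
    and "(u has_vector_derivative u') (at t within S)" "(w has_vector_derivative w') (at t within S)"
  shows "((\<lambda>t. u t \<bullet> (P t *v w t)) has_real_derivative
     u' \<bullet> (P t *v w t) + u t \<bullet> (P' *v w t) + u t \<bullet> (P t *v w')) (at t within S)"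
proof -
  have "((\<lambda>t. P t *v w t) has_vector_derivative P t *v w' + P' *v w t) (at t within S)"
    by (rule matrix_vector_deriv[OF assms(1,3)])
  from bounded_bilinear.has_vector_derivative[OF bounded_bilinear_inner assms(2) this]
  show ?thesis
    by (simp add: has_real_derivative_iff_has_vector_derivative inner_add_right algebra_simps)
qed

lemma inner_transpose_matrix_mult:
  fixes M :: "real^'n^'k" and N :: "real^'m^'k"
  shows "v \<bullet> ((transpose M ** N) *v w) = (M *v v) \<bullet> (N *v w)"
proof -
  have "v \<bullet> ((transpose M ** N) *v w) = v \<bullet> ((N *v w) v* M)"
    by (simp only: matrix_vector_mul_assoc[symmetric] transpose_matrix_vector)
  also have "\<dots> = (N *v w) \<bullet> (M *v v)"
    unfolding dot_lmul_matrix[symmetric] by (rule inner_commute)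
  finally show ?thesis by (simp only: inner_commute)
qed

text \<open>The Lyapunov equation is the condition under which the derivatives of \<open>u\<close> and \<open>w\<close> cancel
  against that of \<open>D\<close>, up to the inhomogeneity.\<close>

lemma bilinear_form_along_solutions:
  fixes A D :: "real \<Rightarrow> real^'m^'m"
  assumes "(D has_vector_derivative - (transpose (A t) ** D t + D t ** A t + Q)) (at t within S)"
    and "(u has_vector_derivative A t *v u t) (at t within S)"
    and "(w has_vector_derivative A t *v w t) (at t within S)"
  shows "((\<lambda>t. u t \<bullet> (D t *v w t)) has_real_derivative - (u t \<bullet> (Q *v w t))) (at t within S)"
proof -
  have neg: "(- M) *v x = - (M *v x)" for M :: "real^'m^'m" and x
    using matrix_vector_mult_diff_rdistrib[of 0 M x] by simp
  have "u t \<bullet> (- (transpose (A t) ** D t + D t ** A t + Q) *v w t) =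
      - (u t \<bullet> ((transpose (A t) ** D t) *v w t)) - u t \<bullet> ((D t ** A t) *v w t) - u t \<bullet> (Q *v w t)"
    by (simp add: neg matrix_vector_mult_diff_rdistrib inner_diff_right)
  also have "\<dots> = - ((A t *v u t) \<bullet> (D t *v w t)) - u t \<bullet> (D t *v (A t *v w t)) - u t \<bullet> (Q *v w t)"
    by (simp only: inner_transpose_matrix_mult matrix_vector_mul_assoc)
  finally show ?thesis
    using has_real_derivative_bilinear_form[OF assms] by simp
qed

lemma periodic_matrix_bounded:
  fixes M :: "real \<Rightarrow> real^'n^'m"
  assumes "continuous_on UNIV M" "\<And>t. M (t + T) = M t" "T > 0"
  obtains L where "L > 0" "\<And>t v. norm (M t *v v) \<le> L * norm v"
proof -
  obtain B where B: "B > 0" "\<And>t. norm (M t) \<le> B"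
    using periodic_continuous_bounded[of M, OF assms] by blast
  obtain K where K: "K > 0" "\<And>(N::real^'n^'m) v. norm (N *v v) \<le> norm N * norm v * K"
    using bounded_bilinear.pos_bounded[OF bounded_bilinear_matrix_vector_mult] by blast
  have "norm (M t *v v) \<le> (B * K) * norm v" for t v
  proof -
    have "norm (M t) * norm v * K \<le> B * norm v * K"
      using B K by (intro mult_right_mono) auto
    with K(2)[of "M t" v] show ?thesis by (simp add: ac_simps)
  qed
  with B K show thesis by (intro that[of "B * K"]) auto
qed

lemma Lyapunov_solution_deriv:
  assumes "SPPD_Lyapunov_solution T A Q P"
  shows "(P has_vector_derivative - (transpose (A t) ** P t + P t ** A t + Q t)) (at t)"
proof -
  have "P differentiable (at t)"
    using assms by (simp add: SPPD_Lyapunov_solution_def C1_differentiable_on_eq)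
  moreover have "vector_derivative P (at t) + transpose (A t) ** P t + P t ** A t + Q t = 0"
    using assms by (simp add: SPPD_Lyapunov_solution_def)
  then have "vector_derivative P (at t) = - (transpose (A t) ** P t + P t ** A t + Q t)"
    by (simp add: eq_neg_iff_add_eq_0 algebra_simps)
  ultimately show ?thesis using vector_derivative_works by metis
qed

locale periodic_linear_system =
  fixes A :: "real \<Rightarrow> real^'m^'m" and T :: real
  assumes A_cont: "continuous_on UNIV A" and A_per: "\<And>t. A (t + T) = A t" and T_pos: "T > 0"
begin

lemma joint_continuity: "continuous_on UNIV (\<lambda>p. A (fst p) *v snd p)"
  by (intro matrix_vector_continuous
      continuous_on_compose2[OF A_cont]) (auto intro: continuous_intros)

lemma A_bound: obtains L where "L \<ge> 0" "\<And>t v. norm (A t *v v) \<le> L * norm v"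
  using periodic_matrix_bounded[OF A_cont A_per T_pos] by (metis less_imp_le)

lemma solution_exists:
  obtains \<zeta> where "\<zeta> t0 = v" "\<And>t. (\<zeta> has_vector_derivative A t *v \<zeta> t) (at t)"
proof -
  obtain L where L: "L \<ge> 0" "\<And>t v. norm (A t *v v) \<le> L * norm v" using A_bound by blast
  show thesis
  proof (rule global_solution_exists[of "\<lambda>t v. A t *v v" L 0 t0 v])
    show "norm (A t *v x - A t *v y) \<le> L * norm (x - y)" for t x y
      using L(2)[of t "x - y"] by (simp add: matrix_vector_mult_diff_distrib)
  qed (use joint_continuity that in auto)
qed

lemma solution_unique_forward:
  assumes "ode_solution (\<lambda>t v. A t *v v) {t0..} \<zeta>" and "ode_solution (\<lambda>t v. A t *v v) {t0..} \<xi>"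
    and "\<zeta> t0 = \<xi> t0" "t \<ge> t0"
  shows "\<zeta> t = \<xi> t"
proof -
  obtain L where L: "L \<ge> 0" "\<And>t v. norm (A t *v v) \<le> L * norm v" using A_bound by blast
  have "\<zeta> t - \<xi> t = 0"
  proof (rule vanishing_forward[where u = "\<lambda>t. \<zeta> t - \<xi> t" and u' = "\<lambda>t. A t *v (\<zeta> t - \<xi> t)" and a = t0])
    fix s assume s: "s \<in> {t0..t}"
    have "(\<zeta> has_vector_derivative A s *v \<zeta> s) (at s within {t0..t})"
         "(\<xi> has_vector_derivative A s *v \<xi> s) (at s within {t0..t})"
      using assms s by (auto simp: ode_solution_def intro: has_vector_derivative_within_subset[where S = "{t0..}"])
    from has_vector_derivative_diff[OF this]
    show "((\<lambda>t. \<zeta> t - \<xi> t) has_vector_derivative A s *v (\<zeta> s - \<xi> s)) (at s within {t0..t})"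
      by (simp add: matrix_vector_mult_diff_distrib)
  qed (use assms L in auto)
  then show ?thesis by simp
qed

lemma bilinear_form_tendsto_0:
  assumes "linear_system_exponentially_stable A"
    and bil: "bounded (range (D :: real \<Rightarrow> real^'m^'m))"
    and u: "\<And>t. (u has_vector_derivative A t *v u t) (at t)"
    and w: "\<And>t. (w has_vector_derivative A t *v w t) (at t)"
  shows "((\<lambda>t. u t \<bullet> (D t *v w t)) \<longlongrightarrow> 0) at_top"
proof -
  obtain K c where K: "K > 0" and c: "c > 0" and stable:
    "\<forall>t0 \<zeta>. ode_solution (\<lambda>t v. A t *v v) {t0..} \<zeta> \<longrightarrow>
        (\<forall>t\<ge>t0. norm (\<zeta> t) \<le> K * exp (- c * (t - t0)) * norm (\<zeta> t0))"
    using assms(1) unfolding linear_system_exponentially_stable_def by blast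
  have to_zero: "(y \<longlongrightarrow> 0) at_top"
    if y: "\<And>t. (y has_vector_derivative A t *v y t) (at t)" for y :: "real \<Rightarrow> real^'m"
  proof (rule tendsto_norm_zero_cancel, rule exponential_bound_tendsto_0[OF c])
    have "ode_solution (\<lambda>t v. A t *v v) {0..} y"
      unfolding ode_solution_def using has_vector_derivative_at_within[OF y] by blast
    then show "norm (y t) \<le> (K * norm (y 0)) * exp (- c * t)" if "0 \<le> t" for t
      using stable[rule_format, of 0 y t] that by (simp add: mult_ac)
  qed simp
  have "((\<lambda>t. D t *v w t) \<longlongrightarrow> 0) at_top"
    unfolding tendsto_Zfun_iff diff_zero
  proof (rule bounded_bilinear.Bfun_prod_Zfun[OF bounded_bilinear_matrix_vector_mult])
    obtain B where "\<And>t. norm (D t) \<le> B" using bil by (auto simp: bounded_iff)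
    then show "Bfun D at_top" by (intro BfunI[of _ B]) simp
    show "Zfun w at_top" using to_zero[OF w] by (simp add: tendsto_Zfun_iff)
  qed
  from tendsto_inner[OF to_zero[OF u] this] show ?thesis by simp
qed

text \<open>Along solutions the bilinear form of \<open>D\<close> is constant and tends to zero. Any two vectors are the values
  of solutions at time \<open>t\<close>, so the form vanishes on them.\<close>

lemma homogeneous_Lyapunov_solution_zero:
  assumes stable: "linear_system_exponentially_stable A"
    and D: "\<And>t. (D has_vector_derivative - (transpose (A t) ** D t + D t ** A t)) (at t)"
    and per: "\<And>t. D (t + T) = D t"
  shows "D t = 0"
proof -
  have "continuous_on UNIV D"
    by (rule curve_continuous[OF D])
  then obtain B where "\<And>t. norm (D t) \<le> B"
    using periodic_continuous_bounded[of D T] per T_pos by blast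
  then have bounded: "bounded (range D)" by (auto simp: bounded_iff)
  have "v \<bullet> (D t *v w) = 0" for v w
  proof -
    obtain \<zeta> where \<zeta>: "\<zeta> t = v" "\<And>t. (\<zeta> has_vector_derivative A t *v \<zeta> t) (at t)"
      using solution_exists by blast
    obtain \<xi> where \<xi>: "\<xi> t = w" "\<And>t. (\<xi> has_vector_derivative A t *v \<xi> t) (at t)"
      using solution_exists by blast
    have "((\<lambda>t. \<zeta> t \<bullet> (D t *v \<xi> t)) has_real_derivative - (\<zeta> s \<bullet> (0 *v \<xi> s))) (at s)" for s
      by (rule bilinear_form_along_solutions[OF _ \<zeta>(2) \<xi>(2)]) (unfold add_0_right, rule D)
    then have "\<forall>s. ((\<lambda>t. \<zeta> t \<bullet> (D t *v \<xi> t)) has_real_derivative 0) (at s)" by simp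
    from DERIV_isconst_all[OF this, of _ t]
    have const: "\<zeta> s \<bullet> (D s *v \<xi> s) = v \<bullet> (D t *v w)" for s
      by (simp only: \<zeta>(1) \<xi>(1))
    from bilinear_form_tendsto_0[OF stable bounded \<zeta>(2) \<xi>(2)]
    show ?thesis by (simp add: const tendsto_const_iff)
  qed
  then have "D t *v w = 0" for w using inner_eq_zero_iff by blast
  then show "D t = 0" by (simp add: matrix_eq)
qed

text \<open>Along the solution through \<open>v\<close> the form never increases, decreases strictly at \<open>t0\<close>, and tends to
  zero. Were it not positive at \<open>t0\<close>, it would stay below a negative constant from then on.\<close>

lemma Lyapunov_solution_pos_def:
  assumes stable: "linear_system_exponentially_stable A" and Q: "SPPD T Q"
    and P: "\<And>t. (P has_vector_derivative - (transpose (A t) ** P t + P t ** A t + Q t)) (at t)"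
    and per: "\<And>t. P (t + T) = P t" and "v \<noteq> 0"
  shows "v \<bullet> (P t0 *v v) > 0"
proof (rule ccontr)
  assume *: "\<not> v \<bullet> (P t0 *v v) > 0"
  have "continuous_on UNIV P"
    by (rule curve_continuous[OF P])
  then obtain B where "\<And>t. norm (P t) \<le> B"
    using periodic_continuous_bounded[of P T] per T_pos by blast
  then have bounded: "bounded (range P)" by (auto simp: bounded_iff)
  obtain \<zeta> where \<zeta>: "\<zeta> t0 = v" "\<And>t. (\<zeta> has_vector_derivative A t *v \<zeta> t) (at t)"
    using solution_exists by blast
  define g where "g = (\<lambda>t. \<zeta> t \<bullet> (P t *v \<zeta> t))"
  have g: "(g has_real_derivative - (\<zeta> t \<bullet> (Q t *v \<zeta> t))) (at t)" for t
    unfolding g_def by (rule bilinear_form_along_solutions[OF P \<zeta>(2) \<zeta>(2)])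
  have Q_nonneg: "u \<bullet> (Q t *v u) \<ge> 0" for u t
    using Q unfolding SPPD_def by (cases "u = 0") (auto simp: less_imp_le)
  have "- (\<zeta> t0 \<bullet> (Q t0 *v \<zeta> t0)) < 0"
    using Q \<open>v \<noteq> 0\<close> unfolding SPPD_def by (simp add: \<zeta>(1))
  from DERIV_neg_dec_right[OF g this] obtain d where d: "d > 0" "\<And>h. 0 < h \<Longrightarrow> h < d \<Longrightarrow> g (t0 + h) < g t0"
    by blast
  define t1 where "t1 = t0 + d / 2"
  have "g t1 < g t0" using d by (simp add: t1_def)
  moreover have "g t0 \<le> 0" using * by (simp add: g_def \<zeta>(1))
  moreover have "g t \<le> g t1" if "t \<ge> t1" for t
    by (rule DERIV_nonpos_imp_nonincreasing[OF that]) (use g Q_nonneg in force)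
  then have "\<forall>\<^sub>F t in at_top. g t \<le> g t1"
    by (intro eventually_mono[OF eventually_ge_at_top[of t1]]) auto
  then have "0 \<le> g t1"
    using bilinear_form_tendsto_0[OF stable bounded \<zeta>(2) \<zeta>(2)] tendsto_upperbound[of g 0 at_top "g t1"]
    by (simp add: g_def)
  ultimately show False by simp
qed

text \<open>Symmetry and positivity are consequences of stability: \<open>transpose P - P\<close> is a periodic solution of
  the homogeneous equation. Only a periodic solution of an affine differential equation remains to be
  found.\<close>

lemma SPPD_Lyapunov_solution_iff:
  assumes stable: "linear_system_exponentially_stable A" and Q: "SPPD T Q" "continuous_on UNIV Q"
  shows "SPPD_Lyapunov_solution T A Q P \<longleftrightarrow>
     (\<forall>t. (P has_vector_derivative - (transpose (A t) ** P t + P t ** A t + Q t)) (at t)) \<and>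
     (\<forall>t. P (t + T) = P t)" (is "?sol \<longleftrightarrow> ?deriv \<and> ?per")
proof
  assume sol: ?sol
  then have "SPPD T P" by (simp add: SPPD_Lyapunov_solution_def)
  then show "?deriv \<and> ?per" using Lyapunov_solution_deriv[OF sol] by (simp add: SPPD_def)
next
  assume *: "?deriv \<and> ?per"
  then have P: "(P has_vector_derivative - (transpose (A t) ** P t + P t ** A t + Q t)) (at t)"
    and per: "P (t + T) = P t" for t by auto
  have P_cont: "continuous_on UNIV P"
    by (rule curve_continuous[OF P])
  have "P C1_differentiable_on UNIV"
    unfolding C1_differentiable_on_def
  proof (intro exI conjI ballI)
    show "(P has_vector_derivative - (transpose (A t) ** P t + P t ** A t + Q t)) (at t)" for t by (rule P)
    show "continuous_on UNIV (\<lambda>t. - (transpose (A t) ** P t + P t ** A t + Q t))"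
      by (intro continuous_intros Q(2) P_cont A_cont transpose_continuous
          matrix_matrix_continuous)
  qed
  moreover have "SPPD T P"
    unfolding SPPD_def
  proof (intro allI conjI impI)
    fix t
    have "(\<lambda>t. transpose (P t) - P t) t = 0"
    proof (rule homogeneous_Lyapunov_solution_zero[OF stable])
      fix t
      have "((\<lambda>t. transpose (P t)) has_vector_derivative
         transpose (- (transpose (A t) ** P t + P t ** A t + Q t))) (at t)"
        by (rule transpose_deriv[OF P])
      moreover have "transpose (- (transpose (A t) ** P t + P t ** A t + Q t)) =
          - (transpose (P t) ** A t + transpose (A t) ** transpose (P t) + Q t)"
        using Q(1) linear_neg[OF bounded_linear.linear[OF bounded_linear_transpose], of "transpose (A t) ** P t + P t ** A t + Q t"]
        by (simp add: linear_add[OF bounded_linear.linear[OF bounded_linear_transpose]] matrix_transpose_mul SPPD_def)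
      ultimately have "((\<lambda>t. transpose (P t)) has_vector_derivative
         - (transpose (P t) ** A t + transpose (A t) ** transpose (P t) + Q t)) (at t)" by (simp only:)
      from has_vector_derivative_diff[OF this P]
      show "((\<lambda>t. transpose (P t) - P t) has_vector_derivative
         - (transpose (A t) ** (transpose (P t) - P t) + (transpose (P t) - P t) ** A t)) (at t)"
        by (rule back_subst[of "\<lambda>d. (_ has_vector_derivative d) _"])
           (simp add: matrix_matrix_diff algebra_simps)
    qed (simp add: per)
    then show "transpose (P t) = P t" by simp
    show "v \<bullet> (P t *v v) > 0" if "v \<noteq> 0" for v
      by (rule Lyapunov_solution_pos_def[OF stable Q(1) P per that])
  qed (rule per)
  moreover have "vector_derivative P (at t) = - (transpose (A t) ** P t + P t ** A t + Q t)" for t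
    by (rule vector_derivative_at[OF P])
  ultimately show ?sol by (simp add: SPPD_Lyapunov_solution_def)
qed

theorem stable_imp_ex1_Lyapunov_solution:
  assumes stable: "linear_system_exponentially_stable A" and Q: "SPPD T Q" "continuous_on UNIV Q"
  shows "\<exists>!P. SPPD_Lyapunov_solution T A Q P"
proof -
  define G where "G = (\<lambda>t Y. - (transpose (A t) ** Y + Y ** A t))"
  obtain B where B: "B > 0" "\<And>t. norm (A t) \<le> B"
    using periodic_continuous_bounded[OF A_cont A_per T_pos] by blast
  obtain K where K: "K \<ge> 0" "\<And>(M::real^'m^'m) (N::real^'m^'m). norm (M ** N) \<le> norm M * norm N * K"
    using bounded_bilinear.nonneg_bounded[OF bounded_bilinear_matrix_matrix_mult] by blast
  obtain k where k: "k \<ge> 0" "\<And>(M::real^'m^'m). norm (transpose M) \<le> norm M * k"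
    using bounded_linear.nonneg_bounded[OF bounded_linear_transpose] by blast
  obtain P where P: "\<And>t. (P has_vector_derivative G t (P t) + - Q t) (at t)" "\<And>t. P (t + T) = P t"
  proof (rule Fredholm_periodic_solution[of G "B * k * K + B * K" T "\<lambda>t. - Q t"])
    show "linear (G t)" for t
      unfolding G_def linear_iff
      by (simp add: bounded_bilinear.add_left[OF bounded_bilinear_matrix_matrix_mult]
          bounded_bilinear.add_right[OF bounded_bilinear_matrix_matrix_mult]
          bounded_bilinear.scaleR_left[OF bounded_bilinear_matrix_matrix_mult]
          bounded_bilinear.scaleR_right[OF bounded_bilinear_matrix_matrix_mult] algebra_simps)
    show "continuous_on UNIV (\<lambda>p. G (fst p) (snd p))"
      unfolding G_def
      by (intro continuous_intros transpose_continuous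
          matrix_matrix_continuous
          continuous_on_compose2[OF A_cont]) auto
    show "norm (G t Y) \<le> (B * k * K + B * K) * norm Y" for t Y
    proof -
      have 1: "norm (transpose (A t)) \<le> B * k"
        using k(2)[of "A t"] mult_right_mono[OF B(2)[of t] k(1)] by linarith
      have "norm (G t Y) \<le> norm (transpose (A t) ** Y) + norm (Y ** A t)"
        unfolding G_def norm_minus_cancel by (rule norm_triangle_ineq)
      also have "\<dots> \<le> (B * k) * norm Y * K + norm Y * B * K"
        using K(2)[of "transpose (A t)" Y] K(2)[of Y "A t"] K(1) B
          mult_right_mono[OF mult_right_mono[OF 1, of "norm Y"] K(1)]
          mult_right_mono[OF mult_left_mono[OF B(2)[of t], of "norm Y"] K(1)]
        by (intro add_mono) (auto intro: order_trans)
      finally show ?thesis by (simp add: algebra_simps)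
    qed
    show "continuous_on UNIV (\<lambda>t. - Q t)" by (intro continuous_intros Q(2))
    show "y 0 = 0" if "\<And>t. (y has_vector_derivative G t (y t)) (at t)" "\<And>t. y (t + T) = y t" for y
      using homogeneous_Lyapunov_solution_zero[OF stable that(1)[unfolded G_def] that(2)] by blast
  qed (use A_per Q(1) T_pos in \<open>auto simp: G_def SPPD_def fun_eq_iff\<close>)
  have "G t (P t) + - Q t = - (transpose (A t) ** P t + P t ** A t + Q t)" for t
    by (simp add: G_def)
  with P have sol: "SPPD_Lyapunov_solution T A Q P"
    unfolding SPPD_Lyapunov_solution_iff[OF assms] by simp
  moreover have "P1 = P" if P1: "SPPD_Lyapunov_solution T A Q P1" for P1
  proof
    fix t
    have "(\<lambda>t. P1 t - P t) t = 0"
    proof (rule homogeneous_Lyapunov_solution_zero[OF stable])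
      fix t
      have "((\<lambda>t. P1 t - P t) has_vector_derivative
         - (transpose (A t) ** P1 t + P1 t ** A t + Q t)
         - - (transpose (A t) ** P t + P t ** A t + Q t)) (at t)"
        using P1 sol unfolding SPPD_Lyapunov_solution_iff[OF assms] by (intro has_vector_derivative_diff) auto
      then show "((\<lambda>t. P1 t - P t) has_vector_derivative
         - (transpose (A t) ** (P1 t - P t) + (P1 t - P t) ** A t)) (at t)"
        by (rule back_subst[of "\<lambda>d. (_ has_vector_derivative d) _"])
           (simp add: matrix_matrix_diff algebra_simps)
      show "P1 (t + T) - P (t + T) = P1 t - P t"
        using P1 sol unfolding SPPD_Lyapunov_solution_iff[OF assms] by simp
    qed
    then show "P1 t = P t" by simp
  qed
  ultimately show ?thesis by blast
qed

end

text \<open>Compactness of one period times the unit sphere.\<close>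

lemma SPPD_bounds:
  fixes M :: "real \<Rightarrow> real^'m^'m"
  assumes M: "SPPD T M" "continuous_on UNIV M" and T: "T > 0"
  obtains k1 k2 where "k1 > 0" "k2 > 0"
    "\<And>t v. k1 * (norm v)\<^sup>2 \<le> v \<bullet> (M t *v v)" "\<And>t v. v \<bullet> (M t *v v) \<le> k2 * (norm v)\<^sup>2"
proof -
  define S where "S = {0..T} \<times> sphere (0::real^'m) 1"
  define F where "F = (\<lambda>p. snd p \<bullet> (M (fst p) *v snd p))"
  have "compact S" unfolding S_def by (intro compact_Times) auto
  have "(0, axis undefined 1) \<in> S" using T by (simp add: S_def)
  then have "S \<noteq> {}" by blast
  have "continuous_on S F"
    unfolding F_def
    by (intro continuous_intros matrix_vector_continuous
        continuous_on_compose2[OF M(2)]) auto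
  from continuous_attains_inf[OF \<open>compact S\<close> \<open>S \<noteq> {}\<close> this]
    continuous_attains_sup[OF \<open>compact S\<close> \<open>S \<noteq> {}\<close> this]
  obtain p q where p: "p \<in> S" "\<And>x. x \<in> S \<Longrightarrow> F p \<le> F x" and q: "q \<in> S" "\<And>x. x \<in> S \<Longrightarrow> F x \<le> F q"
    by blast
  have pos: "F x > 0" if "x \<in> S" for x
  proof -
    have "snd x \<noteq> 0" using that by (auto simp: S_def)
    then show ?thesis using M(1) unfolding F_def SPPD_def by blast
  qed
  have main: "F p * (norm v)\<^sup>2 \<le> v \<bullet> (M t *v v) \<and> v \<bullet> (M t *v v) \<le> F q * (norm v)\<^sup>2" for t v
  proof (cases "v = 0")
    case False
    obtain k :: int where k: "t + of_int k * T \<in> {0..<T}" using reduce_to_period[OF T] by blast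
    define w where "w = v /\<^sub>R norm v"
    have "(t + of_int k * T, w) \<in> S" using k False by (auto simp: S_def w_def)
    from p(2)[OF this] q(2)[OF this] have *: "F p \<le> w \<bullet> (M t *v w)" "w \<bullet> (M t *v w) \<le> F q"
      using periodic_int_shift[of M T t k] M(1) by (auto simp: F_def SPPD_def)
    have "v = norm v *\<^sub>R w" using False by (simp add: w_def)
    then have "v \<bullet> (M t *v v) = (norm v)\<^sup>2 * (w \<bullet> (M t *v w))"
      by (metis inner_scaleR_left inner_scaleR_right matrix_vector_mult_scaleR mult.assoc power2_eq_square)
    with mult_left_mono[OF *(1), of "(norm v)\<^sup>2"] mult_left_mono[OF *(2), of "(norm v)\<^sup>2"]
    show ?thesis by (simp add: mult.commute)
  qed simp
  show thesis using that[of "F p" "F q"] pos p(1) q(1) main by blast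
qed

text \<open>For \<open>Q = 1\<close> the form \<open>\<zeta> \<bullet> P \<zeta>\<close> has derivative \<open>- |\<zeta>|\<^sup>2\<close>, which is at most \<open>- 1 / k2\<close> times the
  form, for the upper bound \<open>k2\<close> of \<open>P\<close>.\<close>

lemma Lyapunov_solution_imp_stable:
  fixes A :: "real \<Rightarrow> real^'m^'m"
  assumes "T > 0" and P: "SPPD_Lyapunov_solution T A (\<lambda>_. mat 1) P"
  shows "linear_system_exponentially_stable A"
proof -
  note deriv = Lyapunov_solution_deriv[OF P]
  have cont: "continuous_on UNIV P" by (rule curve_continuous[OF deriv])
  have P_SPPD: "SPPD T P" using P by (simp add: SPPD_Lyapunov_solution_def)
  obtain k1 k2 where k: "k1 > 0" "k2 > 0" "\<And>t v. k1 * (norm v)\<^sup>2 \<le> v \<bullet> (P t *v v)"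
    "\<And>t v. v \<bullet> (P t *v v) \<le> k2 * (norm v)\<^sup>2"
    using SPPD_bounds[OF P_SPPD cont \<open>T > 0\<close>] by blast
  define c where "c = 1 / k2"
  have c: "c > 0" using k by (simp add: c_def)
  have main: "norm (\<zeta> t) \<le> sqrt (k2 / k1) * exp (- (c / 2) * (t - t0)) * norm (\<zeta> t0)"
    if \<zeta>: "ode_solution (\<lambda>t v. A t *v v) {t0..} \<zeta>" and "t \<ge> t0" for t0 \<zeta> t
  proof -
    define w where "w = (\<lambda>s. exp (c * (s - t0)) * (\<zeta> s \<bullet> (P s *v \<zeta> s)))"
    have d\<zeta>: "(\<zeta> has_vector_derivative A s *v \<zeta> s) (at s within {t0..t})" if "s \<in> {t0..t}" for s
      using \<zeta> that by (auto simp: ode_solution_def intro: has_vector_derivative_within_subset[where S = "{t0..}"])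
    have "continuous_on {t0..t} \<zeta>"
      by (rule continuous_on_vector_derivative) (rule d\<zeta>)
    then have "continuous_on {t0..t} w"
      unfolding w_def
      by (intro continuous_intros matrix_vector_continuous
          continuous_on_subset[OF cont]) auto
    moreover have "\<exists>y. (w has_real_derivative y) (at s) \<and> y \<le> 0" if s: "t0 < s" "s < t" for s
    proof -
      have ds: "(\<zeta> has_vector_derivative A s *v \<zeta> s) (at s)"
        using d\<zeta>[of s] s at_within_Icc_at[of t0 s t] by simp
      have "((\<lambda>t. \<zeta> t \<bullet> (P t *v \<zeta> t)) has_real_derivative - (\<zeta> s \<bullet> (mat 1 *v \<zeta> s))) (at s)"
        by (rule bilinear_form_along_solutions[where A = A and D = P and Q = "mat 1"]) (fact deriv ds)+
      then have "((\<lambda>t. \<zeta> t \<bullet> (P t *v \<zeta> t)) has_real_derivative - (norm (\<zeta> s))\<^sup>2) (at s)"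
        by (simp add: power2_norm_eq_inner)
      then have "(w has_real_derivative exp (c * (s - t0)) * (c * (\<zeta> s \<bullet> (P s *v \<zeta> s)) - (norm (\<zeta> s))\<^sup>2)) (at s)"
        unfolding w_def by (auto intro!: derivative_eq_intros simp: algebra_simps)
      moreover have "c * (\<zeta> s \<bullet> (P s *v \<zeta> s)) - (norm (\<zeta> s))\<^sup>2 \<le> 0"
        using k(2) mult_left_mono[OF k(4)[of "\<zeta> s" s], of c] c by (simp add: c_def)
      ultimately show ?thesis
        by (intro exI[of _ "exp (c * (s - t0)) * (c * (\<zeta> s \<bullet> (P s *v \<zeta> s)) - (norm (\<zeta> s))\<^sup>2)"])
          (simp add: mult_nonneg_nonpos)
    qed
    ultimately have "w t \<le> w t0"
      by (intro DERIV_nonpos_imp_decreasing_open[where f = w and a = t0 and b = t] \<open>t \<ge> t0\<close>)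
    have "exp (c * (t - t0)) * (k1 * (norm (\<zeta> t))\<^sup>2) \<le> w t"
      unfolding w_def by (rule mult_left_mono[OF k(3)]) simp
    also note \<open>w t \<le> w t0\<close>
    also have "w t0 \<le> k2 * (norm (\<zeta> t0))\<^sup>2" unfolding w_def using k by simp
    finally have "exp (c * (t - t0)) * (k1 * (norm (\<zeta> t))\<^sup>2) \<le> k2 * (norm (\<zeta> t0))\<^sup>2" .
    from norm_decay_from_quadratic_decay[OF k(1,2) norm_ge_zero this] show ?thesis .
  qed
  have "sqrt (k2 / k1) > 0" "c / 2 > 0" using k c by auto
  with main show ?thesis unfolding linear_system_exponentially_stable_def by blast
qed

section \<open>Orbital stability from a Lyapunov function\<close>

text \<open>The rate \<open>c = k3 / k2\<close> is the one for which \<open>exp (c t) V\<close> does not increase.\<close>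

lemma Lyapunov_decay_along_solution:
  fixes f :: "'a::real_normed_vector \<Rightarrow> 'a"
  assumes V: "\<And>x. x \<in> U \<Longrightarrow> k1 * (infdist x \<Gamma>)\<^sup>2 \<le> V x \<and> V x \<le> k2 * (infdist x \<Gamma>)\<^sup>2 \<and>
        (\<forall>\<phi> e. e > 0 \<and> \<phi> 0 = x \<and> ode_solution (\<lambda>_. f) {-e<..<e} \<phi> \<longrightarrow>
           (\<exists>v. ((\<lambda>t. V (\<phi> t)) has_real_derivative v) (at 0) \<and> v \<le> - k3 * (infdist x \<Gamma>)\<^sup>2))"
    and k: "k1 > 0" "k2 > 0" "k3 > 0"
    and "0 \<le> s" and cont: "continuous_on UNIV \<phi>"
    and U: "\<And>x. infdist x \<Gamma> < \<rho> \<Longrightarrow> x \<in> U"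
    and deriv: "\<And>t. infdist (\<phi> t) \<Gamma> < \<rho> \<Longrightarrow> (\<phi> has_vector_derivative f (\<phi> t)) (at t)"
    and stay: "\<And>t. t \<in> {0..s} \<Longrightarrow> infdist (\<phi> t) \<Gamma> < \<rho>"
  shows "infdist (\<phi> s) \<Gamma> \<le> sqrt (k2 / k1) * infdist (\<phi> 0) \<Gamma> * exp (- (k3 / k2 / 2) * s)"
proof -
  define c where "c = k3 / k2"
  define w where "w = (\<lambda>t. exp (c * t) * V (\<phi> t))"
  define d where "d = (\<lambda>t. infdist (\<phi> t) \<Gamma>)"
  have d_nonneg: "d t \<ge> 0" for t by (simp add: d_def infdist_nonneg)
  have "w s \<le> w 0"
  proof (rule DERIV_nonpos_imp_nonincreasing[where f = w and a = 0 and b = s])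
    fix t assume t: "0 \<le> t" "t \<le> s"
    have near: "infdist (\<phi> t) \<Gamma> < \<rho>" using stay t by simp
    have "open ((\<lambda>t. infdist (\<phi> t) \<Gamma>) -` {..<\<rho>})"
      by (intro open_vimage continuous_on_infdist cont) simp
    then obtain e where e: "e > 0" "ball t e \<subseteq> (\<lambda>t. infdist (\<phi> t) \<Gamma>) -` {..<\<rho>}"
      using near by (auto elim!: openE)
    \<comment> \<open>The assumption on V speaks of time 0, so the solution is shifted to pass through \<open>\<phi> t\<close> then.\<close>
    define \<psi> where "\<psi> = (\<lambda>h. \<phi> (h + t))"
    have "(\<psi> has_vector_derivative f (\<psi> h)) (at h)" if "h \<in> {-e<..<e}" for h
    proof -
      have "(\<phi> has_vector_derivative f (\<phi> (h + t))) (at (h + t))"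
        using e(2) that by (intro deriv) (auto simp: subset_iff dist_real_def)
      moreover have "((\<lambda>h. h + t) has_vector_derivative 1) (at h)"
        by (auto intro!: derivative_eq_intros)
      ultimately show ?thesis
        using vector_diff_chain_at[of "\<lambda>h. h + t" 1 h \<phi>] by (simp add: \<psi>_def o_def)
    qed
    then have "ode_solution (\<lambda>_. f) {-e<..<e} \<psi>"
      by (simp add: ode_solution_def has_vector_derivative_at_within)
    moreover have "\<psi> 0 = \<phi> t" by (simp add: \<psi>_def)
    ultimately obtain v where v: "((\<lambda>h. V (\<psi> h)) has_real_derivative v) (at 0)"
      "v \<le> - k3 * (d t)\<^sup>2" and Vt: "V (\<phi> t) \<le> k2 * (d t)\<^sup>2"
      using V[OF U[OF near]] e(1) unfolding d_def by blast
    from v(1) have "((\<lambda>t. V (\<phi> t)) has_real_derivative v) (at t)"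
      using DERIV_shift[of "\<lambda>t. V (\<phi> t)" v 0 t] by (simp add: \<psi>_def)
    then have "(w has_real_derivative exp (c * t) * (c * V (\<phi> t) + v)) (at t)"
      unfolding w_def by (auto intro!: derivative_eq_intros simp: algebra_simps)
    moreover have "c * V (\<phi> t) + v \<le> 0"
      using mult_left_mono[OF Vt, of c] v(2) k by (simp add: c_def)
    ultimately show "\<exists>y. (w has_real_derivative y) (at t) \<and> y \<le> 0"
      by (intro exI[of _ "exp (c * t) * (c * V (\<phi> t) + v)"]) (simp add: mult_nonneg_nonpos)
  qed (rule \<open>0 \<le> s\<close>)
  have "exp (c * s) * (k1 * (d s)\<^sup>2) \<le> w s"
    unfolding w_def using V[OF U[OF stay[of s]]] \<open>0 \<le> s\<close> by (auto simp: d_def)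
  also note \<open>w s \<le> w 0\<close>
  also have "w 0 \<le> k2 * (d 0)\<^sup>2"
    unfolding w_def using V[OF U[OF stay[of 0]]] \<open>0 \<le> s\<close> by (auto simp: d_def)
  finally have "exp (c * s) * (k1 * (d s)\<^sup>2) \<le> k2 * (d 0)\<^sup>2" .
  from norm_decay_from_quadratic_decay[OF k(1,2) d_nonneg this]
  show ?thesis by (simp add: c_def d_def mult_ac)
qed

text \<open>As long as a solution from within \<open>b\<close> of \<open>\<Gamma>\<close> stays within \<open>\<rho>\<close>, the decay estimate keeps it within
  \<open>\<rho> / 2\<close>. Before leaving it would have to pass the distance \<open>3 \<rho> / 4\<close>, which is impossible.
  A field cut off outside a large ball supplies a curve for all times to which this applies.\<close>

theorem Lyapunov_function_imp_exponentially_orbitally_stable: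
  fixes f :: "'a::euclidean_space \<Rightarrow> 'a"
  assumes f: "lipschitz_on_balls f" and \<Gamma>: "compact \<Gamma>" "\<Gamma> \<noteq> {}"
    and V: "verifies_exponential_orbital_stability f \<Gamma> U V"
  shows "exponentially_orbitally_stable f \<Gamma>"
proof -
  obtain k1 k2 k3 where k: "k1 > 0" "k2 > 0" "k3 > 0" and
    V': "\<forall>x\<in>U. k1 * (infdist x \<Gamma>)\<^sup>2 \<le> V x \<and> V x \<le> k2 * (infdist x \<Gamma>)\<^sup>2 \<and>
        (\<forall>\<phi> e. e > 0 \<and> \<phi> 0 = x \<and> ode_solution (\<lambda>_. f) {-e<..<e} \<phi> \<longrightarrow>
           (\<exists>v. ((\<lambda>t. V (\<phi> t)) has_real_derivative v) (at 0) \<and> v \<le> - k3 * (infdist x \<Gamma>)\<^sup>2))"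
    and U: "open U" "\<Gamma> \<subseteq> U"
    using V unfolding verifies_exponential_orbital_stability_def
    by (elim conjE exE) (rule that; assumption)
  obtain \<rho> where \<rho>: "\<rho> > 0" "{x. infdist x \<Gamma> \<le> \<rho>} \<subseteq> U"
    using compact_in_open_separated[OF \<Gamma>(2,1) U] by blast
  have "bounded {x. infdist x \<Gamma> \<le> \<rho>}"
    by (intro compact_imp_bounded compact_infdist_le \<Gamma> \<rho>)
  then obtain R where R: "R > 0" "\<And>x. infdist x \<Gamma> \<le> \<rho> \<Longrightarrow> norm x \<le> R"
    by (auto simp: bounded_pos)
  define K where "K = 1 + sqrt (k2 / k1)"
  define c where "c = k3 / k2 / 2"
  define b where "b = \<rho> / (2 * K)"
  have K: "K \<ge> 1" "sqrt (k2 / k1) \<le> K" using k by (auto simp: K_def)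
  have c: "c > 0" using k by (simp add: c_def)
  have b: "b > 0" "b \<le> \<rho> / 2" "K * b = \<rho> / 2"
    using K \<rho> by (auto simp: b_def field_simps)
  have main: "\<exists>x. unique_forward_solution f x0 x \<and> (\<forall>t\<ge>0. infdist (x t) \<Gamma> \<le> K * infdist x0 \<Gamma> * exp (- c * t))"
    if x0: "infdist x0 \<Gamma> < b" for x0
  proof -
    obtain \<phi> where \<phi>: "\<phi> 0 = x0" "continuous_on UNIV \<phi>"
      "\<And>t. norm (\<phi> t) \<le> R \<Longrightarrow> (\<phi> has_vector_derivative f (\<phi> t)) (at t)"
      using solution_while_in_ball[OF f R(1), of x0] by blast
    have deriv: "(\<phi> has_vector_derivative f (\<phi> t)) (at t)" if "infdist (\<phi> t) \<Gamma> < \<rho>" for t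
      using that by (intro \<phi>(3) R(2)) simp
    have decay: "infdist (\<phi> s) \<Gamma> \<le> K * infdist x0 \<Gamma> * exp (- c * s)"
      if "0 \<le> s" and stay: "\<And>t. t \<in> {0..s} \<Longrightarrow> infdist (\<phi> t) \<Gamma> < \<rho>" for s
    proof -
      have "infdist (\<phi> s) \<Gamma> \<le> sqrt (k2 / k1) * infdist (\<phi> 0) \<Gamma> * exp (- (k3 / k2 / 2) * s)"
        using \<rho>(2) by (intro Lyapunov_decay_along_solution[OF bspec[OF V'] k \<open>0 \<le> s\<close> \<phi>(2) _ deriv stay]) auto
      also have "\<dots> \<le> K * infdist x0 \<Gamma> * exp (- c * s)"
        unfolding \<phi>(1) c_def using K by (intro mult_right_mono infdist_nonneg) auto
      finally show ?thesis .
    qed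
    have stay: "infdist (\<phi> s) \<Gamma> < \<rho>" if "s \<ge> 0" for s
    proof (rule ccontr)
      assume bad: "\<not> infdist (\<phi> s) \<Gamma> < \<rho>"
      define S where "S = {0..s} \<inter> (\<lambda>t. infdist (\<phi> t) \<Gamma>) -` {\<rho>..}"
      have cont: "continuous_on A (\<lambda>t. infdist (\<phi> t) \<Gamma>)" for A
        by (intro continuous_on_infdist continuous_on_subset[OF \<phi>(2)]) auto
      have "compact S"
        unfolding S_def by (intro compact_Int_closed closed_vimage cont) auto
      moreover have "S \<noteq> {}" using bad that by (auto simp: S_def)
      ultimately obtain t1 where t1: "t1 \<in> S" "\<And>t. t \<in> S \<Longrightarrow> t1 \<le> t"
        using continuous_attains_inf[of S "\<lambda>t. t"] by auto
      have "\<exists>t2. 0 \<le> t2 \<and> t2 \<le> t1 \<and> infdist (\<phi> t2) \<Gamma> = 3 * \<rho> / 4"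
        using t1(1) x0 b \<rho>(1) \<phi>(1) cont by (intro IVT') (auto simp: S_def)
      then obtain t2 where t2: "0 \<le> t2" "t2 \<le> t1" "infdist (\<phi> t2) \<Gamma> = 3 * \<rho> / 4" by blast
      have "infdist (\<phi> t) \<Gamma> < \<rho>" if "t \<in> {0..t2}" for t
      proof (rule ccontr)
        assume *: "\<not> infdist (\<phi> t) \<Gamma> < \<rho>"
        then have "t \<in> S" using that t1 t2 by (auto simp: S_def)
        then have "t = t2" using t1(2)[of t] that t2 by auto
        with * t2 \<rho>(1) show False by auto
      qed
      then have "infdist (\<phi> t2) \<Gamma> \<le> K * infdist x0 \<Gamma> * exp (- c * t2)"
        using t2(1) by (intro decay) auto
      also have "\<dots> \<le> K * infdist x0 \<Gamma> * 1"
        using K c t2(1) by (intro mult_left_mono mult_nonneg_nonneg infdist_nonneg) auto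
      also have "\<dots> \<le> K * b" using K x0 by simp
      finally show False using t2(3) b \<rho>(1) by simp
    qed
    have "ode_solution (\<lambda>_. f) {0..} \<phi>"
      unfolding ode_solution_def using has_vector_derivative_at_within[OF deriv[OF stay]] by auto
    from unique_forward_solutionI[OF f this] decay stay \<phi>(1) show ?thesis by auto
  qed
  have decay_tendsto: "((\<lambda>t. infdist (x t) \<Gamma>) \<longlongrightarrow> 0) at_top"
    if "\<forall>t\<ge>0. infdist (x t) \<Gamma> \<le> D * exp (- c * t)" for x :: "real \<Rightarrow> 'a" and D
    by (rule exponential_bound_tendsto_0[OF c]) (use that infdist_nonneg in auto)
  have "asymptotically_orbitally_stable f \<Gamma>"
    unfolding asymptotically_orbitally_stable_def using main decay_tendsto b(1) by meson
  moreover have "K > 0" using K by simp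
  ultimately show ?thesis
    unfolding exponentially_orbitally_stable_def using main b(1) c by blast
qed

section \<open>A periodic orbit with a moving orthonormal frame\<close>

text \<open>Vectors \<open>transpose (Pm t) *v p\<close> are to keep this form under simplification.\<close>

declare transpose_matrix_vector [simp del] vector_transpose_matrix [simp del]

text \<open>The rows of \<open>Pm t\<close> and the unit vector \<open>z t\<close> form an orthonormal basis; the last three
  assumptions express this in terms of \<open>Pm t\<close> alone. The argument depends on the frame only through these
  relations and its differentiability.\<close>

locale transversal_frame =
  fixes f :: "real^'n \<Rightarrow> real^'n" and T :: real and xs z :: "real \<Rightarrow> real^'n"
    and Pm :: "real \<Rightarrow> real^'n^'m" and \<delta> :: real
  assumes f_deriv: "\<And>x. (f has_derivative (\<lambda>h. jacobian f x *v h)) (at x)"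
    and J_cont: "continuous_on UNIV (jacobian f)"
    and T_pos: "T > 0"
    and xs_deriv: "\<And>t. (xs has_vector_derivative f (xs t)) (at t)"
    and xs_per: "\<And>t. xs (t + T) = xs t"
    and xs_min: "\<And>s. 0 < s \<Longrightarrow> s < T \<Longrightarrow> \<not> (\<forall>t. xs (t + s) = xs t)"
    and z_deriv: "\<And>t. (z has_vector_derivative vector_derivative z (at t)) (at t)"
    and dz_cont: "continuous_on UNIV (\<lambda>t. vector_derivative z (at t))"
    and z_per: "\<And>t. z (t + T) = z t"
    and z_norm: "\<And>t. norm (z t) = 1"
    and \<delta>_pos: "\<delta> > 0" and transversal: "\<And>t. z t \<bullet> f (xs t) > \<delta>"
    and Pm_deriv: "\<And>t. (Pm has_vector_derivative vector_derivative Pm (at t)) (at t)"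
    and dPm_cont: "continuous_on UNIV (\<lambda>t. vector_derivative Pm (at t))"
    and Pm_per: "\<And>t. Pm (t + T) = Pm t"
    and Pm_z: "\<And>t. Pm t *v z t = 0"
    and Pm_right: "\<And>t p. Pm t *v (transpose (Pm t) *v p) = p"
    and Pm_left: "\<And>t v. transpose (Pm t) *v (Pm t *v v) = v - (z t \<bullet> v) *\<^sub>R z t"
begin

abbreviation "dz t \<equiv> vector_derivative z (at t)"
abbreviation "dPm t \<equiv> vector_derivative Pm (at t)"
abbreviation "A \<equiv> transverse_linearization f xs z Pm"
abbreviation "\<Gamma> \<equiv> orbit T xs"

lemma vector_derivative_periodic:
  fixes h :: "real \<Rightarrow> 'a::real_normed_vector"
  assumes "\<And>t. (h has_vector_derivative vector_derivative h (at t)) (at t)" "\<And>t. h (t + T) = h t"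
  shows "vector_derivative h (at (t + T)) = vector_derivative h (at t)"
proof -
  have "((\<lambda>t. h (t + T)) has_vector_derivative vector_derivative h (at (t + T))) (at t)"
    by (rule has_vector_derivative_shift_time[OF assms(1)])
  then show ?thesis using vector_derivative_unique_at[OF _ assms(1)] by (simp add: assms(2))
qed

lemmas dz_per = vector_derivative_periodic[OF z_deriv z_per]
lemmas dPm_per = vector_derivative_periodic[OF Pm_deriv Pm_per]

lemma xs_cont: "continuous_on S xs"
  by (rule curve_continuous[OF xs_deriv])

lemma z_cont: "continuous_on S z"
  by (rule curve_continuous[OF z_deriv])

lemma Pm_cont: "continuous_on S Pm"
  by (rule curve_continuous[OF Pm_deriv])

lemma f_cont: "continuous_on S f"
  by (rule has_derivative_continuous_on[OF has_derivative_at_withinI[OF f_deriv]])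

lemma f_lipschitz: "lipschitz_on_balls f"
  by (rule C1_lipschitz_on_balls[OF f_deriv J_cont])

lemma fxs_cont: "continuous_on S (\<lambda>t. f (xs t))"
  by (rule continuous_on_compose2[OF f_cont[of UNIV] xs_cont]) auto

lemma Jxs_cont: "continuous_on S (\<lambda>t. jacobian f (xs t))"
  by (rule continuous_on_compose2[OF J_cont xs_cont]) auto

lemma zf_pos: "z t \<bullet> f (xs t) > 0"
  using transversal[of t] \<delta>_pos by linarith

lemma norm_transpose_Pm: "norm (transpose (Pm t) *v p) = norm p"
proof -
  have "(transpose (Pm t) *v p) \<bullet> (transpose (Pm t) *v p) = p \<bullet> p"
    using inner_transpose_matrix_mult[of p "transpose (Pm t)" "transpose (Pm t)" p]
    by (simp add: transpose_transpose matrix_vector_mul_assoc[symmetric] Pm_right)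
  then show ?thesis by (simp add: norm_eq_sqrt_inner)
qed

lemma z_transpose_Pm: "z t \<bullet> (transpose (Pm t) *v p) = 0"
  using inner_transpose_matrix_mult[of "z t" "Pm t" "mat 1" p] by (simp add: Pm_z)

lemma norm_Pm_le: "norm (Pm t *v v) \<le> norm v"
proof -
  have "(norm (Pm t *v v))\<^sup>2 = v \<bullet> (transpose (Pm t) *v (Pm t *v v))"
    using inner_transpose_matrix_mult[of v "Pm t" "Pm t" v]
    by (simp add: power2_norm_eq_inner matrix_vector_mul_assoc[symmetric])
  also have "\<dots> \<le> (norm v)\<^sup>2"
    by (simp add: Pm_left inner_diff_right power2_norm_eq_inner inner_commute)
  finally show ?thesis by (rule power2_le_imp_le) simp
qed

lemma Pm_on_hyperplane:
  assumes "z t \<bullet> u = 0"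
  shows "transpose (Pm t) *v (Pm t *v u) = u" "norm (Pm t *v u) = norm u"
proof -
  show *: "transpose (Pm t) *v (Pm t *v u) = u" by (simp add: Pm_left assms)
  show "norm (Pm t *v u) = norm u" using norm_transpose_Pm[of t "Pm t *v u"] by (simp add: *)
qed

text \<open>To first order in \<open>p\<close>, the time coordinate advances at the speed \<open>1 + rate t p\<close>.\<close>

definition rate :: "real \<Rightarrow> real^'m \<Rightarrow> real" where
  "rate t p = (z t \<bullet> (jacobian f (xs t) *v (transpose (Pm t) *v p)) + dz t \<bullet> (transpose (Pm t) *v p)) /
     (z t \<bullet> f (xs t))"

lemma transverse_linearization_apply:
  "A t *v p = dPm t *v (transpose (Pm t) *v p) +
     Pm t *v (jacobian f (xs t) *v (transpose (Pm t) *v p)) - rate t p *\<^sub>R (Pm t *v f (xs t))"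
proof -
  have outer: "(\<chi> i j. c $ i * r $ j) *v p = (r \<bullet> p) *\<^sub>R c" for c r p :: "real^'m"
    by (simp add: vec_eq_iff matrix_vector_mult_def inner_vec_def sum_distrib_right sum_distrib_left mult_ac)
  show ?thesis
    unfolding transverse_linearization_def Let_def matrix_vector_mult_diff_rdistrib
      matrix_vector_mult_add_rdistrib outer
    by (simp add: matrix_vector_mul_assoc rate_def inner_add_left dot_lmul_matrix matrix_mul_assoc
        divide_inverse mult.commute)
qed

lemma A_cont: "continuous_on UNIV A"
proof -
  have vm: "bounded_bilinear ((v*) :: real^'n \<Rightarrow> real^'m^'n \<Rightarrow> real^'m)"
    unfolding bilinear_conv_bounded_bilinear[symmetric] bilinear_def linear_iff
    by (simp add: vec_eq_iff vector_matrix_mult_def sum.distrib algebra_simps sum_distrib_left)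
  note transpose_cont = transpose_continuous[OF Pm_cont]
  define c where "c = (\<lambda>t. Pm t *v f (xs t))"
  define r where "r = (\<lambda>t. (1 / (z t \<bullet> f (xs t))) *\<^sub>R
     (z t v* (jacobian f (xs t) ** transpose (Pm t)) + dz t v* transpose (Pm t)))"
  have c: "continuous_on UNIV c"
    unfolding c_def by (rule matrix_vector_continuous[OF Pm_cont fxs_cont])
  have "continuous_on UNIV (\<lambda>t. z t v* (jacobian f (xs t) ** transpose (Pm t)))"
    by (rule bounded_bilinear.continuous_on[OF vm z_cont
          matrix_matrix_continuous[OF Jxs_cont transpose_cont]])
  moreover have "continuous_on UNIV (\<lambda>t. dz t v* transpose (Pm t))"
    by (rule bounded_bilinear.continuous_on[OF vm dz_cont transpose_cont])
  moreover have "continuous_on UNIV (\<lambda>t. 1 / (z t \<bullet> f (xs t)))"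
    using zf_pos by (intro continuous_on_divide continuous_on_const continuous_on_inner z_cont fxs_cont)
      (metis less_irrefl)
  ultimately have r: "continuous_on UNIV r"
    unfolding r_def by (intro continuous_on_scaleR continuous_on_add)
  have "continuous_on UNIV (\<lambda>t. \<chi> i j. c t $ i * r t $ j)"
    by (intro continuous_on_vec_lambda continuous_on_mult continuous_on_component c r)
  then show ?thesis
    unfolding transverse_linearization_def[abs_def] Let_def c_def r_def
    by (intro continuous_on_diff continuous_on_add dPm_cont Pm_cont transpose_cont
        matrix_matrix_continuous Jxs_cont)
qed

lemma A_per: "A (t + T) = A t"
  by (simp add: transverse_linearization_def Let_def xs_per z_per dz_per Pm_per dPm_per)

sublocale linearized: periodic_linear_system A T
  by unfold_locales (use A_cont A_per T_pos in auto)

lemma constants_exist: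
  "\<exists>M. M > 0 \<and> (\<forall>t. norm (f (xs t)) \<le> M)" "\<exists>B. B > 0 \<and> (\<forall>t. norm (dz t) \<le> B)"
  using periodic_continuous_bounded[OF fxs_cont _ T_pos] periodic_continuous_bounded[OF dz_cont dz_per T_pos]
  by (metis xs_per)+

definition "speed_max = (SOME M. M > 0 \<and> (\<forall>t. norm (f (xs t)) \<le> M))"
definition "turn_max = (SOME B. B > 0 \<and> (\<forall>t. norm (dz t) \<le> B))"
definition "tube_radius = \<delta> / (2 * turn_max)"

lemma speed_max: "speed_max > 0" "norm (f (xs t)) \<le> speed_max"
  using someI_ex[OF constants_exist(1)] by (auto simp: speed_max_def)

lemma turn_max: "turn_max > 0" "norm (dz t) \<le> turn_max"
  using someI_ex[OF constants_exist(2)] by (auto simp: turn_max_def)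

lemma tube_radius_pos: "tube_radius > 0"
  using \<delta>_pos turn_max(1) by (simp add: tube_radius_def)

lemma xs_lipschitz: "norm (xs s - xs t) \<le> speed_max * \<bar>s - t\<bar>"
proof -
  have "norm (xs s - xs t) \<le> speed_max * norm (s - t)"
  proof (rule differentiable_bound[where S = UNIV and f' = "\<lambda>t h. h *\<^sub>R f (xs t)"])
    show "(xs has_derivative (\<lambda>h. h *\<^sub>R f (xs t))) (at t within UNIV)" for t
      using xs_deriv[of t] by (simp add: has_vector_derivative_def)
    show "onorm (\<lambda>h. h *\<^sub>R f (xs t)) \<le> speed_max" for t
      using speed_max(2)[of t] by (intro onorm_le) (simp add: mult.commute mult_left_mono)
  qed auto
  then show ?thesis by simp
qed

lemma inner_dz_le:
  assumes "norm u \<le> tube_radius"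
  shows "dz t \<bullet> u \<le> \<delta> / 2" "\<bar>dz t \<bullet> u\<bar> \<le> \<delta> / 2"
proof -
  have "\<bar>dz t \<bullet> u\<bar> \<le> norm (dz t) * norm u" by (rule Cauchy_Schwarz_ineq2)
  also have "\<dots> \<le> turn_max * tube_radius"
    using turn_max assms by (intro mult_mono) auto
  finally show "\<bar>dz t \<bullet> u\<bar> \<le> \<delta> / 2" using turn_max(1) by (simp add: tube_radius_def)
  then show "dz t \<bullet> u \<le> \<delta> / 2" by linarith
qed

lemma section_deriv:
  "((\<lambda>t. z t \<bullet> (x - xs t)) has_real_derivative dz t \<bullet> (x - xs t) - z t \<bullet> f (xs t)) (at t)"
proof -
  have "((\<lambda>t. x - xs t) has_vector_derivative 0 - f (xs t)) (at t)"
    by (intro has_vector_derivative_diff has_vector_derivative_const xs_deriv)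
  from bounded_bilinear.has_vector_derivative[OF bounded_bilinear_inner z_deriv this]
  show ?thesis by (simp add: has_real_derivative_iff_has_vector_derivative)
qed

text \<open>The point \<open>x\<close> is crossed by the moving section at speed at least \<open>\<delta>\<close>, of which the turning of \<open>z\<close> can
  undo at most \<open>\<delta> / 2\<close> within the tube.\<close>

lemma section_decreasing:
  assumes "a \<le> b" and tube: "\<And>t. t \<in> {a..b} \<Longrightarrow> norm (x - xs t) \<le> tube_radius"
  shows "z b \<bullet> (x - xs b) \<le> z a \<bullet> (x - xs a) - \<delta> / 2 * (b - a)"
proof -
  define w where "w = (\<lambda>t. z t \<bullet> (x - xs t) + \<delta> / 2 * t)"
  have "w b \<le> w a"
  proof (rule DERIV_nonpos_imp_nonincreasing[where f = w and a = a and b = b, OF \<open>a \<le> b\<close>])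
    fix t assume t: "a \<le> t" "t \<le> b"
    have "(w has_real_derivative (dz t \<bullet> (x - xs t) - z t \<bullet> f (xs t)) + \<delta> / 2 * 1) (at t)"
      unfolding w_def by (intro DERIV_add section_deriv DERIV_cmult DERIV_ident)
    moreover have "(dz t \<bullet> (x - xs t) - z t \<bullet> f (xs t)) + \<delta> / 2 * 1 \<le> 0"
      using inner_dz_le(1)[OF tube[of t], of t] t transversal[of t] by simp
    ultimately show "\<exists>y. (w has_real_derivative y) (at t) \<and> y \<le> 0" by blast
  qed
  moreover have "\<delta> / 2 * (b - a) = \<delta> / 2 * b - \<delta> / 2 * a" by (simp only: right_diff_distrib)
  ultimately show ?thesis unfolding w_def by linarith
qed

text \<open>By uniqueness of solutions, a coincidence makes the time difference a period.\<close>

lemma xs_injective: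
  assumes "xs a = xs b" "a < b" "b - a < T"
  shows False
proof -
  have agree: "xs (a + h) = xs (b + h)" if "h \<ge> 0" for h
  proof (rule solutions_agree[OF f_lipschitz that, where x = "\<lambda>h. xs (a + h)" and y = "\<lambda>h. xs (b + h)"])
    have "((\<lambda>h. xs (c + h)) has_vector_derivative f (xs (c + h))) (at h)" for c h
      using has_vector_derivative_shift_time[of xs "f (xs (h + c))" h c] xs_deriv by (simp add: add.commute)
    then show "ode_solution (\<lambda>_. f) {0..h} (\<lambda>h. xs (a + h))" "ode_solution (\<lambda>_. f) {0..h} (\<lambda>h. xs (b + h))"
      unfolding ode_solution_def using has_vector_derivative_at_within by blast+
  qed (use assms in simp)
  have "xs (t + (b - a)) = xs t" for t
  proof -
    obtain k :: int where k: "(t - a) + of_int k * T \<in> {0..<T}" using reduce_to_period[OF T_pos] by blast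
    define h where "h = (t - a) + of_int k * T"
    have "xs (t + of_int k * T) = xs (t + of_int k * T + (b - a))"
      using agree[of h] k by (simp add: h_def algebra_simps)
    then show ?thesis
      using periodic_int_shift[of xs, OF xs_per, of t k] periodic_int_shift[of xs, OF xs_per, of "t + (b - a)" k]
      by (simp add: algebra_simps)
  qed
  with xs_min[of "b - a"] assms show False by auto
qed

text \<open>On the compact set of pairs of times in \<open>{0..T}\<close> that differ by at least \<open>\<sigma>\<close> modulo \<open>T\<close> the
  distance of the orbit points has a positive minimum.\<close>

lemma close_points_have_close_times:
  assumes "\<sigma> > 0"
  obtains r where "r > 0" "\<And>s t. norm (xs s - xs t) < r \<Longrightarrow> \<exists>k::int. \<bar>s - (t + of_int k * T)\<bar> < \<sigma>"
proof -
  define C where "C = ({0..T} \<times> {0..T}) \<inter> {p. \<sigma> \<le> \<bar>fst p - snd p\<bar>}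
    \<inter> {p. \<sigma> \<le> \<bar>fst p - snd p - T\<bar>} \<inter> {p. \<sigma> \<le> \<bar>fst p - snd p + T\<bar>}"
  have "compact C"
    unfolding C_def by (intro compact_Int_closed compact_Times closed_Collect_le continuous_intros) auto
  have distinct: "xs s \<noteq> xs t" if "(s, t) \<in> C" for s t
  proof
    assume eq: "xs s = xs t"
    have st: "s \<in> {0..T}" "t \<in> {0..T}" "\<sigma> \<le> \<bar>s - t\<bar>" "\<sigma> \<le> \<bar>s - t - T\<bar>" "\<sigma> \<le> \<bar>s - t + T\<bar>"
      using that by (auto simp: C_def)
    moreover have "t - s < T" if "s < t" using st assms that by auto
    moreover have "s - t < T" if "t < s" using st assms that by auto
    moreover have "s \<noteq> t" using st assms by auto
    ultimately consider "s < t" "t - s < T" | "t < s" "s - t < T" by fastforce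
    then show False using xs_injective[OF eq] xs_injective[OF eq[symmetric]] by cases auto
  qed
  obtain r where r: "r > 0" "\<And>s t. (s, t) \<in> C \<Longrightarrow> r \<le> norm (xs s - xs t)"
  proof (cases "C = {}")
    case True then show thesis by (intro that[of 1]) auto
  next
    case False
    have "continuous_on C (\<lambda>p. norm (xs (fst p) - xs (snd p)))"
      by (intro continuous_on_norm continuous_on_diff continuous_on_compose2[OF xs_cont[of UNIV]]
          continuous_on_fst continuous_on_snd continuous_on_id) auto
    from continuous_attains_inf[OF \<open>compact C\<close> False this] obtain p where
      p: "p \<in> C" "\<And>q. q \<in> C \<Longrightarrow> norm (xs (fst p) - xs (snd p)) \<le> norm (xs (fst q) - xs (snd q))" by blast
    show thesis
      using distinct[of "fst p" "snd p"] p by (intro that[of "norm (xs (fst p) - xs (snd p))"]) force+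
  qed
  show thesis
  proof (rule that[OF r(1)])
    fix s t assume close: "norm (xs s - xs t) < r"
    obtain j k :: int where jk: "s + of_int j * T \<in> {0..<T}" "t + of_int k * T \<in> {0..<T}"
      using reduce_to_period[OF T_pos] by metis
    have "(s + of_int j * T, t + of_int k * T) \<notin> C"
      using r(2) close periodic_int_shift[of xs, OF xs_per] by (metis not_le)
    then consider "\<bar>s + of_int j * T - (t + of_int k * T)\<bar> < \<sigma>"
      | "\<bar>s + of_int j * T - (t + of_int k * T) - T\<bar> < \<sigma>"
      | "\<bar>s + of_int j * T - (t + of_int k * T) + T\<bar> < \<sigma>"
      using jk by (force simp: C_def)
    then show "\<exists>k::int. \<bar>s - (t + of_int k * T)\<bar> < \<sigma>"
    proof cases
      case 1 then show ?thesis by (intro exI[of _ "k - j"]) (simp add: algebra_simps)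
    next
      case 2 then show ?thesis by (intro exI[of _ "k - j + 1"]) (simp add: algebra_simps)
    next
      case 3 then show ?thesis by (intro exI[of _ "k - j - 1"]) (simp add: algebra_simps)
    qed
  qed
qed

lemma orbit_eq: "\<Gamma> = range xs"
proof -
  have "xs t \<in> \<Gamma>" for t
  proof -
    obtain k :: int where "t + of_int k * T \<in> {0..<T}" using reduce_to_period[OF T_pos] by blast
    then show ?thesis unfolding orbit_def using periodic_int_shift[of xs, OF xs_per, of t k] by (metis imageI)
  qed
  then show ?thesis by (auto simp: orbit_def)
qed

lemma orbit_compact: "compact \<Gamma>" "\<Gamma> \<noteq> {}"
proof -
  have "\<Gamma> \<subseteq> xs ` {0..T}" by (auto simp: orbit_def)
  moreover have "xs ` {0..T} \<subseteq> \<Gamma>" by (auto simp: orbit_eq)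
  ultimately have "\<Gamma> = xs ` {0..T}" by blast
  then show "compact \<Gamma>" by (simp add: compact_continuous_image xs_cont)
qed (simp add: orbit_eq)

lemma nearest_orbit_point:
  obtains s where "infdist x \<Gamma> = norm (x - xs s)"
  using infdist_attains_inf[OF compact_imp_closed[OF orbit_compact(1)] orbit_compact(2), of x]
  unfolding orbit_eq dist_norm by blast

lemma infdist_orbit_le: "infdist x \<Gamma> \<le> norm (x - xs s)"
  using infdist_le[of "xs s" \<Gamma> x] by (simp add: orbit_eq dist_norm)

subsection \<open>Sections transversal to the orbit\<close>

text \<open>Lipschitz dependence of the time coordinate on the point, modulo the period. The case \<open>x = y\<close>
  is its uniqueness. Since sections far apart in time meet the tube at distant points, both times may be
  taken in an interval on which the section function of \<open>x\<close> is strictly decreasing.\<close>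

lemma times_on_sections_close:
  obtains r where "0 < r" "r \<le> tube_radius"
    "\<And>x y s t. z s \<bullet> (x - xs s) = 0 \<Longrightarrow> z t \<bullet> (y - xs t) = 0 \<Longrightarrow>
       norm (x - xs s) < r \<Longrightarrow> norm (y - xs t) < r \<Longrightarrow> norm (x - y) < r \<Longrightarrow>
       \<exists>k::int. \<bar>s - (t + of_int k * T)\<bar> \<le> 2 / \<delta> * norm (x - y)"
proof -
  define \<sigma> where "\<sigma> = tube_radius / (2 * speed_max)"
  have \<sigma>: "\<sigma> > 0" "speed_max * \<sigma> = tube_radius / 2"
    using tube_radius_pos speed_max(1) by (auto simp: \<sigma>_def)
  obtain r0 where r0: "r0 > 0" "\<And>s t. norm (xs s - xs t) < r0 \<Longrightarrow> \<exists>k::int. \<bar>s - (t + of_int k * T)\<bar> < \<sigma>"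
    using close_points_have_close_times[OF \<sigma>(1)] by blast
  define r where "r = min (r0 / 3) (tube_radius / 2)"
  have r: "0 < r" "3 * r \<le> r0" "r \<le> tube_radius / 2"
    using r0(1) tube_radius_pos by (auto simp: r_def)
  show thesis
  proof (rule that)
    fix x y s t
    assume sec: "z s \<bullet> (x - xs s) = 0" "z t \<bullet> (y - xs t) = 0"
      and near: "norm (x - xs s) < r" "norm (y - xs t) < r" "norm (x - y) < r"
    have "norm (xs s - xs t) \<le> norm (x - xs s) + norm (x - y) + norm (y - xs t)"
      using norm_triangle_ineq4[of "x - xs t" "x - xs s"] norm_triangle_ineq[of "x - y" "y - xs t"] by simp
    then obtain k :: int where k: "\<bar>s - (t + of_int k * T)\<bar> < \<sigma>"
      using r0(2)[of s t] near r by auto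
    define t' where "t' = t + of_int k * T"
    have t': "xs t' = xs t" "z t' = z t"
      unfolding t'_def by (rule periodic_int_shift[of xs, OF xs_per] periodic_int_shift[of z, OF z_per])+
    have tube: "norm (x - xs \<tau>) \<le> tube_radius" if "\<bar>\<tau> - s\<bar> \<le> \<sigma>" for \<tau>
    proof -
      have "norm (x - xs \<tau>) \<le> norm (x - xs s) + norm (xs \<tau> - xs s)"
        using norm_triangle_ineq4[of "x - xs s" "xs \<tau> - xs s"] by simp
      also have "norm (xs \<tau> - xs s) \<le> speed_max * \<sigma>"
        using xs_lipschitz[of \<tau> s] mult_left_mono[OF that, of speed_max] speed_max(1) by linarith
      finally show ?thesis using near(1) r(3) \<sigma>(2) by linarith
    qed
    have "z t' \<bullet> (x - xs t') = z t \<bullet> (x - y)"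
      using sec(2) by (simp add: t' inner_diff_right)
    moreover have "\<bar>z t \<bullet> (x - y)\<bar> \<le> norm (x - y)"
      using Cauchy_Schwarz_ineq2[of "z t" "x - y"] by (simp add: z_norm)
    ultimately have small: "\<bar>z t' \<bullet> (x - xs t')\<bar> \<le> norm (x - y)" by simp
    have "\<delta> / 2 * \<bar>s - t'\<bar> \<le> norm (x - y)"
    proof (cases "s \<le> t'")
      case True
      have "z t' \<bullet> (x - xs t') \<le> z s \<bullet> (x - xs s) - \<delta> / 2 * (t' - s)"
        using k by (intro section_decreasing[OF True] tube) (auto simp: t'_def)
      then show ?thesis using True sec(1) small by (simp add: abs_if split: if_splits)
    next
      case False
      have "z s \<bullet> (x - xs s) \<le> z t' \<bullet> (x - xs t') - \<delta> / 2 * (s - t')"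
        using k False by (intro section_decreasing tube) (auto simp: t'_def)
      then show ?thesis using False sec(1) small by (simp add: abs_if split: if_splits)
    qed
    then have "\<bar>s - t'\<bar> \<le> 2 / \<delta> * norm (x - y)" using \<delta>_pos by (simp add: field_simps)
    then show "\<exists>k::int. \<bar>s - (t + of_int k * T)\<bar> \<le> 2 / \<delta> * norm (x - y)"
      unfolding t'_def by blast
  qed (use r in auto)
qed

text \<open>At the time \<open>s\<close> the section function of \<open>x\<close> is at most \<open>d\<close> in absolute value, and it falls at a rate of
  at least \<open>\<delta> / 2\<close>; so it has a zero within time \<open>2 d / \<delta>\<close>.\<close>

lemma section_time_exists:
  assumes d: "norm (x - xs s) = d" and small: "(1 + 2 * speed_max / \<delta>) * d \<le> tube_radius"
  obtains \<tau> where "\<tau> \<in> {0..<T}" "z \<tau> \<bullet> (x - xs \<tau>) = 0" "norm (x - xs \<tau>) \<le> (1 + 2 * speed_max / \<delta>) * d"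
proof -
  define h where "h = 2 * d / \<delta>"
  have h: "h \<ge> 0" "\<delta> / 2 * h = d" "speed_max * h = 2 * speed_max / \<delta> * d"
    using d \<delta>_pos by (auto simp: h_def)
  have near: "norm (x - xs t) \<le> (1 + 2 * speed_max / \<delta>) * d" if "\<bar>t - s\<bar> \<le> h" for t
  proof -
    have "norm (x - xs t) \<le> norm (x - xs s) + norm (xs t - xs s)"
      using norm_triangle_ineq4[of "x - xs s" "xs t - xs s"] by simp
    also have "norm (xs t - xs s) \<le> speed_max * h"
      using xs_lipschitz[of t s] mult_left_mono[OF that, of speed_max] speed_max(1) by linarith
    finally show ?thesis using d h(3) by (simp add: algebra_simps)
  qed
  have at_s: "\<bar>z s \<bullet> (x - xs s)\<bar> \<le> d"
    using Cauchy_Schwarz_ineq2[of "z s" "x - xs s"] by (simp add: z_norm d)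
  have "z (s + h) \<bullet> (x - xs (s + h)) \<le> z s \<bullet> (x - xs s) - \<delta> / 2 * (s + h - s)"
    using h(1) by (intro section_decreasing order_trans[OF near small]) auto
  then have right: "z (s + h) \<bullet> (x - xs (s + h)) \<le> 0" using at_s h(2) by simp
  have "z s \<bullet> (x - xs s) \<le> z (s - h) \<bullet> (x - xs (s - h)) - \<delta> / 2 * (s - (s - h))"
    using h(1) by (intro section_decreasing order_trans[OF near small]) auto
  then have left: "0 \<le> z (s - h) \<bullet> (x - xs (s - h))" using at_s h(2) by simp
  have "continuous_on {s - h..s + h} (\<lambda>t. z t \<bullet> (x - xs t))"
    by (intro continuous_on_inner continuous_on_diff continuous_on_const z_cont xs_cont)
  from IVT2'[of "\<lambda>t. z t \<bullet> (x - xs t)" "s + h" 0 "s - h", OF right left _ this] h(1)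
  obtain t where t: "s - h \<le> t" "t \<le> s + h" "z t \<bullet> (x - xs t) = 0" by auto
  obtain k :: int where k: "t + of_int k * T \<in> {0..<T}" using reduce_to_period[OF T_pos] by blast
  have "xs (t + of_int k * T) = xs t" "z (t + of_int k * T) = z t"
    by (rule periodic_int_shift[of xs, OF xs_per] periodic_int_shift[of z, OF z_per])+
  with k t near[of t] show thesis by (intro that[of "t + of_int k * T"]) auto
qed

text \<open>Implicit differentiation in one unknown. In the form of Caratheodory, the section function of
  \<open>\<phi> 0\<close> is \<open>h s (s - q 0)\<close> with \<open>h\<close> continuous at \<open>q 0\<close>; this solves for the difference quotient of \<open>q\<close>,
  and continuity of \<open>q\<close> yields the limit.\<close>

lemma section_time_deriv:
  assumes \<phi>: "(\<phi> has_vector_derivative v) (at 0)" and q: "isCont q 0"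
    and sec: "\<forall>\<^sub>F t in nhds 0. z (q t) \<bullet> (\<phi> t - xs (q t)) = 0"
    and slope: "dz (q 0) \<bullet> (\<phi> 0 - xs (q 0)) - z (q 0) \<bullet> f (xs (q 0)) \<noteq> 0" (is "?\<gamma> \<noteq> 0")
  shows "(q has_real_derivative (z (q 0) \<bullet> v) / (z (q 0) \<bullet> f (xs (q 0)) - dz (q 0) \<bullet> (\<phi> 0 - xs (q 0)))) (at 0)"
proof -
  have at_0: "z (q 0) \<bullet> (\<phi> 0 - xs (q 0)) = 0"
    using eventually_nhds_x_imp_x[OF sec] .
  obtain h where h: "\<And>s. z s \<bullet> (\<phi> 0 - xs s) - z (q 0) \<bullet> (\<phi> 0 - xs (q 0)) = h s * (s - q 0)"
    "isCont h (q 0)" "h (q 0) = ?\<gamma>"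
    using section_deriv[of "\<phi> 0" "q 0"] unfolding CARAT_DERIV by blast
  have hq: "((\<lambda>t. h (q t)) \<longlongrightarrow> ?\<gamma>) (at 0)"
    using isCont_o2[OF q h(2)] h(3) by (simp add: isCont_def)
  have "((\<lambda>t. (\<phi> t - \<phi> 0) /\<^sub>R t) \<longlongrightarrow> v) (at 0)"
  proof -
    have "((\<lambda>t. norm (\<phi> t - \<phi> 0 - t *\<^sub>R v) / \<bar>t\<bar>) \<longlongrightarrow> 0) (at 0)"
    proof -
      have "((\<lambda>t. (\<phi> t - \<phi> 0 - t *\<^sub>R v) /\<^sub>R \<bar>t\<bar>) \<longlongrightarrow> 0) (at 0)"
        using \<phi> unfolding has_vector_derivative_def has_derivative_at_within by simp
      from tendsto_norm_zero[OF this] show ?thesis by (simp add: divide_inverse mult.commute)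
    qed
    moreover have "\<forall>\<^sub>F t in at 0. norm (\<phi> t - \<phi> 0 - t *\<^sub>R v) / \<bar>t\<bar> = norm ((\<phi> t - \<phi> 0) /\<^sub>R t - v)"
    proof (rule eventually_mono[OF eventually_neq_at_within[of 0]])
      fix t :: real assume "t \<noteq> 0"
      then have "(\<phi> t - \<phi> 0) /\<^sub>R t - v = (\<phi> t - \<phi> 0 - t *\<^sub>R v) /\<^sub>R t"
        by (simp add: scaleR_diff_right)
      then show "norm (\<phi> t - \<phi> 0 - t *\<^sub>R v) / \<bar>t\<bar> = norm ((\<phi> t - \<phi> 0) /\<^sub>R t - v)"
        by (simp add: divide_inverse mult.commute)
    qed
    ultimately have "((\<lambda>t. norm ((\<phi> t - \<phi> 0) /\<^sub>R t - v)) \<longlongrightarrow> 0) (at 0)"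
      by (rule Lim_transform_eventually)
    then show ?thesis using LIM_zero_iff tendsto_norm_zero_iff by blast
  qed
  moreover have "((\<lambda>t. z (q t)) \<longlongrightarrow> z (q 0)) (at 0)"
    using isCont_o2[OF q, of z] z_cont[of UNIV] by (simp add: continuous_on_eq_continuous_at isCont_def)
  ultimately have "((\<lambda>t. - (z (q t) \<bullet> ((\<phi> t - \<phi> 0) /\<^sub>R t)) / h (q t)) \<longlongrightarrow> - (z (q 0) \<bullet> v) / ?\<gamma>) (at 0)"
    by (intro tendsto_divide tendsto_minus tendsto_inner hq slope)
  moreover have "\<forall>\<^sub>F t in at 0. - (z (q t) \<bullet> ((\<phi> t - \<phi> 0) /\<^sub>R t)) / h (q t) = (q t - q 0) / t"
  proof -
    have "\<forall>\<^sub>F t in at 0. h (q t) \<noteq> 0" by (rule tendsto_imp_eventually_ne[OF hq slope])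
    moreover have "\<forall>\<^sub>F t in at 0. z (q t) \<bullet> (\<phi> t - xs (q t)) = 0"
      using sec by (simp add: eventually_nhds_conv_at)
    ultimately show ?thesis using eventually_neq_at_within[of 0]
    proof eventually_elim
      case (elim t)
      have "h (q t) * (q t - q 0) = - (z (q t) \<bullet> (\<phi> t - \<phi> 0))"
        using h(1)[of "q t"] at_0 elim(2) by (simp add: inner_diff_right)
      moreover have "z (q t) \<bullet> ((\<phi> t - \<phi> 0) /\<^sub>R t) = (z (q t) \<bullet> (\<phi> t - \<phi> 0)) / t"
        by (simp add: divide_inverse mult.commute)
      ultimately have "- (z (q t) \<bullet> ((\<phi> t - \<phi> 0) /\<^sub>R t)) = h (q t) * ((q t - q 0) / t)" by simp
      then show ?case using elim(1) by simp
    qed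
  qed
  ultimately have "((\<lambda>t. (q t - q 0) / t) \<longlongrightarrow> - (z (q 0) \<bullet> v) / ?\<gamma>) (at 0)"
    by (rule Lim_transform_eventually)
  then have "(q has_real_derivative - (z (q 0) \<bullet> v) / ?\<gamma>) (at 0)"
    by (simp add: has_field_derivative_iff)
  moreover have "- (z (q 0) \<bullet> v) / ?\<gamma> =
      (z (q 0) \<bullet> v) / (z (q 0) \<bullet> f (xs (q 0)) - dz (q 0) \<bullet> (\<phi> 0 - xs (q 0)))"
    by (metis minus_diff_eq minus_divide_divide minus_minus)
  ultimately show ?thesis by simp
qed

subsection \<open>The flow in transverse coordinates\<close>

text \<open>The derivative of the time coordinate along the flow: differentiate
  \<open>z \<tau> \<bullet> (x - xs \<tau>) = 0\<close> in time and solve for \<open>\<tau>'\<close>.\<close>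

definition clock_rate :: "real \<Rightarrow> real^'n \<Rightarrow> real" where
  "clock_rate \<tau> x = (z \<tau> \<bullet> f x) / (z \<tau> \<bullet> f (xs \<tau>) - dz \<tau> \<bullet> (x - xs \<tau>))"

text \<open>The derivative of \<open>Pm \<tau> (x - xs \<tau>)\<close> along the flow.\<close>

definition transverse_velocity :: "real \<Rightarrow> real^'n \<Rightarrow> real^'m" where
  "transverse_velocity \<tau> x = clock_rate \<tau> x *\<^sub>R (dPm \<tau> *v (x - xs \<tau>)) + Pm \<tau> *v (f x - clock_rate \<tau> x *\<^sub>R f (xs \<tau>))"

text \<open>With \<open>u = x - xs \<tau>\<close> and \<open>w\<close> the Taylor remainder of \<open>f\<close> at \<open>xs \<tau>\<close>, the deviation of the clock rate from 1
  is \<open>O(|u|)\<close>, and from \<open>1 + rate \<tau> p\<close> it is \<open>O(|w| + |u|\<^sup>2)\<close>. Inserting both in the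
  transverse velocity leaves \<open>A \<tau> p\<close> and terms of order \<open>|w| + |u|\<^sup>2\<close>. Periodicity makes all
  constants independent of \<open>\<tau>\<close>.\<close>

lemma transverse_dynamics_linearize:
  assumes "\<epsilon> > 0"
  obtains d where "d > 0" "\<And>x \<tau>. z \<tau> \<bullet> (x - xs \<tau>) = 0 \<Longrightarrow> norm (x - xs \<tau>) \<le> d \<Longrightarrow>
     \<bar>clock_rate \<tau> x - 1\<bar> \<le> \<epsilon> \<and>
     norm (transverse_velocity \<tau> x - A \<tau> *v (Pm \<tau> *v (x - xs \<tau>))) \<le> \<epsilon> * norm (x - xs \<tau>)"
proof -
  obtain R where R: "R > 0" "\<And>t. norm (xs t) \<le> R"
    using periodic_continuous_bounded[OF xs_cont xs_per T_pos] by blast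
  obtain BJ where BJ: "BJ > 0" "\<And>t v. norm (jacobian f (xs t) *v v) \<le> BJ * norm v"
    using periodic_matrix_bounded[OF Jxs_cont _ T_pos] xs_per by metis
  obtain BP where BP: "BP > 0" "\<And>t v. norm (dPm t *v v) \<le> BP * norm v"
    using periodic_matrix_bounded[OF dPm_cont dPm_per T_pos] by metis
  define B where "B = turn_max"
  define M where "M = speed_max"
  have B: "B > 0" "\<And>t. norm (dz t) \<le> B" and M: "M > 0" "\<And>t. norm (f (xs t)) \<le> M"
    unfolding B_def M_def using turn_max speed_max by auto
  define C1 where "C1 = 2 / \<delta> * (BJ + B + 1)"
  have C1: "C1 > 0" using BJ B \<delta>_pos by (simp add: C1_def)
  define C2 where "C2 = C1 * BP + M * C1 * B / \<delta>"
  define C3 where "C3 = 1 + M / \<delta>"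
  have C: "C2 > 0" "C3 > 0" using C1 BP M B \<delta>_pos by (auto simp: C2_def C3_def add_pos_pos)
  define e where "e = min 1 (\<epsilon> / (2 * C3))"
  have e: "e > 0" "e \<le> 1" "C3 * e \<le> \<epsilon> / 2"
  proof -
    show "e > 0" "e \<le> 1" using assms C by (auto simp: e_def)
    have "C3 * e \<le> C3 * (\<epsilon> / (2 * C3))" using C by (intro mult_left_mono) (auto simp: e_def)
    also have "\<dots> = \<epsilon> / 2" using C by simp
    finally show "C3 * e \<le> \<epsilon> / 2" .
  qed
  obtain d0 where d0: "d0 > 0" "\<And>a h. a \<in> cball 0 R \<Longrightarrow> norm h \<le> d0 \<Longrightarrow>
      norm (f (a + h) - f a - jacobian f a *v h) \<le> e * norm h"
    using uniform_linearization[OF f_deriv J_cont e(1)] by blast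
  define d where "d = min (min d0 tube_radius) (min (\<epsilon> / C1) (\<epsilon> / (2 * C2)))"
  have d: "d > 0" "d \<le> d0" "d \<le> tube_radius" "d \<le> \<epsilon> / C1" "d \<le> \<epsilon> / (2 * C2)"
    using d0 tube_radius_pos assms C1 C by (auto simp: d_def)
  have d': "C1 * d \<le> \<epsilon>" "C2 * d \<le> \<epsilon> / 2"
    using mult_left_mono[OF d(4), of C1] mult_left_mono[OF d(5), of C2] C C1 by simp_all
  show thesis
  proof (rule that[OF d(1)])
    fix x \<tau> assume sec: "z \<tau> \<bullet> (x - xs \<tau>) = 0" and small: "norm (x - xs \<tau>) \<le> d"
    define u where "u = x - xs \<tau>"
    define p where "p = Pm \<tau> *v u"
    define s where "s = clock_rate \<tau> x"
    define w where "w = f x - f (xs \<tau>) - jacobian f (xs \<tau>) *v u"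
    define zf where "zf = z \<tau> \<bullet> f (xs \<tau>)"
    have u: "norm u \<le> d" "z \<tau> \<bullet> u = 0" "transpose (Pm \<tau>) *v p = u"
      using small sec Pm_on_hyperplane(1)[of \<tau> u] by (auto simp: u_def p_def)
    have w: "norm w \<le> e * norm u"
      using d0(2)[of "xs \<tau>" u] R(2)[of \<tau>] u(1) d(2) by (simp add: w_def u_def)
    have zf: "zf > \<delta>" unfolding zf_def by (rule transversal)
    have den: "zf - dz \<tau> \<bullet> u \<ge> \<delta> / 2"
      using inner_dz_le(1)[of u \<tau>] u(1) d(3) zf by linarith
    have fx: "f x = f (xs \<tau>) + jacobian f (xs \<tau>) *v u + w" by (simp add: w_def)
    have s_eq: "(s - 1) * (zf - dz \<tau> \<bullet> u) = z \<tau> \<bullet> (jacobian f (xs \<tau>) *v u) + dz \<tau> \<bullet> u + z \<tau> \<bullet> w"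
    proof -
      have "s * (zf - dz \<tau> \<bullet> u) = z \<tau> \<bullet> f x"
        using den \<delta>_pos unfolding s_def clock_rate_def zf_def u_def by simp
      then show ?thesis by (simp add: fx inner_add_right zf_def algebra_simps)
    qed
    have z_inner: "\<bar>z \<tau> \<bullet> v\<bar> \<le> norm v" for v
      using Cauchy_Schwarz_ineq2[of "z \<tau>" v] by (simp add: z_norm)
    have dz_inner: "\<bar>dz \<tau> \<bullet> u\<bar> \<le> B * norm u"
      using Cauchy_Schwarz_ineq2[of "dz \<tau>" u] mult_right_mono[OF B(2)[of \<tau>], of "norm u"] by simp
    have s1: "\<bar>s - 1\<bar> \<le> C1 * norm u"
    proof -
      have "\<bar>s - 1\<bar> * (\<delta> / 2) \<le> \<bar>s - 1\<bar> * (zf - dz \<tau> \<bullet> u)"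
        using den by (intro mult_left_mono) auto
      also have "\<dots> = \<bar>z \<tau> \<bullet> (jacobian f (xs \<tau>) *v u) + dz \<tau> \<bullet> u + z \<tau> \<bullet> w\<bar>"
        using den \<delta>_pos by (simp add: s_eq[symmetric] abs_mult)
      also have "\<dots> \<le> BJ * norm u + B * norm u + 1 * norm u"
        using z_inner[of "jacobian f (xs \<tau>) *v u"] BJ(2)[of \<tau> u] dz_inner z_inner[of w] w
          mult_right_mono[OF e(2) norm_ge_zero[of u]] by linarith
      finally have "\<bar>s - 1\<bar> * (\<delta> / 2) \<le> (BJ + B + 1) * norm u" by (simp add: algebra_simps)
      then show ?thesis using \<delta>_pos by (simp add: C1_def field_simps)
    qed
    define e1 where "e1 = s - 1 - rate \<tau> p"
    have e1_eq: "e1 * zf = z \<tau> \<bullet> w + (s - 1) * (dz \<tau> \<bullet> u)"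
    proof -
      have "rate \<tau> p * zf = z \<tau> \<bullet> (jacobian f (xs \<tau>) *v u) + dz \<tau> \<bullet> u"
        using zf \<delta>_pos by (simp add: rate_def u(3) zf_def)
      with s_eq show ?thesis by (simp add: e1_def algebra_simps)
    qed
    have e1: "\<bar>e1\<bar> \<le> (e * norm u + C1 * B * (norm u)\<^sup>2) / \<delta>"
    proof -
      have "\<bar>e1\<bar> * \<delta> \<le> \<bar>e1 * zf\<bar>" using zf \<delta>_pos by (simp add: abs_mult mult_left_mono)
      also have "\<dots> \<le> e * norm u + (C1 * norm u) * (B * norm u)"
      proof -
        have "\<bar>(s - 1) * (dz \<tau> \<bullet> u)\<bar> \<le> (C1 * norm u) * (B * norm u)"
          unfolding abs_mult using C1 by (intro mult_mono s1 dz_inner) auto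
        then show ?thesis unfolding e1_eq using z_inner[of w] w by linarith
      qed
      finally show ?thesis using \<delta>_pos by (simp add: field_simps power2_eq_square)
    qed
    have "transverse_velocity \<tau> x - A \<tau> *v p =
        (s - 1) *\<^sub>R (dPm \<tau> *v u) + Pm \<tau> *v w - e1 *\<^sub>R (Pm \<tau> *v f (xs \<tau>))"
      unfolding transverse_velocity_def s_def[symmetric] u_def[symmetric] transverse_linearization_apply u(3)
      by (simp add: fx e1_def matrix_vector_mult_diff_distrib matrix_vector_right_distrib
          matrix_vector_mult_scaleR algebra_simps)
    also have "norm \<dots> \<le> \<bar>s - 1\<bar> * norm (dPm \<tau> *v u) + norm (Pm \<tau> *v w) + \<bar>e1\<bar> * norm (Pm \<tau> *v f (xs \<tau>))"
      using norm_triangle_ineq4[of "(s - 1) *\<^sub>R (dPm \<tau> *v u) + Pm \<tau> *v w" "e1 *\<^sub>R (Pm \<tau> *v f (xs \<tau>))"]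
        norm_triangle_ineq[of "(s - 1) *\<^sub>R (dPm \<tau> *v u)" "Pm \<tau> *v w"] by simp
    also have "\<dots> \<le> (C1 * norm u) * (BP * norm u) + e * norm u + (e * norm u + C1 * B * (norm u)\<^sup>2) / \<delta> * M"
    proof (intro add_mono mult_mono)
      show "norm (Pm \<tau> *v w) \<le> e * norm u" using norm_Pm_le[of \<tau> w] w by linarith
      show "norm (Pm \<tau> *v f (xs \<tau>)) \<le> M" using norm_Pm_le[of \<tau> "f (xs \<tau>)"] M(2)[of \<tau>] by linarith
    qed (use s1 e1 BP C1 B e \<delta>_pos in auto)
    also have "\<dots> = (C3 * e + C2 * norm u) * norm u"
      using \<delta>_pos by (simp add: C2_def C3_def field_simps power2_eq_square)
    also have "\<dots> \<le> (\<epsilon> / 2 + \<epsilon> / 2) * norm u"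
    proof (rule mult_right_mono)
      have "C2 * norm u \<le> C2 * d" using u(1) C by (intro mult_left_mono) auto
      then show "C3 * e + C2 * norm u \<le> \<epsilon> / 2 + \<epsilon> / 2" using e(3) d'(2) by linarith
    qed simp
    finally have "norm (transverse_velocity \<tau> x - A \<tau> *v p) \<le> \<epsilon> * norm u" by simp
    moreover have "\<bar>s - 1\<bar> \<le> \<epsilon>" using s1 d'(1) mult_left_mono[OF u(1), of C1] C1 by linarith
    ultimately show "\<bar>clock_rate \<tau> x - 1\<bar> \<le> \<epsilon> \<and>
       norm (transverse_velocity \<tau> x - A \<tau> *v (Pm \<tau> *v (x - xs \<tau>))) \<le> \<epsilon> * norm (x - xs \<tau>)"
      by (simp add: s_def p_def u_def)
  qed
qed

subsection \<open>The quadratic form in transverse coordinates\<close>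

text \<open>Transverse coordinates in which the norm of \<open>xp x\<close> is comparable to the distance from the orbit and
  \<open>tau\<close> is locally Lipschitz modulo \<open>T\<close>.\<close>

definition regular_coordinates ::
  "(real^'n) set \<Rightarrow> real \<Rightarrow> (real^'n \<Rightarrow> real^'m) \<Rightarrow> (real^'n \<Rightarrow> real) \<Rightarrow> real \<Rightarrow> bool" where
  "regular_coordinates U r xp tau C \<longleftrightarrow> transverse_coordinates T xs z Pm U r xp tau \<and> C > 0 \<and>
     (\<forall>x\<in>U. norm (x - xs (tau x)) \<le> C * infdist x \<Gamma> \<and> norm (x - xs (tau x)) \<le> tube_radius) \<and>
     (\<forall>x\<in>U. \<forall>y\<in>U. norm (x - y) < r \<longrightarrow>
       (\<exists>k::int. \<bar>tau x - (tau y + of_int k * T)\<bar> \<le> 2 / \<delta> * norm (x - y)))"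

lemma regular_coordinates_exist:
  obtains U r xp tau C where "regular_coordinates U r xp tau C"
proof -
  obtain r where r: "0 < r" "r \<le> tube_radius" and
    close: "\<And>x y s t. z s \<bullet> (x - xs s) = 0 \<Longrightarrow> z t \<bullet> (y - xs t) = 0 \<Longrightarrow>
       norm (x - xs s) < r \<Longrightarrow> norm (y - xs t) < r \<Longrightarrow> norm (x - y) < r \<Longrightarrow>
       \<exists>k::int. \<bar>s - (t + of_int k * T)\<bar> \<le> 2 / \<delta> * norm (x - y)"
    using times_on_sections_close by blast
  define C where "C = 1 + 2 * speed_max / \<delta>"
  have C: "C > 0" using speed_max(1) \<delta>_pos by (simp add: C_def add_pos_pos)
  define U where "U = {x. infdist x \<Gamma> < r / C}"
  define good where "good = (\<lambda>x \<tau>. \<tau> \<in> {0..<T} \<and> z \<tau> \<bullet> (x - xs \<tau>) = 0 \<and> norm (x - xs \<tau>) \<le> C * infdist x \<Gamma>)"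
  define tau where "tau = (\<lambda>x. SOME \<tau>. good x \<tau>)"
  define xp where "xp = (\<lambda>x. Pm (tau x) *v (x - xs (tau x)))"
  have CU: "C * infdist x \<Gamma> < r" if "x \<in> U" for x
    using that C by (simp add: U_def field_simps)
  have tau: "good x (tau x)" if "x \<in> U" for x
  proof -
    obtain s where s: "infdist x \<Gamma> = norm (x - xs s)" by (rule nearest_orbit_point)
    have "(1 + 2 * speed_max / \<delta>) * infdist x \<Gamma> \<le> tube_radius"
      using CU[OF that] r(2) unfolding C_def by linarith
    from section_time_exists[OF s[symmetric] this] obtain \<tau> where "good x \<tau>"
      unfolding good_def C_def by blast
    then show ?thesis unfolding tau_def by (rule someI)
  qed
  have near: "norm (x - xs (tau x)) < r" if "x \<in> U" for x
    using tau[OF that] CU[OF that] by (simp add: good_def)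
  have unique: "\<tau> = tau x"
    if u: "x \<in> U" "\<tau> \<in> {0..<T}" "z \<tau> \<bullet> (x - xs \<tau>) = 0" "norm (Pm \<tau> *v (x - xs \<tau>)) < r" for x \<tau>
  proof -
    have "norm (x - xs \<tau>) < r" using Pm_on_hyperplane(2)[OF u(3)] u(4) by simp
    then obtain k :: int where "\<bar>\<tau> - (tau x + of_int k * T)\<bar> \<le> 2 / \<delta> * norm (x - x)"
      using close[OF u(3), of "tau x" x] tau[OF u(1)] near[OF u(1)] r(1) by (auto simp: good_def)
    then have eq: "\<tau> = tau x + of_int k * T" by simp
    have range: "\<tau> < T" "0 \<le> \<tau>" "tau x < T" "0 \<le> tau x"
      using u(2) tau[OF u(1)] by (auto simp: good_def)
    have "of_int k * T < 1 * T" "(- 1) * T < of_int k * T" using eq range by linarith+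
    then have "of_int k < (1::real)" "(- 1 :: real) < of_int k"
      using T_pos by (simp_all only: mult_less_cancel_right_pos)
    then have "k = 0" by linarith
    with eq show ?thesis by simp
  qed
  have "open U"
    unfolding U_def by (intro open_Collect_less continuous_on_infdist continuous_on_id continuous_on_const)
  moreover have "\<Gamma> \<subseteq> U" using r(1) C by (auto simp: U_def)
  moreover have "norm (xp x) < r" if "x \<in> U" for x
    unfolding xp_def by (rule le_less_trans[OF norm_Pm_le near[OF that]])
  ultimately have "transverse_coordinates T xs z Pm U r xp tau"
    unfolding transverse_coordinates_def
    using r(1) tau unique by (auto simp: good_def xp_def)
  moreover have "norm (x - xs (tau x)) \<le> C * infdist x \<Gamma>" "norm (x - xs (tau x)) \<le> tube_radius"
    if "x \<in> U" for x
    using tau[OF that] near[OF that] r(2) by (simp_all add: good_def)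
  moreover have "\<exists>k::int. \<bar>tau x - (tau y + of_int k * T)\<bar> \<le> 2 / \<delta> * norm (x - y)"
    if "x \<in> U" "y \<in> U" "norm (x - y) < r" for x y
    using that tau near by (intro close) (auto simp: good_def)
  ultimately show thesis using C that unfolding regular_coordinates_def by blast
qed

text \<open>With values in \<open>{0..<T}\<close> the time coordinate jumps where a curve crosses the section at \<open>xs 0\<close>.
  Adding integer multiples of \<open>T\<close> gives a differentiable \<open>q\<close>, and periodic functions do not see the
  difference.\<close>

lemma time_coordinate_along_curve:
  assumes coordinates: "regular_coordinates U r xp tau C"
    and x: "\<phi> 0 = x" "x \<in> U" and \<phi>: "(\<phi> has_vector_derivative f x) (at 0)"
  obtains q where "q 0 = tau x" "(q has_real_derivative clock_rate (tau x) x) (at 0)"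
    "\<forall>\<^sub>F t in nhds 0. \<phi> t \<in> U \<and> (\<exists>k::int. q t = tau (\<phi> t) + of_int k * T)"
proof -
  have U: "open U" "r > 0" and sec: "\<And>x. x \<in> U \<Longrightarrow> z (tau x) \<bullet> (x - xs (tau x)) = 0"
    and tube: "\<And>x. x \<in> U \<Longrightarrow> norm (x - xs (tau x)) \<le> tube_radius"
    and close: "\<And>x y. x \<in> U \<Longrightarrow> y \<in> U \<Longrightarrow> norm (x - y) < r \<Longrightarrow>
      \<exists>k::int. \<bar>tau x - (tau y + of_int k * T)\<bar> \<le> 2 / \<delta> * norm (x - y)"
    using coordinates by (auto simp: regular_coordinates_def transverse_coordinates_def)
  have \<phi>_cont: "isCont \<phi> 0" by (rule has_vector_derivative_continuous[OF \<phi>])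
  define near where "near = (\<lambda>t. \<phi> t \<in> U \<and> norm (x - \<phi> t) < r)"
  have "open (U \<inter> ball x r)" "\<phi> 0 \<in> U \<inter> ball x r" using U x by auto
  moreover have "(\<phi> \<longlongrightarrow> \<phi> 0) (nhds 0)"
    using \<phi>_cont unfolding isCont_def tendsto_at_iff_tendsto_nhds .
  ultimately have "\<forall>\<^sub>F t in nhds 0. \<phi> t \<in> U \<inter> ball x r"
    by (intro topological_tendstoD)
  then have near: "\<forall>\<^sub>F t in nhds 0. near t"
    by (rule eventually_mono) (auto simp: near_def dist_norm)
  define k where "k = (\<lambda>t. SOME k::int. \<bar>tau x - (tau (\<phi> t) + of_int k * T)\<bar> \<le> 2 / \<delta> * norm (x - \<phi> t))"
  define q where "q = (\<lambda>t. tau (\<phi> t) + of_int (k t) * T)"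
  have q: "\<bar>tau x - q t\<bar> \<le> 2 / \<delta> * norm (x - \<phi> t)" if "near t" for t
    unfolding q_def k_def by (rule someI_ex) (use that x close near_def in blast)
  have "near 0" using near by (rule eventually_nhds_x_imp_x)
  then have q0: "q 0 = tau x" using q[of 0] x(1) by simp
  have "((\<lambda>t. q t - tau x) \<longlongrightarrow> 0) (at 0)"
  proof (rule Lim_null_comparison)
    show "\<forall>\<^sub>F t in at 0. norm (q t - tau x) \<le> 2 / \<delta> * norm (x - \<phi> t)"
      using near unfolding eventually_nhds_conv_at
      by (elim conjE eventually_mono) (use q in \<open>force simp: abs_minus_commute\<close>)
    have "((\<lambda>t. 2 / \<delta> * norm (x - \<phi> t)) \<longlongrightarrow> 2 / \<delta> * norm (x - x)) (at 0)"
      using \<phi>_cont x(1) by (intro tendsto_intros) (simp add: isCont_def)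
    then show "((\<lambda>t. 2 / \<delta> * norm (x - \<phi> t)) \<longlongrightarrow> 0) (at 0)" by simp
  qed
  then have q_cont: "isCont q 0" by (simp add: isCont_def q0 LIM_zero_iff)
  have shift: "z (q t) = z (tau (\<phi> t))" "xs (q t) = xs (tau (\<phi> t))" for t
    unfolding q_def by (rule periodic_int_shift[of z, OF z_per] periodic_int_shift[of xs, OF xs_per])+
  have "(q has_real_derivative (z (q 0) \<bullet> f x) / (z (q 0) \<bullet> f (xs (q 0)) - dz (q 0) \<bullet> (\<phi> 0 - xs (q 0)))) (at 0)"
  proof (rule section_time_deriv[OF \<phi> q_cont])
    show "\<forall>\<^sub>F t in nhds 0. z (q t) \<bullet> (\<phi> t - xs (q t)) = 0"
      using near by (rule eventually_mono) (use sec in \<open>auto simp: near_def shift\<close>)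
    show "dz (q 0) \<bullet> (\<phi> 0 - xs (q 0)) - z (q 0) \<bullet> f (xs (q 0)) \<noteq> 0"
      using inner_dz_le(1)[OF tube[OF x(2)], of "tau x"] transversal[of "tau x"] \<delta>_pos by (simp add: q0 x(1))
  qed
  then have "(q has_real_derivative clock_rate (tau x) x) (at 0)"
    by (simp add: q0 x(1) clock_rate_def)
  moreover have "\<forall>\<^sub>F t in nhds 0. \<phi> t \<in> U \<and> (\<exists>k::int. q t = tau (\<phi> t) + of_int k * T)"
    using near by (rule eventually_mono) (auto simp: near_def q_def)
  ultimately show thesis using that q0 by blast
qed

lemma quadratic_form_along_curve:
  fixes P :: "real \<Rightarrow> real^'m^'m"
  assumes q: "(q has_real_derivative s) (at 0)" and \<phi>: "(\<phi> has_vector_derivative f (\<phi> 0)) (at 0)"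
    and s: "s = clock_rate (q 0) (\<phi> 0)" and P: "(P has_vector_derivative dP) (at (q 0))"
  defines "p \<equiv> (\<lambda>t. Pm (q t) *v (\<phi> t - xs (q t)))"
  shows "((\<lambda>t. p t \<bullet> (P (q t) *v p t)) has_real_derivative
     transverse_velocity (q 0) (\<phi> 0) \<bullet> (P (q 0) *v p 0) + p 0 \<bullet> ((s *\<^sub>R dP) *v p 0) +
     p 0 \<bullet> (P (q 0) *v transverse_velocity (q 0) (\<phi> 0))) (at 0)"
proof -
  have q': "(q has_vector_derivative s) (at 0)"
    using q by (simp add: has_real_derivative_iff_has_vector_derivative)
  have comp: "((\<lambda>t. h (q t)) has_vector_derivative s *\<^sub>R h') (at 0)"
    if "(h has_vector_derivative h') (at (q 0))" for h :: "real \<Rightarrow> 'c::real_normed_vector" and h'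
    using vector_diff_chain_at[OF q' that] by (simp add: o_def)
  have "((\<lambda>t. \<phi> t - xs (q t)) has_vector_derivative f (\<phi> 0) - s *\<^sub>R f (xs (q 0))) (at 0)"
    by (rule has_vector_derivative_diff[OF \<phi> comp[OF xs_deriv]])
  from matrix_vector_deriv[OF comp[OF Pm_deriv] this]
  have p: "(p has_vector_derivative transverse_velocity (q 0) (\<phi> 0)) (at 0)"
    by (simp add: p_def transverse_velocity_def s scaleR_matrix_vector_assoc add.commute)
  from has_real_derivative_bilinear_form[OF comp[OF P] p p] show ?thesis .
qed

text \<open>For \<open>p = xp x\<close> and \<open>w\<close> the difference between the transverse velocity and \<open>A p\<close>, the Lyapunov
  equation reduces the derivative of the quadratic form to
  \<open>- p \<bullet> Q p + (\<tau>' - 1) (p \<bullet> P' p) + w \<bullet> P p + p \<bullet> P w\<close>.\<close>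

theorem Lyapunov_solution_verifies:
  fixes P Q :: "real \<Rightarrow> real^'m^'m"
  assumes coordinates: "regular_coordinates U r xp tau C"
    and Q: "SPPD T Q" "continuous_on UNIV Q" and P: "SPPD_Lyapunov_solution T A Q P"
  shows "\<exists>W\<subseteq>U. verifies_exponential_orbital_stability f \<Gamma> W (\<lambda>x. xp x \<bullet> (P (tau x) *v xp x))"
proof -
  have U: "open U" "\<Gamma> \<subseteq> U" and sec: "\<And>x. x \<in> U \<Longrightarrow> z (tau x) \<bullet> (x - xs (tau x)) = 0"
    and xp: "\<And>x. x \<in> U \<Longrightarrow> xp x = Pm (tau x) *v (x - xs (tau x))"
    and C: "C > 0" "\<And>x. x \<in> U \<Longrightarrow> norm (x - xs (tau x)) \<le> C * infdist x \<Gamma>"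
    using coordinates by (auto simp: regular_coordinates_def transverse_coordinates_def)
  have P_per: "P (t + T) = P t" and P_C1: "P C1_differentiable_on UNIV" and
    P_eq: "vector_derivative P (at t) + transpose (A t) ** P t + P t ** A t + Q t = 0" for t
    using P by (auto simp: SPPD_Lyapunov_solution_def SPPD_def)
  have P_deriv: "(P has_vector_derivative vector_derivative P (at t)) (at t)" for t
    using P_C1 by (simp add: C1_differentiable_on_eq vector_derivative_works)
  have P_cont: "continuous_on UNIV P" using P_C1 by (rule C1_differentiable_imp_continuous_on)
  have dP_cont: "continuous_on UNIV (\<lambda>t. vector_derivative P (at t))"
    using P_C1 by (simp add: C1_differentiable_on_eq)
  have P_SPPD: "SPPD T P" using P by (simp add: SPPD_Lyapunov_solution_def)
  obtain k1 k2 where k: "k1 > 0" "k2 > 0" "\<And>t v. k1 * (norm v)\<^sup>2 \<le> v \<bullet> (P t *v v)"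
    "\<And>t v. v \<bullet> (P t *v v) \<le> k2 * (norm v)\<^sup>2"
    using SPPD_bounds[OF P_SPPD P_cont T_pos] by blast
  obtain q1 q2 where "q1 > 0" "q2 > 0" "\<And>t v. q1 * (norm v)\<^sup>2 \<le> v \<bullet> (Q t *v v)"
    "\<And>t v. v \<bullet> (Q t *v v) \<le> q2 * (norm v)\<^sup>2"
    using SPPD_bounds[OF Q T_pos] by blast
  note q1 = this(1,3)
  obtain BP where BP: "BP > 0" "\<And>t v. norm (P t *v v) \<le> BP * norm v"
    using periodic_matrix_bounded[OF P_cont P_per T_pos] by blast
  obtain BD where BD: "BD > 0" "\<And>t v. norm (vector_derivative P (at t) *v v) \<le> BD * norm v"
    using periodic_matrix_bounded[OF dP_cont vector_derivative_periodic[OF P_deriv P_per] T_pos] by blast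
  \<comment> \<open>Chosen so that the three error terms use up at most half of the lower bound \<open>q1\<close> of Q.\<close>
  define \<epsilon> where "\<epsilon> = q1 / (2 * (BD + 2 * BP))"
  have \<epsilon>: "\<epsilon> > 0" "\<epsilon> * BD + 2 * (\<epsilon> * BP) = q1 / 2"
  proof -
    show "\<epsilon> > 0" using q1 BP(1) BD(1) by (simp add: \<epsilon>_def)
    have "BD + 2 * BP \<noteq> 0" using BP(1) BD(1) by simp
    then have "\<epsilon> * (BD + 2 * BP) = q1 / 2"
      unfolding \<epsilon>_def using nonzero_mult_divide_mult_cancel_right by (metis times_divide_eq_left)
    then show "\<epsilon> * BD + 2 * (\<epsilon> * BP) = q1 / 2" by (simp add: algebra_simps)
  qed
  obtain d where d: "d > 0" "\<And>x \<tau>. z \<tau> \<bullet> (x - xs \<tau>) = 0 \<Longrightarrow> norm (x - xs \<tau>) \<le> d \<Longrightarrow>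
     \<bar>clock_rate \<tau> x - 1\<bar> \<le> \<epsilon> \<and>
     norm (transverse_velocity \<tau> x - A \<tau> *v (Pm \<tau> *v (x - xs \<tau>))) \<le> \<epsilon> * norm (x - xs \<tau>)"
    using transverse_dynamics_linearize[OF \<epsilon>(1)] by blast
  define V where "V = (\<lambda>x. xp x \<bullet> (P (tau x) *v xp x))"
  define W where "W = U \<inter> {x. infdist x \<Gamma> < d / C}"
  have norm_xp: "norm (xp x) = norm (x - xs (tau x))" if "x \<in> U" for x
    using Pm_on_hyperplane(2)[OF sec[OF that]] xp[OF that] by simp
  have W_near: "norm (x - xs (tau x)) \<le> d" if "x \<in> W" for x
  proof -
    have "C * infdist x \<Gamma> \<le> d" using that C(1) by (simp add: W_def field_simps)
    then show ?thesis using C(2)[of x] that by (simp add: W_def)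
  qed
  have sq: "(infdist x \<Gamma>)\<^sup>2 \<le> (norm (xp x))\<^sup>2" "(norm (xp x))\<^sup>2 \<le> C\<^sup>2 * (infdist x \<Gamma>)\<^sup>2" if "x \<in> U" for x
  proof -
    show "(infdist x \<Gamma>)\<^sup>2 \<le> (norm (xp x))\<^sup>2"
      unfolding norm_xp[OF that] by (intro power_mono infdist_orbit_le infdist_nonneg)
    show "(norm (xp x))\<^sup>2 \<le> C\<^sup>2 * (infdist x \<Gamma>)\<^sup>2"
      unfolding norm_xp[OF that] power_mult_distrib[symmetric] using C(2)[OF that] by (rule power_mono) simp
  qed
  have decay: "\<exists>v. ((\<lambda>t. V (\<phi> t)) has_real_derivative v) (at 0) \<and> v \<le> - (q1 / 2) * (infdist x \<Gamma>)\<^sup>2"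
    if x: "x \<in> W" "\<phi> 0 = x" and sol: "e > 0" "ode_solution (\<lambda>_. f) {-e<..<e} \<phi>" for x \<phi> e
  proof -
    have xU: "x \<in> U" using x by (simp add: W_def)
    have \<phi>: "(\<phi> has_vector_derivative f x) (at 0)"
    proof -
      have "(\<phi> has_vector_derivative f (\<phi> 0)) (at 0 within {-e<..<e})"
        using sol unfolding ode_solution_def by simp
      moreover have "at 0 within {-e<..<e} = at 0" using sol(1) by (intro at_within_open) auto
      ultimately show ?thesis by (simp only: x(2))
    qed
    obtain q where q: "q 0 = tau x" "(q has_real_derivative clock_rate (tau x) x) (at 0)"
      "\<forall>\<^sub>F t in nhds 0. \<phi> t \<in> U \<and> (\<exists>k::int. q t = tau (\<phi> t) + of_int k * T)"
      using time_coordinate_along_curve[OF coordinates x(2) xU \<phi>] by blast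
    define p where "p = xp x"
    define w where "w = transverse_velocity (tau x) x - A (tau x) *v p"
    define s where "s = clock_rate (tau x) x"
    define dP where "dP = vector_derivative P (at (tau x))"
    define v where "v = transverse_velocity (tau x) x \<bullet> (P (tau x) *v p) + p \<bullet> ((s *\<^sub>R dP) *v p) +
       p \<bullet> (P (tau x) *v transverse_velocity (tau x) x)"
    have "((\<lambda>t. (Pm (q t) *v (\<phi> t - xs (q t))) \<bullet> (P (q t) *v (Pm (q t) *v (\<phi> t - xs (q t))))) has_real_derivative v) (at 0)"
      using quadratic_form_along_curve[of q s \<phi> P dP] q(1,2) \<phi> P_deriv[of "tau x"] x(2)
      by (simp add: v_def s_def dP_def p_def xp[OF xU])
    moreover have "\<forall>\<^sub>F t in nhds 0. (Pm (q t) *v (\<phi> t - xs (q t))) \<bullet> (P (q t) *v (Pm (q t) *v (\<phi> t - xs (q t)))) = V (\<phi> t)"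
      using q(3)
    proof (rule eventually_mono)
      fix t assume "\<phi> t \<in> U \<and> (\<exists>k::int. q t = tau (\<phi> t) + of_int k * T)"
      then obtain k :: int where t: "\<phi> t \<in> U" "q t = tau (\<phi> t) + of_int k * T" by blast
      have "Pm (q t) = Pm (tau (\<phi> t))" "xs (q t) = xs (tau (\<phi> t))" "P (q t) = P (tau (\<phi> t))"
        unfolding t(2)
        by (rule periodic_int_shift[of Pm, OF Pm_per] periodic_int_shift[of xs, OF xs_per]
            periodic_int_shift[of P, OF P_per])+
      then show "(Pm (q t) *v (\<phi> t - xs (q t))) \<bullet> (P (q t) *v (Pm (q t) *v (\<phi> t - xs (q t)))) = V (\<phi> t)"
        by (simp add: V_def xp[OF t(1)])
    qed
    ultimately have V: "((\<lambda>t. V (\<phi> t)) has_real_derivative v) (at 0)"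
      using DERIV_cong_ev[where x = 0 and y = 0 and u = v and v = v and
          f = "\<lambda>t. (Pm (q t) *v (\<phi> t - xs (q t))) \<bullet> (P (q t) *v (Pm (q t) *v (\<phi> t - xs (q t))))" and
          g = "\<lambda>t. V (\<phi> t)"] by simp
    have est: "\<bar>s - 1\<bar> \<le> \<epsilon>" "norm w \<le> \<epsilon> * norm p"
      using d(2)[OF sec[OF xU] W_near[OF x(1)]] norm_xp[OF xU]
      by (simp_all add: s_def w_def p_def xp[OF xU, symmetric])
    have vel: "transverse_velocity (tau x) x = A (tau x) *v p + w" by (simp add: w_def)
    have dP: "p \<bullet> (dP *v p) = - ((A (tau x) *v p) \<bullet> (P (tau x) *v p)) - p \<bullet> (P (tau x) *v (A (tau x) *v p))
        - p \<bullet> (Q (tau x) *v p)"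
    proof -
      have "dP *v p + (transpose (A (tau x)) ** P (tau x)) *v p + (P (tau x) ** A (tau x)) *v p + Q (tau x) *v p = 0"
        using arg_cong[OF P_eq[of "tau x"], of "\<lambda>M. M *v p"] by (simp add: dP_def matrix_vector_mult_add_rdistrib)
      then have "p \<bullet> (dP *v p + (transpose (A (tau x)) ** P (tau x)) *v p + (P (tau x) ** A (tau x)) *v p + Q (tau x) *v p) = 0"
        by simp
      then have "p \<bullet> (dP *v p) + (A (tau x) *v p) \<bullet> (P (tau x) *v p) + p \<bullet> (P (tau x) *v (A (tau x) *v p)) + p \<bullet> (Q (tau x) *v p) = 0"
        unfolding inner_add_right inner_transpose_matrix_mult unfolding matrix_vector_mul_assoc[symmetric] .
      then show ?thesis by linarith
    qed
    have "v = - (p \<bullet> (Q (tau x) *v p)) + (s - 1) * (p \<bullet> (dP *v p)) + w \<bullet> (P (tau x) *v p) + p \<bullet> (P (tau x) *v w)"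
      unfolding v_def vel
      by (simp add: dP matrix_vector_right_distrib inner_add_left inner_add_right
          scaleR_matrix_vector_assoc[symmetric] algebra_simps)
    also have "\<dots> \<le> - (q1 * (norm p)\<^sup>2) + \<epsilon> * (BD * (norm p)\<^sup>2) + \<epsilon> * (BP * (norm p)\<^sup>2) + \<epsilon> * (BP * (norm p)\<^sup>2)"
    proof (intro add_mono)
      show "- (p \<bullet> (Q (tau x) *v p)) \<le> - (q1 * (norm p)\<^sup>2)" using q1(2) by simp
      have "\<bar>p \<bullet> (dP *v p)\<bar> \<le> norm p * (BD * norm p)"
        using Cauchy_Schwarz_ineq2[of p "dP *v p"] mult_left_mono[OF BD(2)[of "tau x" p] norm_ge_zero[of p]]
        by (simp add: dP_def)
      then have "\<bar>s - 1\<bar> * \<bar>p \<bullet> (dP *v p)\<bar> \<le> \<epsilon> * (norm p * (BD * norm p))"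
        using est(1) \<epsilon>(1) by (intro mult_mono) auto
      then show "(s - 1) * (p \<bullet> (dP *v p)) \<le> \<epsilon> * (BD * (norm p)\<^sup>2)"
        using abs_ge_self[of "(s - 1) * (p \<bullet> (dP *v p))"] by (simp add: abs_mult power2_eq_square mult_ac)
      have "w \<bullet> (P (tau x) *v p) \<le> (\<epsilon> * norm p) * (BP * norm p)"
        using norm_cauchy_schwarz[of w "P (tau x) *v p"] mult_mono[OF est(2) BP(2)[of "tau x" p]] \<epsilon>(1) by simp
      then show "w \<bullet> (P (tau x) *v p) \<le> \<epsilon> * (BP * (norm p)\<^sup>2)" by (simp add: power2_eq_square mult_ac)
      have "norm (P (tau x) *v w) \<le> BP * (\<epsilon> * norm p)"
        using mult_left_mono[OF est(2) less_imp_le[OF BP(1)]] by (rule order_trans[OF BP(2)])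
      then have "p \<bullet> (P (tau x) *v w) \<le> norm p * (BP * (\<epsilon> * norm p))"
        using norm_cauchy_schwarz[of p "P (tau x) *v w"] mult_left_mono[OF _ norm_ge_zero[of p]] by fastforce
      then show "p \<bullet> (P (tau x) *v w) \<le> \<epsilon> * (BP * (norm p)\<^sup>2)" by (simp add: power2_eq_square mult_ac)
    qed
    also have "\<dots> = (- q1 + (\<epsilon> * BD + 2 * (\<epsilon> * BP))) * (norm p)\<^sup>2" by (simp add: algebra_simps)
    also have "\<dots> = - (q1 / 2) * (norm p)\<^sup>2" unfolding \<epsilon>(2) by simp
    also have "\<dots> \<le> - (q1 / 2) * (infdist x \<Gamma>)\<^sup>2"
      using sq(1)[OF xU] q1(1) by (simp add: p_def)
    finally show ?thesis using V by blast
  qed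
  have bounds: "k1 * (infdist x \<Gamma>)\<^sup>2 \<le> V x" "V x \<le> (k2 * C\<^sup>2) * (infdist x \<Gamma>)\<^sup>2" if "x \<in> U" for x
  proof -
    show "k1 * (infdist x \<Gamma>)\<^sup>2 \<le> V x"
      unfolding V_def using mult_left_mono[OF sq(1)[OF that] less_imp_le[OF k(1)]] k(3) by (rule order_trans)
    have "V x \<le> k2 * (C\<^sup>2 * (infdist x \<Gamma>)\<^sup>2)"
      unfolding V_def using k(4) mult_left_mono[OF sq(2)[OF that] less_imp_le[OF k(2)]] by (rule order_trans)
    then show "V x \<le> (k2 * C\<^sup>2) * (infdist x \<Gamma>)\<^sup>2" by (simp add: mult.assoc)
  qed
  have main: "\<forall>x\<in>W. k1 * (infdist x \<Gamma>)\<^sup>2 \<le> V x \<and> V x \<le> (k2 * C\<^sup>2) * (infdist x \<Gamma>)\<^sup>2 \<and>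
     (\<forall>\<phi> e. e > 0 \<and> \<phi> 0 = x \<and> ode_solution (\<lambda>_. f) {-e<..<e} \<phi> \<longrightarrow>
       (\<exists>v. ((\<lambda>t. V (\<phi> t)) has_real_derivative v) (at 0) \<and> v \<le> - (q1 / 2) * (infdist x \<Gamma>)\<^sup>2))"
  proof (intro ballI conjI allI impI)
    fix x assume "x \<in> W"
    then have "x \<in> U" by (simp add: W_def)
    then show "k1 * (infdist x \<Gamma>)\<^sup>2 \<le> V x" "V x \<le> (k2 * C\<^sup>2) * (infdist x \<Gamma>)\<^sup>2" by (rule bounds)+
  qed (use decay in blast)
  have "open W"
    unfolding W_def
    by (intro open_Int U open_Collect_less continuous_on_infdist continuous_on_id continuous_on_const)
  moreover have "\<Gamma> \<subseteq> W" using U(2) d(1) C(1) by (auto simp: W_def)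
  moreover have "k2 * C\<^sup>2 > 0" "q1 / 2 > 0" using k(2) C(1) q1(1) by simp_all
  ultimately have "verifies_exponential_orbital_stability f \<Gamma> W V"
    unfolding verifies_exponential_orbital_stability_def using main k(1) by blast
  then show ?thesis by (intro exI[of _ W]) (auto simp: W_def V_def)
qed

end

section \<open>From orbital stability to the transverse linearization\<close>

text \<open>The curve \<open>x + \<epsilon> y\<close> solves the nonlinear equation up to an error \<open>o(\<epsilon>)\<close>, uniformly on bounded time
  intervals, and the Gronwall estimate compares it with a true solution. The bound \<open>R\<close> provides a common
  ball, hence one Lipschitz constant.\<close>

lemma linear_approximation_of_solutions:
  fixes f :: "real^'n \<Rightarrow> real^'n"
  assumes deriv: "\<And>x. (f has_derivative (\<lambda>h. J x *v h)) (at x)" and J: "continuous_on UNIV J"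
    and x: "\<And>t. (x has_vector_derivative f (x t)) (at t)"
    and y: "\<And>t. (y has_vector_derivative J (x t) *v y t) (at t)"
    and "0 \<le> D" "0 < \<eta>"
  obtains \<epsilon>0 where "\<epsilon>0 > 0"
    "\<And>\<epsilon> w. 0 < \<epsilon> \<Longrightarrow> \<epsilon> < \<epsilon>0 \<Longrightarrow> ode_solution (\<lambda>_. f) {0..} w \<Longrightarrow> w 0 = x t0 + \<epsilon> *\<^sub>R y t0 \<Longrightarrow>
       (\<And>s. 0 \<le> s \<Longrightarrow> norm (w s) \<le> R) \<Longrightarrow>
       norm (w D - x (t0 + D) - \<epsilon> *\<^sub>R y (t0 + D)) \<le> \<epsilon> * \<eta>"
proof -
  have x_cont: "continuous_on {t0..t0 + D} x"
    by (rule curve_continuous[OF x])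
  have y_cont: "continuous_on {t0..t0 + D} y"
    by (rule curve_continuous[OF y])
  have "bounded (x ` {t0..t0 + D})" "bounded (y ` {t0..t0 + D})"
    by (intro compact_imp_bounded compact_continuous_image x_cont y_cont compact_Icc)+
  then obtain X Y where X: "\<And>t. t \<in> {t0..t0 + D} \<Longrightarrow> norm (x t) \<le> X"
    and Y: "Y > 0" "\<And>t. t \<in> {t0..t0 + D} \<Longrightarrow> norm (y t) \<le> Y"
    unfolding bounded_pos by blast
  define R' where "R' = max R (X + Y)"
  obtain L where L: "L \<ge> 0" "\<And>x y. x \<in> cball 0 R' \<Longrightarrow> y \<in> cball 0 R' \<Longrightarrow> norm (f x - f y) \<le> L * norm (x - y)"
    using C1_lipschitz_on_balls[OF deriv J] unfolding lipschitz_on_balls_def by blast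
  define E where "E = exp ((2 * L + 1) * D) * D"
  define G where "G = sqrt E + 1"
  have G: "G > 0" "E \<le> G\<^sup>2"
  proof -
    have "E \<ge> 0" using \<open>0 \<le> D\<close> by (simp add: E_def)
    then show "G > 0" by (simp add: G_def add_nonneg_pos)
    have "E = (sqrt E)\<^sup>2" using \<open>E \<ge> 0\<close> by simp
    also have "\<dots> \<le> G\<^sup>2" using \<open>E \<ge> 0\<close> by (intro power_mono) (auto simp: G_def)
    finally show "E \<le> G\<^sup>2" .
  qed
  \<comment> \<open>A relative error of the linearization for which the Gronwall bound at time D is at most
    \<open>\<epsilon> * \<eta>\<close>.\<close>
  define e where "e = \<eta> / (Y * G)"
  have e: "e > 0" "e * Y * G = \<eta>" using \<open>0 < \<eta>\<close> Y(1) G(1) by (auto simp: e_def)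
  obtain d where d: "d > 0" "\<And>a h. a \<in> cball 0 X \<Longrightarrow> norm h \<le> d \<Longrightarrow> norm (f (a + h) - f a - J a *v h) \<le> e * norm h"
    using uniform_linearization[OF deriv J e(1)] by blast
  show thesis
  proof (rule that[of "min 1 (d / Y)"])
    show "min 1 (d / Y) > 0" using d(1) Y(1) by simp
    fix \<epsilon> w assume \<epsilon>: "0 < \<epsilon>" "\<epsilon> < min 1 (d / Y)" and w: "ode_solution (\<lambda>_. f) {0..} w"
      "w 0 = x t0 + \<epsilon> *\<^sub>R y t0" "\<And>s. 0 \<le> s \<Longrightarrow> norm (w s) \<le> R"
    define u where "u = (\<lambda>s. w s - x (s + t0) - \<epsilon> *\<^sub>R y (s + t0))"
    define u' where "u' = (\<lambda>s. f (w s) - f (x (s + t0)) - \<epsilon> *\<^sub>R (J (x (s + t0)) *v y (s + t0)))"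
    have du: "(u has_vector_derivative u' s) (at s within {0..D})" if "s \<in> {0..D}" for s
    proof -
      have "(w has_vector_derivative f (w s)) (at s within {0..D})"
        using w(1) that has_vector_derivative_within_subset[of w _ s "{0..}" "{0..D}"] by (auto simp: ode_solution_def)
      moreover have "((\<lambda>s. x (s + t0)) has_vector_derivative f (x (s + t0))) (at s within {0..D})"
        by (rule has_vector_derivative_at_within[OF has_vector_derivative_shift_time[OF x]])
      moreover have "((\<lambda>s. y (s + t0)) has_vector_derivative J (x (s + t0)) *v y (s + t0)) (at s within {0..D})"
        by (rule has_vector_derivative_at_within[OF has_vector_derivative_shift_time[OF y]])
      ultimately show ?thesis
        unfolding u_def u'_def
        by (intro has_vector_derivative_diff bounded_linear.has_vector_derivative[OF bounded_linear_scaleR_right])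
    qed
    have bound: "norm (u' s) \<le> L * norm (u s) + e * (\<epsilon> * Y)" if "s \<in> {0..D}" for s
    proof -
      define a where "a = x (s + t0)"
      define h where "h = \<epsilon> *\<^sub>R y (s + t0)"
      have s: "s + t0 \<in> {t0..t0 + D}" using that by auto
      have a: "norm a \<le> X" unfolding a_def by (rule X[OF s])
      have h: "norm h \<le> \<epsilon> * Y" unfolding h_def using Y(2)[OF s] \<epsilon>(1) by (simp add: mult_left_mono)
      have "\<epsilon> * Y \<le> d" "\<epsilon> * Y \<le> Y"
        using \<epsilon> Y(1) mult_right_mono[of \<epsilon> 1 Y] by (auto simp: field_simps)
      with h have h': "norm h \<le> d" "norm h \<le> Y" by linarith+
      have "a + h \<in> cball 0 R'" using norm_triangle_ineq[of a h] a h'(2) by (simp add: R'_def)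
      moreover have "w s \<in> cball 0 R'" using w(3)[of s] that by (auto simp: R'_def)
      ultimately have "norm (f (w s) - f (a + h)) \<le> L * norm (w s - (a + h))" by (intro L(2))
      moreover have "norm (f (a + h) - f a - J a *v h) \<le> e * norm h" using a h' by (intro d(2)) auto
      moreover have "e * norm h \<le> e * (\<epsilon> * Y)" using h e(1) by simp
      moreover have "norm (u' s) \<le> norm (f (w s) - f (a + h)) + norm (f (a + h) - f a - J a *v h)"
      proof -
        have "u' s = (f (w s) - f (a + h)) + (f (a + h) - f a - J a *v h)"
          by (simp add: u'_def a_def h_def matrix_vector_mult_scaleR)
        then show ?thesis by (simp only: norm_triangle_ineq)
      qed
      ultimately show ?thesis by (simp add: u_def a_def h_def diff_diff_eq)
    qed
    have "(norm (u D))\<^sup>2 \<le> exp ((2 * L + 1) * (D - 0)) * ((norm (u 0))\<^sup>2 + (e * (\<epsilon> * Y))\<^sup>2 * (D - 0))"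
      by (rule gronwall_inequality[OF \<open>0 \<le> D\<close> L(1), where u' = u']) (fact du bound)+
    also have "\<dots> = E * (e * (\<epsilon> * Y))\<^sup>2" by (simp add: u_def w(2) E_def)
    also have "\<dots> \<le> G\<^sup>2 * (e * (\<epsilon> * Y))\<^sup>2" using G(2) by (rule mult_right_mono) simp
    also have "\<dots> = (\<epsilon> * (e * Y * G))\<^sup>2" by (simp add: power_mult_distrib mult_ac)
    finally have "(norm (u D))\<^sup>2 \<le> (\<epsilon> * \<eta>)\<^sup>2" by (simp only: e(2))
    then have "norm (u D) \<le> \<epsilon> * \<eta>" by (rule power2_le_imp_le) (use \<epsilon>(1) \<open>0 < \<eta>\<close> in simp)
    then show "norm (w D - x (t0 + D) - \<epsilon> *\<^sub>R y (t0 + D)) \<le> \<epsilon> * \<eta>" by (simp add: u_def add.commute)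
  qed
qed

context transversal_frame
begin

text \<open>The derivatives of the constant expressions \<open>z t \<bullet> \<Pi>\<^sup>T p = 0\<close> and \<open>\<Pi> \<Pi>\<^sup>T p = p\<close>.\<close>

lemma frame_derivative_identities:
  "z t \<bullet> (transpose (dPm t) *v p) = - (dz t \<bullet> (transpose (Pm t) *v p))"
  "Pm t *v (transpose (dPm t) *v p) = - (dPm t *v (transpose (Pm t) *v p))"
proof -
  have "((\<lambda>t. transpose (Pm t)) has_vector_derivative transpose (dPm t)) (at t)"
    by (rule transpose_deriv[OF Pm_deriv])
  then have "((\<lambda>t. transpose (Pm t) *v p) has_vector_derivative transpose (Pm t) *v 0 + transpose (dPm t) *v p) (at t)"
    by (rule matrix_vector_deriv)
       (rule has_vector_derivative_const)
  then have lift: "((\<lambda>t. transpose (Pm t) *v p) has_vector_derivative transpose (dPm t) *v p) (at t)" by simp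
  have "((\<lambda>t. z t \<bullet> (transpose (Pm t) *v p)) has_vector_derivative
     z t \<bullet> (transpose (dPm t) *v p) + dz t \<bullet> (transpose (Pm t) *v p)) (at t)"
    by (rule bounded_bilinear.has_vector_derivative[OF bounded_bilinear_inner z_deriv lift])
  then have "((\<lambda>t. 0) has_vector_derivative
     z t \<bullet> (transpose (dPm t) *v p) + dz t \<bullet> (transpose (Pm t) *v p)) (at t)" by (simp add: z_transpose_Pm)
  from vector_derivative_unique_at[OF this has_vector_derivative_const]
  show "z t \<bullet> (transpose (dPm t) *v p) = - (dz t \<bullet> (transpose (Pm t) *v p))" by simp
  have "((\<lambda>t. Pm t *v (transpose (Pm t) *v p)) has_vector_derivative
     Pm t *v (transpose (dPm t) *v p) + dPm t *v (transpose (Pm t) *v p)) (at t)"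
    by (rule matrix_vector_deriv[OF Pm_deriv lift])
  then have "((\<lambda>t. p) has_vector_derivative
     Pm t *v (transpose (dPm t) *v p) + dPm t *v (transpose (Pm t) *v p)) (at t)" by (simp add: Pm_right)
  from vector_derivative_unique_at[OF this has_vector_derivative_const]
  show "Pm t *v (transpose (dPm t) *v p) = - (dPm t *v (transpose (Pm t) *v p))"
    by (simp add: eq_neg_iff_add_eq_0)
qed

lemma fxs_deriv: "((\<lambda>t. f (xs t)) has_vector_derivative jacobian f (xs t) *v f (xs t)) (at t)"
proof -
  have "((\<lambda>t. f (xs t)) has_derivative (\<lambda>h. jacobian f (xs t) *v (h *\<^sub>R f (xs t)))) (at t)"
    using xs_deriv[of t] unfolding has_vector_derivative_def by (rule has_derivative_compose[OF _ f_deriv])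
  then show ?thesis by (simp add: has_vector_derivative_def matrix_vector_mult_scaleR)
qed

text \<open>The coefficient \<open>\<theta>\<close> integrates the first order drift \<open>rate\<close> of the time coordinate. The residual of the
  variational equation is orthogonal to \<open>z t\<close> by the choice of \<open>\<theta>\<close> and to the frame by the definition of
  \<open>A\<close>, hence zero.\<close>

lemma variational_solution:
  assumes \<zeta>: "\<And>t. (\<zeta> has_vector_derivative A t *v \<zeta> t) (at t)"
  obtains \<theta> where "\<theta> t0 = 0"
    "\<And>t. ((\<lambda>t. \<theta> t *\<^sub>R f (xs t) + transpose (Pm t) *v \<zeta> t) has_vector_derivative
       jacobian f (xs t) *v (\<theta> t *\<^sub>R f (xs t) + transpose (Pm t) *v \<zeta> t)) (at t)"
proof -
  have \<zeta>_cont: "continuous_on UNIV \<zeta>"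
    by (rule curve_continuous[OF \<zeta>])
  have lift_cont: "continuous_on UNIV (\<lambda>t. transpose (Pm t) *v \<zeta> t)"
    by (rule matrix_vector_continuous[OF transpose_continuous[OF Pm_cont] \<zeta>_cont])
  have "continuous_on UNIV (\<lambda>t. rate t (\<zeta> t))"
    unfolding rate_def
  proof (rule continuous_on_divide)
    show "\<forall>t\<in>UNIV. z t \<bullet> f (xs t) \<noteq> 0" using zf_pos less_irrefl by metis
  qed (intro continuous_on_inner continuous_on_add z_cont dz_cont fxs_cont lift_cont
      matrix_vector_continuous[OF Jxs_cont])+
  from antiderivative_on_line[OF this] obtain H where H: "\<And>t. (H has_vector_derivative rate t (\<zeta> t)) (at t)" by blast
  define \<theta> where "\<theta> = (\<lambda>t. H t - H t0)"
  have \<theta>: "(\<theta> has_vector_derivative rate t (\<zeta> t)) (at t)" for t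
    unfolding \<theta>_def using has_vector_derivative_diff[OF H has_vector_derivative_const] by simp
  show thesis
  proof (rule that[of \<theta>])
    show "\<theta> t0 = 0" by (simp add: \<theta>_def)
    fix t
    define F where "F = f (xs t)"
    define J where "J = jacobian f (xs t)"
    define Z where "Z = transpose (Pm t) *v \<zeta> t"
    define d where "d = \<theta> t *\<^sub>R (J *v F) + rate t (\<zeta> t) *\<^sub>R F +
       (transpose (Pm t) *v (A t *v \<zeta> t) + transpose (dPm t) *v \<zeta> t)"
    have "((\<lambda>t. transpose (Pm t)) has_vector_derivative transpose (dPm t)) (at t)"
      by (rule transpose_deriv[OF Pm_deriv])
    then have "((\<lambda>t. transpose (Pm t) *v \<zeta> t) has_vector_derivative
        transpose (Pm t) *v (A t *v \<zeta> t) + transpose (dPm t) *v \<zeta> t) (at t)"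
      by (rule matrix_vector_deriv[OF _ \<zeta>])
    moreover have "((\<lambda>t. \<theta> t *\<^sub>R f (xs t)) has_vector_derivative \<theta> t *\<^sub>R (J *v F) + rate t (\<zeta> t) *\<^sub>R F) (at t)"
      unfolding J_def F_def
      by (rule bounded_bilinear.has_vector_derivative[OF bounded_bilinear_scaleR \<theta> fxs_deriv])
    ultimately have "((\<lambda>t. \<theta> t *\<^sub>R f (xs t) + transpose (Pm t) *v \<zeta> t) has_vector_derivative d) (at t)"
      unfolding d_def by (rule has_vector_derivative_add[rotated])
    moreover have "d = J *v (\<theta> t *\<^sub>R F + Z)"
    proof -
      define w where "w = rate t (\<zeta> t) *\<^sub>R F + transpose (Pm t) *v (A t *v \<zeta> t) + transpose (dPm t) *v \<zeta> t - J *v Z"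
      have "rate t (\<zeta> t) * (z t \<bullet> F) = z t \<bullet> (J *v Z) + dz t \<bullet> Z"
        using zf_pos[of t] by (simp add: rate_def J_def Z_def F_def)
      then have "z t \<bullet> w = 0"
        by (simp add: w_def inner_add_right inner_diff_right z_transpose_Pm frame_derivative_identities Z_def)
      moreover have "Pm t *v w = 0"
        by (simp add: w_def matrix_vector_right_distrib matrix_vector_mult_diff_distrib Pm_right
            frame_derivative_identities transverse_linearization_apply matrix_vector_mult_scaleR
            J_def Z_def F_def)
      ultimately have "w = 0" using Pm_left[of t w] by simp
      then show ?thesis
        by (simp add: d_def w_def matrix_vector_right_distrib matrix_vector_mult_scaleR algebra_simps)
    qed
    ultimately show "((\<lambda>t. \<theta> t *\<^sub>R f (xs t) + transpose (Pm t) *v \<zeta> t) has_vector_derivative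
       jacobian f (xs t) *v (\<theta> t *\<^sub>R f (xs t) + transpose (Pm t) *v \<zeta> t)) (at t)"
      by (simp add: J_def F_def Z_def)
  qed
qed

text \<open>Frame coordinates of the projection onto the section at \<open>t\<close> along the direction of the flow.\<close>

definition oblique :: "real \<Rightarrow> real^'n \<Rightarrow> real^'m" where
  "oblique t v = Pm t *v (v - ((z t \<bullet> v) / (z t \<bullet> f (xs t))) *\<^sub>R f (xs t))"

lemma oblique_linear: "linear (oblique t)"
  unfolding oblique_def linear_iff
  by (auto simp: inner_add_right add_divide_distrib matrix_vector_right_distrib matrix_vector_mult_diff_distrib
      matrix_vector_mult_scaleR algebra_simps)

lemma oblique_tangent: "oblique t (f (xs t)) = 0"
  using zf_pos[of t] by (simp add: oblique_def)

lemma oblique_lift: "oblique t (transpose (Pm t) *v p) = p"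
  by (simp add: oblique_def z_transpose_Pm Pm_right)

lemma norm_oblique_le: "norm (oblique t v) \<le> (1 + speed_max / \<delta>) * norm v"
proof -
  have "norm (oblique t v) \<le> norm v + \<bar>z t \<bullet> v\<bar> / (z t \<bullet> f (xs t)) * norm (f (xs t))"
    using norm_Pm_le[of t "v - ((z t \<bullet> v) / (z t \<bullet> f (xs t))) *\<^sub>R f (xs t)"]
      norm_triangle_ineq4[of v "((z t \<bullet> v) / (z t \<bullet> f (xs t))) *\<^sub>R f (xs t)"] zf_pos[of t]
    by (simp add: oblique_def)
  also have "\<bar>z t \<bullet> v\<bar> / (z t \<bullet> f (xs t)) * norm (f (xs t)) \<le> norm v / \<delta> * speed_max"
    using Cauchy_Schwarz_ineq2[of "z t" v] transversal[of t] \<delta>_pos zf_pos[of t] speed_max(1) speed_max(2)[of t]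
    by (intro mult_mono frac_le) (auto simp: z_norm)
  finally show ?thesis by (simp add: algebra_simps)
qed

text \<open>Starting at \<open>xs t0 + \<epsilon> y t0\<close>, the nonlinear solution is \<open>xs t1 + \<epsilon> y t1 + o(\<epsilon>)\<close> at time \<open>t1\<close> and lies
  within \<open>\<epsilon> a\<close> of some orbit point \<open>xs s\<close>, where \<open>|s - t1| = O(\<epsilon>)\<close>. The chord from \<open>xs t1\<close> to \<open>xs s\<close> is
  tangent to the flow up to \<open>o(\<epsilon>)\<close>, so the oblique projection removes it and maps \<open>y t1\<close> to \<open>\<zeta> t1\<close>.
  Dividing by \<open>\<epsilon>\<close> and letting the remainder tend to 0 gives the bound.\<close>

lemma decay_of_linearization:
  assumes stable: "\<And>x0. infdist x0 \<Gamma> < b \<Longrightarrow> \<exists>x. unique_forward_solution f x0 x \<and>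
             (\<forall>t\<ge>0. infdist (x t) \<Gamma> \<le> K * infdist x0 \<Gamma> * exp (- c * t))"
    and K: "b > 0" "K > 0" "c > 0"
    and \<zeta>: "\<And>t. (\<zeta> has_vector_derivative A t *v \<zeta> t) (at t)" and "t0 \<le> t1"
  shows "norm (\<zeta> t1) \<le> (1 + speed_max / \<delta>) * (K * norm (\<zeta> t0) * exp (- c * (t1 - t0)))"
proof -
  define D where "D = t1 - t0"
  define a where "a = K * norm (\<zeta> t0) * exp (- c * D)"
  define \<kappa> where "\<kappa> = 1 + speed_max / \<delta>"
  have D: "D \<ge> 0" "t0 + D = t1" using \<open>t0 \<le> t1\<close> by (auto simp: D_def)
  have \<kappa>: "\<kappa> > 0" using speed_max(1) \<delta>_pos by (simp add: \<kappa>_def add_pos_pos)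
  have a: "a \<ge> 0" using K by (simp add: a_def)
  obtain R where R: "\<And>t. norm (xs t) \<le> R"
    using periodic_continuous_bounded[OF xs_cont xs_per T_pos] by blast
  obtain \<theta> where \<theta>: "\<theta> t0 = 0"
    "\<And>t. ((\<lambda>t. \<theta> t *\<^sub>R f (xs t) + transpose (Pm t) *v \<zeta> t) has_vector_derivative
       jacobian f (xs t) *v (\<theta> t *\<^sub>R f (xs t) + transpose (Pm t) *v \<zeta> t)) (at t)"
    using variational_solution[OF \<zeta>] by blast
  define y where "y = (\<lambda>t. \<theta> t *\<^sub>R f (xs t) + transpose (Pm t) *v \<zeta> t)"
  have y_deriv: "(y has_vector_derivative jacobian f (xs t) *v y t) (at t)" for t
    unfolding y_def by (rule \<theta>(2))
  have y0: "norm (y t0) = norm (\<zeta> t0)" by (simp add: y_def \<theta>(1) norm_transpose_Pm)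
  have y1: "oblique t1 (y t1) = \<zeta> t1"
    by (simp add: y_def linear_add[OF oblique_linear] linear_cmul[OF oblique_linear] oblique_tangent oblique_lift)
  obtain r where r: "0 < r" "r \<le> tube_radius" and close: "\<And>x y s t. z s \<bullet> (x - xs s) = 0 \<Longrightarrow> z t \<bullet> (y - xs t) = 0 \<Longrightarrow>
       norm (x - xs s) < r \<Longrightarrow> norm (y - xs t) < r \<Longrightarrow> norm (x - y) < r \<Longrightarrow>
       \<exists>k::int. \<bar>s - (t + of_int k * T)\<bar> \<le> 2 / \<delta> * norm (x - y)"
    using times_on_sections_close by blast
  have main: "norm (\<zeta> t1) \<le> \<kappa> * (a + 2 * \<eta>)" if "\<eta> > 0" for \<eta>
  proof -
    define B where "B = a + \<eta> + norm (y t1)"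
    have B: "B > 0" using a \<open>\<eta> > 0\<close> by (simp add: B_def add_pos_nonneg)
    \<comment> \<open>\<open>B * \<epsilon>\<close> will bound the chord and \<open>2 / \<delta> * (\<epsilon> * B)\<close> the time difference, so the deviation of the chord
      from the tangent is at most \<open>\<epsilon> * \<eta>\<close>.\<close>
    define \<eta>' where "\<eta>' = \<eta> * \<delta> / (2 * B)"
    have \<eta>': "\<eta>' > 0" "\<eta>' * (2 / \<delta> * B) = \<eta>" using \<open>\<eta> > 0\<close> \<delta>_pos B by (auto simp: \<eta>'_def)
    obtain h0 where h0: "h0 > 0" "\<And>s. \<bar>s - t1\<bar> < h0 \<Longrightarrow>
        norm (xs s - xs t1 - (s - t1) *\<^sub>R f (xs t1)) \<le> \<eta>' * \<bar>s - t1\<bar>"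
      using xs_deriv[of t1] \<eta>'(1) unfolding has_vector_derivative_def has_derivative_at_alt by fastforce
    obtain \<epsilon>0 where \<epsilon>0: "\<epsilon>0 > 0"
      "\<And>\<epsilon> w. 0 < \<epsilon> \<Longrightarrow> \<epsilon> < \<epsilon>0 \<Longrightarrow> ode_solution (\<lambda>_. f) {0..} w \<Longrightarrow> w 0 = xs t0 + \<epsilon> *\<^sub>R y t0 \<Longrightarrow>
       (\<And>s. 0 \<le> s \<Longrightarrow> norm (w s) \<le> R + K * b) \<Longrightarrow>
       norm (w D - xs (t0 + D) - \<epsilon> *\<^sub>R y (t0 + D)) \<le> \<epsilon> * \<eta>"
      using linear_approximation_of_solutions[OF f_deriv J_cont xs_deriv y_deriv D(1) \<open>\<eta> > 0\<close>] by blast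
    have "\<exists>\<epsilon>>0. \<epsilon> < \<epsilon>0 \<and> \<epsilon> * norm (\<zeta> t0) < b \<and> \<epsilon> * B < r \<and> 2 / \<delta> * (\<epsilon> * B) < h0"
    proof -
      have pos: "\<exists>\<epsilon>1>0. \<forall>\<epsilon>. 0 < \<epsilon> \<and> \<epsilon> < \<epsilon>1 \<longrightarrow> \<epsilon> * C < d" if "d > 0" "C \<ge> 0" for C d :: real
      proof (intro exI[of _ "d / (C + 1)"] conjI allI impI)
        show "d / (C + 1) > 0" using that by simp
        fix \<epsilon> assume "0 < \<epsilon> \<and> \<epsilon> < d / (C + 1)"
        then have "\<epsilon> * (C + 1) < d" "\<epsilon> > 0" using that by (auto simp: field_simps)
        then show "\<epsilon> * C < d" by (simp add: distrib_left)
      qed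
      obtain e1 where e1: "e1 > 0" "\<forall>\<epsilon>. 0 < \<epsilon> \<and> \<epsilon> < e1 \<longrightarrow> \<epsilon> * norm (\<zeta> t0) < b" using pos[OF K(1), of "norm (\<zeta> t0)"] by auto
      obtain e2 where e2: "e2 > 0" "\<forall>\<epsilon>. 0 < \<epsilon> \<and> \<epsilon> < e2 \<longrightarrow> \<epsilon> * B < r" using pos[OF r(1), of B] B by auto
      obtain e3 where e3: "e3 > 0" "\<forall>\<epsilon>. 0 < \<epsilon> \<and> \<epsilon> < e3 \<longrightarrow> \<epsilon> * (2 / \<delta> * B) < h0"
        using pos[OF h0(1), of "2 / \<delta> * B"] B \<delta>_pos by auto
      define \<epsilon> where "\<epsilon> = min (min \<epsilon>0 e1) (min e2 e3) / 2"
      have "0 < \<epsilon>" "\<epsilon> < \<epsilon>0" "\<epsilon> < e1" "\<epsilon> < e2" "\<epsilon> < e3" using \<epsilon>0(1) e1(1) e2(1) e3(1) by (auto simp: \<epsilon>_def)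
      then have "\<epsilon> * norm (\<zeta> t0) < b" "\<epsilon> * B < r" "\<epsilon> * (2 / \<delta> * B) < h0"
        using e1(2) e2(2) e3(2) by blast+
      moreover have "2 / \<delta> * (\<epsilon> * B) = \<epsilon> * (2 / \<delta> * B)" by simp
      ultimately show ?thesis using \<open>0 < \<epsilon>\<close> \<open>\<epsilon> < \<epsilon>0\<close> by (intro exI[of _ \<epsilon>]) metis
    qed
    then obtain \<epsilon> where \<epsilon>: "\<epsilon> > 0" "\<epsilon> < \<epsilon>0" "\<epsilon> * norm (\<zeta> t0) < b" "\<epsilon> * B < r" "2 / \<delta> * (\<epsilon> * B) < h0" by blast
    define x0 where "x0 = xs t0 + \<epsilon> *\<^sub>R y t0"
    have x0: "infdist x0 \<Gamma> \<le> \<epsilon> * norm (\<zeta> t0)"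
      using infdist_orbit_le[of x0 t0] \<epsilon>(1) by (simp add: x0_def y0)
    then obtain w where w: "unique_forward_solution f x0 w"
      "\<And>t. t \<ge> 0 \<Longrightarrow> infdist (w t) \<Gamma> \<le> K * infdist x0 \<Gamma> * exp (- c * t)"
      using stable[of x0] \<epsilon>(3) by auto
    have w_bound: "norm (w s) \<le> R + K * b" if "s \<ge> 0" for s
    proof -
      obtain s' where s': "infdist (w s) \<Gamma> = norm (w s - xs s')" by (rule nearest_orbit_point)
      have "norm (w s - xs s') \<le> K * infdist x0 \<Gamma> * exp (- c * s)" using w(2)[OF that] s' by simp
      also have "\<dots> \<le> (K * b) * 1"
        using K that x0 \<epsilon>(3) by (intro mult_mono) (auto simp: infdist_nonneg)
      finally show ?thesis using norm_triangle_ineq2[of "w s" "xs s'"] R[of s'] by linarith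
    qed
    have approx: "norm (w D - xs t1 - \<epsilon> *\<^sub>R y t1) \<le> \<epsilon> * \<eta>"
    proof -
      have "norm (w D - xs (t0 + D) - \<epsilon> *\<^sub>R y (t0 + D)) \<le> \<epsilon> * \<eta>"
        by (rule \<epsilon>0(2)[OF \<epsilon>(1,2)])
           (use w(1) w_bound in \<open>auto simp: unique_forward_solution_def x0_def\<close>)
      then show ?thesis by (simp only: D(2))
    qed
    obtain s0 where "infdist (w D) \<Gamma> = norm (w D - xs s0)" by (rule nearest_orbit_point)
    moreover have "infdist (w D) \<Gamma> \<le> \<epsilon> * a"
    proof -
      have "K * infdist x0 \<Gamma> * exp (- c * D) \<le> K * (\<epsilon> * norm (\<zeta> t0)) * exp (- c * D)"
        using x0 K by (intro mult_right_mono mult_left_mono) auto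
      with w(2)[OF D(1)] show ?thesis by (simp add: a_def mult_ac)
    qed
    ultimately have s0: "norm (w D - xs s0) \<le> \<epsilon> * a" by simp
    have gap: "norm (xs t1 + \<epsilon> *\<^sub>R y t1 - xs s0) \<le> \<epsilon> * (a + \<eta>)"
      using norm_triangle_ineq4[of "w D - xs s0" "w D - xs t1 - \<epsilon> *\<^sub>R y t1"] s0 approx
      by (simp add: algebra_simps)
    have near: "norm (xs s0 - xs t1) \<le> \<epsilon> * B"
      using norm_triangle_ineq4[of "\<epsilon> *\<^sub>R y t1" "xs t1 + \<epsilon> *\<^sub>R y t1 - xs s0"] gap \<epsilon>(1)
      by (simp add: B_def algebra_simps)
    obtain k :: int where k: "\<bar>s0 - (t1 + of_int k * T)\<bar> \<le> 2 / \<delta> * norm (xs s0 - xs t1)"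
      using close[of s0 "xs s0" t1 "xs t1"] near \<epsilon>(4) r by auto
    define s where "s = s0 + of_int (- k) * T"
    have xs_s: "xs s = xs s0" unfolding s_def by (rule periodic_int_shift[of xs, OF xs_per])
    have "2 / \<delta> * norm (xs s0 - xs t1) \<le> 2 / \<delta> * (\<epsilon> * B)"
      using near \<delta>_pos by (intro mult_left_mono) auto
    with k have s: "\<bar>s - t1\<bar> \<le> 2 / \<delta> * (\<epsilon> * B)" by (simp add: s_def algebra_simps)
    have "norm (xs s - xs t1 - (s - t1) *\<^sub>R f (xs t1)) \<le> \<eta>' * \<bar>s - t1\<bar>"
      using s \<epsilon>(5) by (intro h0(2)) simp
    also have "\<dots> \<le> \<eta>' * (2 / \<delta> * (\<epsilon> * B))" using s less_imp_le[OF \<eta>'(1)] by (rule mult_left_mono)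
    also have "\<dots> = \<epsilon> * (\<eta>' * (2 / \<delta> * B))" by (simp add: mult_ac)
    finally have tangent: "norm (xs s - xs t1 - (s - t1) *\<^sub>R f (xs t1)) \<le> \<epsilon> * \<eta>" by (simp only: \<eta>'(2))
    have "\<epsilon> *\<^sub>R y t1 = (xs t1 + \<epsilon> *\<^sub>R y t1 - xs s0) + (xs s - xs t1 - (s - t1) *\<^sub>R f (xs t1)) + (s - t1) *\<^sub>R f (xs t1)"
      by (simp add: xs_s)
    then have "oblique t1 (\<epsilon> *\<^sub>R y t1) = oblique t1 (xs t1 + \<epsilon> *\<^sub>R y t1 - xs s0) +
       oblique t1 (xs s - xs t1 - (s - t1) *\<^sub>R f (xs t1)) + (s - t1) *\<^sub>R oblique t1 (f (xs t1))"
      by (metis linear_add[OF oblique_linear] linear_cmul[OF oblique_linear])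
    then have "\<epsilon> *\<^sub>R \<zeta> t1 = oblique t1 (xs t1 + \<epsilon> *\<^sub>R y t1 - xs s0) +
       oblique t1 (xs s - xs t1 - (s - t1) *\<^sub>R f (xs t1))"
      by (simp add: linear_cmul[OF oblique_linear] y1 oblique_tangent)
    then have "\<epsilon> * norm (\<zeta> t1) = norm (oblique t1 (xs t1 + \<epsilon> *\<^sub>R y t1 - xs s0) +
       oblique t1 (xs s - xs t1 - (s - t1) *\<^sub>R f (xs t1)))"
      using \<epsilon>(1) by (metis abs_of_pos norm_scaleR)
    also have "\<dots> \<le> \<kappa> * (\<epsilon> * (a + \<eta>)) + \<kappa> * (\<epsilon> * \<eta>)"
      using mult_left_mono[OF gap less_imp_le[OF \<kappa>]] mult_left_mono[OF tangent less_imp_le[OF \<kappa>]]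
      by (intro norm_triangle_le add_mono order_trans[OF norm_oblique_le[of t1, folded \<kappa>_def]])
    also have "\<dots> = \<epsilon> * (\<kappa> * (a + 2 * \<eta>))" by (simp add: algebra_simps)
    finally show ?thesis using \<epsilon>(1) by simp
  qed
  have "norm (\<zeta> t1) \<le> \<kappa> * a"
  proof (rule field_le_epsilon)
    fix e :: real assume "e > 0"
    then have "e / (2 * \<kappa>) > 0" using \<kappa> by simp
    from main[OF this] show "norm (\<zeta> t1) \<le> \<kappa> * a + e" using \<kappa> by (simp add: algebra_simps)
  qed
  then show ?thesis by (simp add: \<kappa>_def a_def D_def)
qed

theorem exponentially_orbitally_stable_imp_linearization_stable:
  assumes "exponentially_orbitally_stable f \<Gamma>"
  shows "linear_system_exponentially_stable A"
proof -
  obtain b K c where K: "b > 0" "K > 0" "c > 0" and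
    stable: "\<forall>x0. infdist x0 \<Gamma> < b \<longrightarrow> (\<exists>x. unique_forward_solution f x0 x \<and>
             (\<forall>t\<ge>0. infdist (x t) \<Gamma> \<le> K * infdist x0 \<Gamma> * exp (- c * t)))"
    using assms unfolding exponentially_orbitally_stable_def by blast
  define K' where "K' = (1 + speed_max / \<delta>) * K"
  have "K' > 0" using K(2) speed_max(1) \<delta>_pos by (simp add: K'_def add_pos_pos)
  moreover have "norm (\<zeta> t) \<le> K' * exp (- c * (t - t0)) * norm (\<zeta> t0)"
    if \<zeta>: "ode_solution (\<lambda>t v. A t *v v) {t0..} \<zeta>" and "t0 \<le> t" for t0 \<zeta> t
  proof -
    obtain \<xi> where \<xi>: "\<xi> t0 = \<zeta> t0" "\<And>t. (\<xi> has_vector_derivative A t *v \<xi> t) (at t)"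
      using linearized.solution_exists by blast
    have "ode_solution (\<lambda>t v. A t *v v) {t0..} \<xi>"
      unfolding ode_solution_def using has_vector_derivative_at_within[OF \<xi>(2)] by blast
    from linearized.solution_unique_forward[OF \<zeta> this \<xi>(1)[symmetric] \<open>t0 \<le> t\<close>]
    have "\<zeta> t = \<xi> t" .
    moreover have "norm (\<xi> t) \<le> (1 + speed_max / \<delta>) * (K * norm (\<xi> t0) * exp (- c * (t - t0)))"
      using stable by (intro decay_of_linearization[OF _ K \<xi>(2) \<open>t0 \<le> t\<close>]) blast
    ultimately show ?thesis by (simp add: K'_def \<xi>(1) mult_ac)
  qed
  ultimately show ?thesis unfolding linear_system_exponentially_stable_def using K(3) by blast
qed

end

section \<open>The frame of the projection operator\<close>

lemma smooth_curve_C1: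
  assumes "smooth (z :: real \<Rightarrow> 'a::real_normed_vector)"
  shows "(z has_vector_derivative vector_derivative z (at t)) (at t)"
    and "continuous_on UNIV (\<lambda>t. vector_derivative z (at t))"
proof -
  have "Ck (Suc 0) z" using assms unfolding smooth_def by blast
  then have diff: "z differentiable (at t)" and cont: "continuous_on UNIV (\<lambda>t. frechet_derivative z (at t) 1)" for t
    by simp_all
  show "(z has_vector_derivative vector_derivative z (at t)) (at t)"
    using diff by (simp add: vector_derivative_works)
  have "frechet_derivative z (at t) 1 = vector_derivative z (at t)" for t
    using diff[of t] by (simp add: frechet_derivative_eq_vector_derivative)
  with cont show "continuous_on UNIV (\<lambda>t. vector_derivative z (at t))" by simp
qed

lemma smooth_jacobian:
  assumes "smooth (f :: real^'n \<Rightarrow> real^'n)"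
  shows "(f has_derivative (\<lambda>h. jacobian f x *v h)) (at x)" and "continuous_on UNIV (jacobian f)"
proof -
  have "Ck (Suc 0) f" using assms unfolding smooth_def by blast
  then have diff: "f differentiable (at x)" and cont: "continuous_on UNIV (\<lambda>x. frechet_derivative f (at x) v)" for x v
    by simp_all
  have deriv: "(f has_derivative frechet_derivative f (at x)) (at x)" for x
    using diff by (simp add: frechet_derivative_works)
  then have "jacobian f x *v h = frechet_derivative f (at x) h" for x h
    unfolding jacobian_def
    by (intro matrix_works) (use deriv in \<open>auto simp: linear_matrix_vector_mul_eq intro: has_derivative_linear\<close>)
  with deriv[of x] show "(f has_derivative (\<lambda>h. jacobian f x *v h)) (at x)" by simp
  show "continuous_on UNIV (jacobian f)"
    unfolding jacobian_def[abs_def] matrix_def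
    by (intro continuous_on_vec_lambda continuous_on_component cont)
qed

text \<open>As many orthonormal vectors as the dimension span the space, so a vector with all coefficients
  removed is zero.\<close>

lemma orthonormal_frame_projection:
  fixes e :: "real^'n" and \<xi> :: "'m::finite \<Rightarrow> real^'n"
  assumes dim: "CARD('n) = CARD('m) + 1" and e: "norm e = 1" "\<And>j. e \<bullet> \<xi> j = 0"
    and orth: "\<And>i j. \<xi> i \<bullet> \<xi> j = (if i = j then 1 else 0)"
  defines "X \<equiv> (\<chi> j. \<xi> j) :: real^'n^'m"
  shows "X *v e = 0" "X *v (transpose X *v p) = p" "transpose X *v (X *v v) = v - (e \<bullet> v) *\<^sub>R e"
proof -
  have Xv: "(X *v v) $ j = \<xi> j \<bullet> v" for v j
    by (simp add: X_def matrix_vector_mul_component)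
  have Xt: "transpose X *v p = (\<Sum>j\<in>UNIV. p $ j *\<^sub>R \<xi> j)" for p
    by (simp add: matrix_vector_column transpose_transpose scalar_mult_eq_scaleR X_def)
  show "X *v e = 0" using e(2) by (simp add: vec_eq_iff Xv inner_commute)
  show "X *v (transpose X *v p) = p"
    unfolding Xt by (simp add: vec_eq_iff Xv inner_sum_right orth if_distrib cong: if_cong)
  define w where "w = v - (e \<bullet> v) *\<^sub>R e - transpose X *v (X *v v)"
  define S where "S = insert e (range \<xi>)"
  have ee: "e \<bullet> e = 1" using e(1) by (simp add: norm_eq_1)
  have "inj \<xi>" using orth by (metis injI zero_neq_one)
  moreover have "e \<notin> range \<xi>" using e(2) ee by (metis imageE zero_neq_one)
  ultimately have "card S = CARD('n)" by (simp add: S_def card_image dim)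
  moreover have "0 \<notin> S" using orth ee by (auto simp: S_def) (metis inner_zero_left zero_neq_one)
  moreover have "pairwise orthogonal S"
    unfolding S_def pairwise_def orthogonal_def using e(2) orth by (auto simp: inner_commute)
  ultimately have "UNIV \<subseteq> span S"
    by (intro card_ge_dim_independent pairwise_orthogonal_independent) auto
  moreover have "orthogonal w y" if "y \<in> S" for y
  proof -
    have "w \<bullet> e = 0"
      using e(2) by (simp add: w_def Xt inner_diff_left inner_sum_left ee inner_commute[of v e]
          inner_commute[of "\<xi> j" e for j])
    moreover have "w \<bullet> \<xi> j = 0" for j
      by (simp add: w_def Xt inner_diff_left inner_sum_left e(2) orth Xv if_distrib inner_commute[of v] cong: if_cong)
    ultimately show ?thesis using that by (auto simp: S_def orthogonal_def)
  qed
  ultimately have "orthogonal w w" using orthogonal_to_span[of w S w] by blast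
  then have "w = 0" by (simp add: orthogonal_def)
  then show "transpose X *v (X *v v) = v - (e \<bullet> v) *\<^sub>R e" by (simp add: w_def)
qed

lemma has_vector_derivative_vec_lambda:
  fixes F :: "real \<Rightarrow> 'm::finite \<Rightarrow> 'a::euclidean_space"
  assumes "\<And>j. ((\<lambda>t. F t j) has_vector_derivative F' j) (at t)"
  shows "((\<lambda>t. \<chi> j. F t j) has_vector_derivative (\<chi> j. F' j)) (at t)"
proof -
  have lin: "bounded_linear (axis j :: 'a \<Rightarrow> 'a^'m)" for j
    unfolding linear_conv_bounded_linear[symmetric] linear_iff by (simp add: vec_eq_iff axis_def)
  have eq: "(\<chi> j. v j) = (\<Sum>j\<in>UNIV. axis j (v j))" for v :: "'m \<Rightarrow> 'a"
    by (simp add: vec_eq_iff axis_def if_distrib cong: if_cong)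
  show ?thesis
    unfolding eq by (intro has_vector_derivative_sum bounded_linear.has_vector_derivative[OF lin] assms)
qed

text \<open>In dimension at least 3 the frame vectors are the images of \<open>\<eta> (Some j)\<close> under the rotation in the plane of
  \<open>\<eta> None\<close> and \<open>z \<tau>\<close> that carries \<open>\<eta> None\<close> to \<open>z \<tau>\<close>; in dimension 2 the only one is \<open>z \<tau>\<close> turned by a
  right angle.\<close>

lemma frame_vector_orthonormal:
  fixes z :: "real \<Rightarrow> real^'n" and \<eta> :: "'m::finite option \<Rightarrow> real^'n"
  assumes dim: "CARD('n) = CARD('m) + 1" and z: "norm (z \<tau>) = 1"
    and basis: "CARD('n) \<ge> 3 \<Longrightarrow> orthonormal_basis \<eta>"
    and noncollinear: "CARD('n) \<ge> 3 \<Longrightarrow> 1 + \<eta> None \<bullet> z \<tau> \<noteq> 0"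
    and "i1 \<noteq> i2"
  shows "z \<tau> \<bullet> frame_vector i1 i2 \<eta> z \<tau> j = 0"
    and "frame_vector i1 i2 \<eta> z \<tau> i \<bullet> frame_vector i1 i2 \<eta> z \<tau> j = (if i = j then 1 else 0)"
proof -
  have zz: "z \<tau> \<bullet> z \<tau> = 1" using z by (simp add: norm_eq_1)
  have "z \<tau> \<bullet> frame_vector i1 i2 \<eta> z \<tau> j = 0 \<and>
    frame_vector i1 i2 \<eta> z \<tau> i \<bullet> frame_vector i1 i2 \<eta> z \<tau> j = (if i = j then 1 else 0)"
  proof (cases "CARD('n) = 2")
    case True
    have "{i1, i2} = (UNIV :: 'n set)"
      using True \<open>i1 \<noteq> i2\<close> by (intro card_subset_eq) auto
    then have sum2: "(\<Sum>k\<in>UNIV. h k) = h i1 + h i2" for h :: "'n \<Rightarrow> real"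
      using \<open>i1 \<noteq> i2\<close> by (simp add: \<open>{i1, i2} = UNIV\<close>[symmetric])
    have "CARD('m) = 1" using True dim by simp
    then obtain m :: 'm where "UNIV = {m}" by (rule card_1_singletonE)
    then have "i = j" by (metis UNIV_I singletonD)
    moreover have "z \<tau> $ i1 * z \<tau> $ i1 + z \<tau> $ i2 * z \<tau> $ i2 = 1"
      using zz by (simp add: inner_vec_def sum2)
    ultimately show ?thesis
      using True \<open>i1 \<noteq> i2\<close> by (simp add: frame_vector_def inner_vec_def sum2 algebra_simps)
  next
    case False
    have "CARD('m) \<ge> 1" by (simp add: Suc_leI)
    with False dim have n3: "CARD('n) \<ge> 3" by linarith
    define b where "b = 1 + \<eta> None \<bullet> z \<tau>"
    have b: "b \<noteq> 0" using noncollinear[OF n3] by (simp add: b_def)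
    define a where "a = (\<lambda>j. \<eta> (Some j) \<bullet> z \<tau>)"
    have \<eta>: "\<eta> i \<bullet> \<eta> j = (if i = j then 1 else 0)" for i j
      using basis[OF n3] by (simp add: orthonormal_basis_def)
    define c where "c = \<eta> None + z \<tau>"
    have \<xi>: "frame_vector i1 i2 \<eta> z \<tau> j = \<eta> (Some j) - (a j / b) *\<^sub>R c" for j
      using False by (simp add: frame_vector_def a_def b_def c_def)
    have c: "\<eta> (Some j) \<bullet> c = a j" "c \<bullet> \<eta> (Some j) = a j" "z \<tau> \<bullet> c = b" "c \<bullet> c = 2 * b"
      "z \<tau> \<bullet> \<eta> (Some j) = a j" for j
      by (simp_all add: c_def a_def b_def inner_add_left inner_add_right \<eta> zz inner_commute[of "z \<tau>" "\<eta> k" for k])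
    have "z \<tau> \<bullet> frame_vector i1 i2 \<eta> z \<tau> j = 0"
      using b by (simp add: \<xi> inner_diff_right c)
    moreover have "frame_vector i1 i2 \<eta> z \<tau> i \<bullet> frame_vector i1 i2 \<eta> z \<tau> j = (if i = j then 1 else 0)"
      using b by (simp add: \<xi> inner_diff_right inner_diff_left c \<eta>)
    ultimately show ?thesis by blast
  qed
  then show "z \<tau> \<bullet> frame_vector i1 i2 \<eta> z \<tau> j = 0"
    "frame_vector i1 i2 \<eta> z \<tau> i \<bullet> frame_vector i1 i2 \<eta> z \<tau> j = (if i = j then 1 else 0)" by blast+
qed

lemma frame_vector_C1:
  fixes z :: "real \<Rightarrow> real^'n" and \<eta> :: "'m::finite option \<Rightarrow> real^'n"
  assumes z: "\<And>t. (z has_vector_derivative dz t) (at t)" "continuous_on UNIV dz"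
    and denominator: "\<And>t. CARD('n) \<noteq> 2 \<Longrightarrow> 1 + \<eta> None \<bullet> z t \<noteq> 0"
  obtains F' where "\<And>t. ((\<lambda>t. frame_vector i1 i2 \<eta> z t j) has_vector_derivative F' t) (at t)"
    "continuous_on UNIV F'"
proof (cases "CARD('n) = 2")
  case True
  define Rot where "Rot = (\<lambda>v :: real^'n. (\<chi> i. if i = i1 then - (v $ i2) else v $ i1) :: real^'n)"
  have Rot: "bounded_linear Rot"
    unfolding linear_conv_bounded_linear[symmetric] linear_iff Rot_def by (simp add: vec_eq_iff)
  have "frame_vector i1 i2 \<eta> z t j = Rot (z t)" for t using True by (simp add: frame_vector_def Rot_def)
  moreover have "((\<lambda>t. Rot (z t)) has_vector_derivative Rot (dz t)) (at t)" for t
    by (rule bounded_linear.has_vector_derivative[OF Rot z(1)])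
  moreover have "continuous_on UNIV (\<lambda>t. Rot (dz t))"
    by (rule bounded_linear.continuous_on[OF Rot z(2)])
  ultimately show thesis using that[of "\<lambda>t. Rot (dz t)"] by simp
next
  case False
  define b where "b = (\<lambda>t. 1 + \<eta> None \<bullet> z t)"
  have b: "b t \<noteq> 0" for t using denominator[OF False] by (simp add: b_def)
  define a where "a = (\<lambda>t. \<eta> (Some j) \<bullet> z t)"
  have z_cont: "continuous_on UNIV z"
    by (rule curve_continuous[OF z(1)])
  have inner: "((\<lambda>t. v \<bullet> z t) has_real_derivative v \<bullet> dz t) (at t)" for v t
    using bounded_linear.has_vector_derivative[OF bounded_linear_inner_right z(1)]
    by (simp add: has_real_derivative_iff_has_vector_derivative)
  have db: "(b has_real_derivative \<eta> None \<bullet> dz t) (at t)" for t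
    unfolding b_def using DERIV_add[OF DERIV_const inner] by simp
  have da: "(a has_real_derivative \<eta> (Some j) \<bullet> dz t) (at t)" for t
    unfolding a_def by (rule inner)
  define q' where "q' = (\<lambda>t. ((\<eta> (Some j) \<bullet> dz t) * b t - a t * (\<eta> None \<bullet> dz t)) / (b t * b t))"
  have "((\<lambda>t. a t / b t) has_real_derivative q' t) (at t)" for t
    unfolding q'_def by (rule DERIV_divide[OF da db b])
  then have dq: "((\<lambda>t. a t / b t) has_vector_derivative q' t) (at t)" for t
    by (simp add: has_real_derivative_iff_has_vector_derivative)
  define F' where "F' = (\<lambda>t. 0 - ((a t / b t) *\<^sub>R (0 + dz t) + q' t *\<^sub>R (\<eta> None + z t)))"
  show thesis
  proof (rule that[of F'])
    have "frame_vector i1 i2 \<eta> z t j = \<eta> (Some j) - (a t / b t) *\<^sub>R (\<eta> None + z t)" for t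
      using False by (simp add: frame_vector_def a_def b_def)
    moreover have "((\<lambda>t. \<eta> (Some j) - (a t / b t) *\<^sub>R (\<eta> None + z t)) has_vector_derivative F' t) (at t)" for t
      unfolding F'_def
      by (intro has_vector_derivative_diff has_vector_derivative_const has_vector_derivative_add z(1)
          bounded_bilinear.has_vector_derivative[OF bounded_bilinear_scaleR dq])
    ultimately show "((\<lambda>t. frame_vector i1 i2 \<eta> z t j) has_vector_derivative F' t) (at t)" for t by simp
    have "continuous_on UNIV a" "continuous_on UNIV b"
      unfolding a_def b_def by (intro continuous_on_add continuous_on_inner continuous_on_const z_cont)+
    then show "continuous_on UNIV F'"
      unfolding F'_def q'_def using b
      by (intro continuous_on_diff continuous_on_add continuous_on_scaleR continuous_on_divide continuous_on_mult
          continuous_on_inner continuous_on_const z_cont z(2)) auto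
  qed
qed

section \<open>The equivalence\<close>

theorem theorem3:
  fixes f :: "real^'n \<Rightarrow> real^'n"
    and T :: real
    and xs z :: "real \<Rightarrow> real^'n"
    and \<eta> :: "'m::finite option \<Rightarrow> real^'n"
    and i1 i2 :: 'n
    and Pm :: "real \<Rightarrow> real^'n^'m"
    and A :: "real \<Rightarrow> real^'m^'m"
  assumes dim: "CARD('n) = CARD('m) + 1"
    and f_smooth: "smooth f"
    and periodic: "nontrivial_periodic_solution f T xs"
    and normal: "transversal_normal_field f T xs z"
    and basis: "CARD('n) \<ge> 3 \<Longrightarrow> orthonormal_basis \<eta>"
    and noncollinear: "CARD('n) \<ge> 3 \<Longrightarrow> (\<forall>\<tau>. \<not> collinear {0, \<eta> None, z \<tau>})"
    and coords: "i1 \<noteq> i2"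
    and Pm: "Pm = projection i1 i2 \<eta> z"
    and A: "A = transverse_linearization f xs z Pm"
  shows "(exponentially_orbitally_stable f (orbit T xs) \<longleftrightarrow> linear_system_exponentially_stable A) \<and>
         (linear_system_exponentially_stable A \<longleftrightarrow> Lyapunov_condition f T xs z Pm A)"
proof -
  obtain \<delta> where \<delta>: "\<delta> > 0" "\<And>t. z t \<bullet> f (xs t) > \<delta>"
    using normal by (auto simp: transversal_normal_field_def)
  have z_smooth: "smooth z" and z_per: "\<And>t. z (t + T) = z t" and z_norm: "\<And>t. norm (z t) = 1"
    using normal by (auto simp: transversal_normal_field_def)
  \<comment> \<open>For unit vectors the denominator vanishes only if they are opposite.\<close>
  have denominator: "1 + \<eta> None \<bullet> z t \<noteq> 0" if n3: "CARD('n) \<ge> 3" for t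
  proof
    assume "1 + \<eta> None \<bullet> z t = 0"
    moreover have "\<eta> None \<bullet> \<eta> None = 1" using basis[OF n3] by (simp add: orthonormal_basis_def)
    moreover have "z t \<bullet> z t = 1" using z_norm by (simp add: norm_eq_1)
    ultimately have "(\<eta> None + z t) \<bullet> (\<eta> None + z t) = 0"
      by (simp add: inner_add_left inner_add_right inner_commute[of "z t" "\<eta> None"])
    then have "z t = (- 1) *\<^sub>R \<eta> None" by (simp add: eq_neg_iff_add_eq_0 add.commute)
    then have "collinear {0, \<eta> None, z t}" unfolding collinear_lemma by blast
    with noncollinear[OF n3] show False by blast
  qed
  have "CARD('m) \<ge> 1" by (simp add: Suc_leI)
  then have n3: "CARD('n) \<ge> 3" if "CARD('n) \<noteq> 2" using that dim by linarith
  note frame = frame_vector_orthonormal[OF dim z_norm basis denominator coords]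
  have "\<exists>F'. (\<forall>t. ((\<lambda>t. frame_vector i1 i2 \<eta> z t j) has_vector_derivative F' t) (at t)) \<and> continuous_on UNIV F'" for j
  proof -
    obtain F' where "\<And>t. ((\<lambda>t. frame_vector i1 i2 \<eta> z t j) has_vector_derivative F' t) (at t)"
      "continuous_on UNIV F'"
      using frame_vector_C1[where \<eta> = \<eta> and ?i1.0 = i1 and ?i2.0 = i2 and j = j,
          OF smooth_curve_C1[OF z_smooth] denominator[OF n3]] by blast
    then show ?thesis by (intro exI[of _ F']) simp
  qed
  then obtain F' where F': "\<And>t j. ((\<lambda>t. frame_vector i1 i2 \<eta> z t j) has_vector_derivative F' j t) (at t)"
    "\<And>j. continuous_on UNIV (F' j)"
    by metis
  have Pm_deriv: "(Pm has_vector_derivative (\<chi> j. F' j t)) (at t)" for t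
    unfolding Pm projection_def[abs_def] by (rule has_vector_derivative_vec_lambda) (rule F'(1))
  have dPm: "vector_derivative Pm (at t) = (\<chi> j. F' j t)" for t
    by (rule vector_derivative_at[OF Pm_deriv])
  interpret transversal_frame f T xs z Pm \<delta>
  proof
    show "(xs has_vector_derivative f (xs t)) (at t)" for t
      using periodic by (simp add: nontrivial_periodic_solution_def ode_solution_def)
    show "T > 0" "xs (t + T) = xs t" for t
      using periodic by (simp_all add: nontrivial_periodic_solution_def)
    show "\<not> (\<forall>t. xs (t + s) = xs t)" if "0 < s" "s < T" for s
      using periodic that by (simp add: nontrivial_periodic_solution_def)
    show "(Pm has_vector_derivative vector_derivative Pm (at t)) (at t)" for t
      unfolding dPm by (rule Pm_deriv)
    show "continuous_on UNIV (\<lambda>t. vector_derivative Pm (at t))"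
      unfolding dPm by (intro continuous_on_vec_lambda F'(2))
    show "Pm (t + T) = Pm t" for t
      unfolding Pm projection_def frame_vector_def z_per by (rule refl)
    show "Pm t *v z t = 0" for t
      unfolding Pm projection_def
      by (rule orthonormal_frame_projection(1)[OF dim z_norm frame])
    show "Pm t *v (transpose (Pm t) *v p) = p" for t p
      unfolding Pm projection_def
      by (rule orthonormal_frame_projection(2)[where e = "z t" and \<xi> = "frame_vector i1 i2 \<eta> z t" and p = p, OF dim z_norm frame])
    show "transpose (Pm t) *v (Pm t *v v) = v - (z t \<bullet> v) *\<^sub>R z t" for t v
      unfolding Pm projection_def
      using orthonormal_frame_projection(3)[where e = "z t" and \<xi> = "frame_vector i1 i2 \<eta> z t" and v = v, OF dim z_norm frame] by simp
  qed (fact smooth_jacobian[OF f_smooth] smooth_curve_C1[OF z_smooth] \<delta> z_per z_norm)+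
  have SPPD_one: "SPPD T (\<lambda>_. mat 1 :: real^'m^'m)" by (simp add: SPPD_def)
  have stable_imp_Lyapunov: "Lyapunov_condition f T xs z Pm A" if stable: "linear_system_exponentially_stable A"
  proof -
    obtain U r xp tau C where coordinates: "regular_coordinates U r xp tau C"
      by (rule regular_coordinates_exist)
    have "\<exists>!P. SPPD_Lyapunov_solution T A Q P" if "SPPD T Q \<and> continuous_on UNIV Q" for Q
      using linearized.stable_imp_ex1_Lyapunov_solution stable that unfolding A by blast
    moreover have "\<exists>W\<subseteq>U. verifies_exponential_orbital_stability f (orbit T xs) W (\<lambda>x. xp x \<bullet> (P (tau x) *v xp x))"
      if "SPPD T Q \<and> continuous_on UNIV Q" "SPPD_Lyapunov_solution T A Q P" for Q P
      using that unfolding A by (intro Lyapunov_solution_verifies[OF coordinates]) auto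
    ultimately show ?thesis
      unfolding Lyapunov_condition_def using coordinates unfolding regular_coordinates_def by meson
  qed
  have one: "SPPD T (\<lambda>_. mat 1 :: real^'m^'m) \<and> continuous_on UNIV (\<lambda>_::real. mat 1 :: real^'m^'m)"
    using SPPD_one by simp
  have Lyapunov_imp_stable: "linear_system_exponentially_stable A" if "Lyapunov_condition f T xs z Pm A"
  proof -
    have "\<exists>P. SPPD_Lyapunov_solution T A (\<lambda>_. mat 1) P"
      using that one unfolding Lyapunov_condition_def by blast
    then show ?thesis using Lyapunov_solution_imp_stable[OF T_pos] by blast
  qed
  have "exponentially_orbitally_stable f (orbit T xs)" if "linear_system_exponentially_stable A"
  proof -
    have "\<exists>U V. verifies_exponential_orbital_stability f (orbit T xs) U V"
      using stable_imp_Lyapunov[OF that] one unfolding Lyapunov_condition_def by blast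
    then show ?thesis
      using Lyapunov_function_imp_exponentially_orbitally_stable[OF f_lipschitz orbit_compact] by blast
  qed
  with stable_imp_Lyapunov Lyapunov_imp_stable show ?thesis
    using exponentially_orbitally_stable_imp_linearization_stable unfolding A by blast
qed

end
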